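(* An artin algebra $A$ is left weakly Gorenstein if and only if ${}^\perp A$ with its canonical exact structure is a Frobenius category.
   Context: Modules are finitely generated left $A$-modules; $\operatorname{mod}A$ is their category. ${}^\perp A$ is the full subcategory of semi-Gorenstein-projective modules, i.e. modules $M$ with $\operatorname{Ext}^i(M,A)=0$ for all $i\ge1$; it is extension-closed, and its canonical exact structure is the one induced by the embedding in $\operatorname{mod}A$ (the conflations are the short exact sequences of $\operatorname{mod}A$ with all terms in ${}^\perp A$). An exact category is Frobenius if it has enough projective and enough injective objects and its projective objects are exactly its injective objects. A complete projective resolution is a doubly infinite exact sequence $P^\bullet$ of projective left $A$-modules with differentials $d^i\colon P^i\to P^{i+1}$ such that $\operatorname{Hom}_A(P^\bullet,A)$ is again exact; a module is Gorenstein-projective if it is isomorphic to the image of $d^0$ for some complete projective resolution. $A$ is left weakly Gorenstein if every module in ${}^\perp A$ is Gorenstein-projective. *)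

theory Defs
  imports "HOL-Algebra.Module" "HOL-Algebra.RingHom" "HOL-Algebra.Elementary_Groups"
begin

section \<open>Left modules over a not necessarily commutative ring\<close>

text \<open>
  The locale \<^locale>\<open>module\<close> of the library assumes a commutative ring of scalars. We reuse its record
  type; as there, the fields \<open>mult\<close> and \<open>one\<close> of a module carry no meaning.
\<close>

locale left_module = R?: ring R + M?: abelian_group M
  for R :: "('a, 'r) ring_scheme" (structure) and M :: "('a, 'm, 's) module_scheme" (structure) +
  assumes smult_closed [simp, intro]:
      "\<lbrakk>a \<in> carrier R; x \<in> carrier M\<rbrakk> \<Longrightarrow> a \<odot>\<^bsub>M\<^esub> x \<in> carrier M"
    and smult_l_distr:
      "\<lbrakk>a \<in> carrier R; b \<in> carrier R; x \<in> carrier M\<rbrakk> \<Longrightarrow>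
        (a \<oplus>\<^bsub>R\<^esub> b) \<odot>\<^bsub>M\<^esub> x = (a \<odot>\<^bsub>M\<^esub> x) \<oplus>\<^bsub>M\<^esub> (b \<odot>\<^bsub>M\<^esub> x)"
    and smult_r_distr:
      "\<lbrakk>a \<in> carrier R; x \<in> carrier M; y \<in> carrier M\<rbrakk> \<Longrightarrow>
        a \<odot>\<^bsub>M\<^esub> (x \<oplus>\<^bsub>M\<^esub> y) = (a \<odot>\<^bsub>M\<^esub> x) \<oplus>\<^bsub>M\<^esub> (a \<odot>\<^bsub>M\<^esub> y)"
    and smult_assoc:
      "\<lbrakk>a \<in> carrier R; b \<in> carrier R; x \<in> carrier M\<rbrakk> \<Longrightarrow>
        (a \<otimes>\<^bsub>R\<^esub> b) \<odot>\<^bsub>M\<^esub> x = a \<odot>\<^bsub>M\<^esub> (b \<odot>\<^bsub>M\<^esub> x)"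
    and smult_one [simp]:
      "x \<in> carrier M \<Longrightarrow> \<one>\<^bsub>R\<^esub> \<odot>\<^bsub>M\<^esub> x = x"

definition fin_gen :: "('a, 'r) ring_scheme \<Rightarrow> ('a, 'm, 's) module_scheme \<Rightarrow> bool"
  where "fin_gen R M \<longleftrightarrow>
    (\<exists>S \<subseteq> carrier M. finite S \<and>
      carrier M = {\<Oplus>\<^bsub>M\<^esub>s\<in>S. c s \<odot>\<^bsub>M\<^esub> s | c. c \<in> S \<rightarrow> carrier R})"

definition regular_module :: "('a, 'r) ring_scheme \<Rightarrow> ('a, 'a) module"
  where "regular_module A =
    \<lparr>carrier = carrier A, mult = mult A, one = \<one>\<^bsub>A\<^esub>, zero = \<zero>\<^bsub>A\<^esub>, add = add A, smult = mult A\<rparr>"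

definition restrict_scalars :: "('k \<Rightarrow> 'a) \<Rightarrow> ('a, 'r) ring_scheme \<Rightarrow> ('k, 'a) module"
  where "restrict_scalars \<phi> A =
    \<lparr>carrier = carrier A, mult = mult A, one = \<one>\<^bsub>A\<^esub>, zero = \<zero>\<^bsub>A\<^esub>, add = add A,
     smult = (\<lambda>c x. \<phi> c \<otimes>\<^bsub>A\<^esub> x)\<rparr>"

text \<open>Morphisms are extensional, so that they are determined by their values on the carrier.\<close>

definition mod_hom ::
    "('a, 'r) ring_scheme \<Rightarrow> ('a, 'm, 's) module_scheme \<Rightarrow> ('a, 'n, 't) module_scheme \<Rightarrow> ('m \<Rightarrow> 'n) set"
  where "mod_hom R M N =
    {f \<in> carrier M \<rightarrow>\<^sub>E carrier N.
      (\<forall>x\<in>carrier M. \<forall>y\<in>carrier M. f (x \<oplus>\<^bsub>M\<^esub> y) = f x \<oplus>\<^bsub>N\<^esub> f y) \<and>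
      (\<forall>a\<in>carrier R. \<forall>x\<in>carrier M. f (a \<odot>\<^bsub>M\<^esub> x) = a \<odot>\<^bsub>N\<^esub> f x)}"

text \<open>The additive group of homomorphisms, as a \<^type>\<open>monoid\<close> record: \<open>mult\<close> is pointwise addition and
  \<open>one\<close> is the zero homomorphism.\<close>

definition hom_group ::
    "('a, 'r) ring_scheme \<Rightarrow> ('a, 'm, 's) module_scheme \<Rightarrow> ('a, 'n, 't) module_scheme \<Rightarrow> ('m \<Rightarrow> 'n) monoid"
  where "hom_group R M N =
    \<lparr>carrier = mod_hom R M N,
     mult = (\<lambda>f g. \<lambda>x\<in>carrier M. f x \<oplus>\<^bsub>N\<^esub> g x),
     one = (\<lambda>x\<in>carrier M. \<zero>\<^bsub>N\<^esub>)\<rparr>"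

text \<open>The map \<open>Hom(d,N) : Hom(Q,N) \<rightarrow> Hom(P,N)\<close> induced by \<open>d : P \<rightarrow> Q\<close>.\<close>

definition precomp :: "('a, 'm, 's) module_scheme \<Rightarrow> ('m \<Rightarrow> 'q) \<Rightarrow> ('q \<Rightarrow> 'n) \<Rightarrow> ('m \<Rightarrow> 'n)"
  where "precomp P d = (\<lambda>g. compose (carrier P) g d)"

definition mod_iso ::
    "('a, 'r) ring_scheme \<Rightarrow> ('a, 'm, 's) module_scheme \<Rightarrow> ('a, 'n, 't) module_scheme \<Rightarrow> bool"
  where "mod_iso R M N \<longleftrightarrow> (\<exists>f \<in> mod_hom R M N. bij_betw f (carrier M) (carrier N))"


section \<open>Artin algebras\<close>

locale artinian_cring = cring R for R (structure) +
  assumes descending_chain_condition: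
    "\<lbrakk>\<And>n::nat. ideal (I n) R; \<And>n. I (Suc n) \<subseteq> I n\<rbrakk> \<Longrightarrow> \<exists>n. \<forall>m\<ge>n. I m = I n"

text \<open>\<open>\<phi>\<close> is the structure map of the \<open>k\<close>-algebra \<open>A\<close>.\<close>

locale artin_algebra = k: artinian_cring k + A: ring A
  for k (structure) and \<phi> and A (structure) +
  assumes structure_map: "\<phi> \<in> ring_hom k A"
    and central: "\<lbrakk>c \<in> carrier k; x \<in> carrier A\<rbrakk> \<Longrightarrow> \<phi> c \<otimes>\<^bsub>A\<^esub> x = x \<otimes>\<^bsub>A\<^esub> \<phi> c"
    and finitely_generated: "fin_gen k (restrict_scalars \<phi> A)"


section \<open>Finitely generated modules\<close>

text \<open>
  A type of carriers for finitely generated modules has to be fixed. Every finitely generated left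
  \<open>A\<close>-module is isomorphic to a quotient of some \<open>A\<^sup>n\<close>. Realising \<open>A\<^sup>n\<close> by functions \<open>nat \<Rightarrow> 'a\<close>, the
  elements of such a quotient are cosets, hence of type \<open>(nat \<Rightarrow> 'a) set\<close>. Modules with this
  carrier type therefore represent all isomorphism classes of finitely generated modules.
\<close>

type_synonym 'a fgmod = "('a, (nat \<Rightarrow> 'a) set) module"
type_synonym 'a fgmap = "(nat \<Rightarrow> 'a) set \<Rightarrow> (nat \<Rightarrow> 'a) set"

definition fg_modules :: "('a, 'r) ring_scheme \<Rightarrow> 'a fgmod set"
  where "fg_modules A = {M. left_module A M \<and> fin_gen A M}"

definition projective_module :: "('a, 'r) ring_scheme \<Rightarrow> 'a fgmod \<Rightarrow> bool"
  where "projective_module A P \<longleftrightarrow>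
    P \<in> fg_modules A \<and>
    (\<forall>M\<in>fg_modules A. \<forall>N\<in>fg_modules A. \<forall>g\<in>mod_hom A M N. \<forall>f\<in>mod_hom A P N.
      g ` carrier M = carrier N \<longrightarrow> (\<exists>h\<in>mod_hom A P M. compose (carrier P) g h = f))"

definition short_exact ::
    "('a, 'r) ring_scheme \<Rightarrow> 'a fgmod \<Rightarrow> 'a fgmap \<Rightarrow> 'a fgmod \<Rightarrow> 'a fgmap \<Rightarrow> 'a fgmod \<Rightarrow> bool"
  where "short_exact A L i M p N \<longleftrightarrow>
    i \<in> mod_hom A L M \<and> p \<in> mod_hom A M N \<and>
    inj_on i (carrier L) \<and> i ` carrier L = a_kernel M N p \<and> p ` carrier M = carrier N"


section \<open>Ext and semi-Gorenstein-projective modules\<close>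

text \<open>\<open>\<dots> \<rightarrow> P 2 \<rightarrow> P 1 \<rightarrow> P 0 \<rightarrow> M \<rightarrow> 0\<close> with \<open>d n : P (n + 1) \<rightarrow> P n\<close> and \<open>e : P 0 \<rightarrow> M\<close>.\<close>

definition projective_resolution ::
    "('a, 'r) ring_scheme \<Rightarrow> 'a fgmod \<Rightarrow> (nat \<Rightarrow> 'a fgmod) \<Rightarrow> (nat \<Rightarrow> 'a fgmap) \<Rightarrow> 'a fgmap \<Rightarrow> bool"
  where "projective_resolution A M P d e \<longleftrightarrow>
    (\<forall>n. projective_module A (P n)) \<and>
    (\<forall>n. d n \<in> mod_hom A (P (Suc n)) (P n)) \<and>
    e \<in> mod_hom A (P 0) M \<and>
    e ` carrier (P 0) = carrier M \<and>
    d 0 ` carrier (P 1) = a_kernel (P 0) M e \<and>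
    (\<forall>n. d (Suc n) ` carrier (P (Suc (Suc n))) = a_kernel (P (Suc n)) (P n) (d n))"

definition cocycles ::
    "('a, 'r) ring_scheme \<Rightarrow> (nat \<Rightarrow> 'a fgmod) \<Rightarrow> (nat \<Rightarrow> 'a fgmap) \<Rightarrow> ('a, 'n, 's) module_scheme \<Rightarrow>
      nat \<Rightarrow> ((nat \<Rightarrow> 'a) set \<Rightarrow> 'n) set"
  where "cocycles A P d N n =
    kernel (hom_group A (P n) N) (hom_group A (P (Suc n)) N) (precomp (P (Suc n)) (d n))"

fun coboundaries ::
    "('a, 'r) ring_scheme \<Rightarrow> (nat \<Rightarrow> 'a fgmod) \<Rightarrow> (nat \<Rightarrow> 'a fgmap) \<Rightarrow> ('a, 'n, 's) module_scheme \<Rightarrow>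
      nat \<Rightarrow> ((nat \<Rightarrow> 'a) set \<Rightarrow> 'n) set"
  where
    "coboundaries A P d N 0 = {\<one>\<^bsub>hom_group A (P 0) N\<^esub>}"
  | "coboundaries A P d N (Suc n) = precomp (P (Suc n)) (d n) ` mod_hom A (P n) N"

text \<open>The \<open>n\<close>-th cohomology group of \<open>Hom(P,N)\<close> for a chosen projective resolution \<open>P\<close> of \<open>M\<close>.\<close>

definition Ext ::
    "('a, 'r) ring_scheme \<Rightarrow> nat \<Rightarrow> 'a fgmod \<Rightarrow> ('a, 'n, 's) module_scheme \<Rightarrow>
      ((nat \<Rightarrow> 'a) set \<Rightarrow> 'n) set monoid"
  where "Ext A n M N =
    (let (P, d, e) = (SOME (P, d, e). projective_resolution A M P d e)
     in (hom_group A (P n) N)\<lparr>carrier := cocycles A P d N n\<rparr> Mod coboundaries A P d N n)"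

definition semi_gorenstein_projective :: "('a, 'r) ring_scheme \<Rightarrow> 'a fgmod set"
  where "semi_gorenstein_projective A =
    {M \<in> fg_modules A. \<forall>i\<ge>1. trivial_group (Ext A i M (regular_module A))}"


section \<open>Gorenstein-projective modules\<close>

definition complete_projective_resolution ::
    "('a, 'r) ring_scheme \<Rightarrow> (int \<Rightarrow> 'a fgmod) \<Rightarrow> (int \<Rightarrow> 'a fgmap) \<Rightarrow> bool"
  where "complete_projective_resolution A P d \<longleftrightarrow>
    (\<forall>i. projective_module A (P i)) \<and>
    (\<forall>i. d i \<in> mod_hom A (P i) (P (i + 1))) \<and>
    (\<forall>i. d i ` carrier (P i) = a_kernel (P (i + 1)) (P (i + 2)) (d (i + 1))) \<and>
    (\<forall>i. precomp (P (i + 1)) (d (i + 1)) ` mod_hom A (P (i + 2)) (regular_module A) =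
      kernel (hom_group A (P (i + 1)) (regular_module A)) (hom_group A (P i) (regular_module A))
        (precomp (P i) (d i)))"

definition gorenstein_projective :: "('a, 'r) ring_scheme \<Rightarrow> 'a fgmod \<Rightarrow> bool"
  where "gorenstein_projective A M \<longleftrightarrow>
    M \<in> fg_modules A \<and>
    (\<exists>P d. complete_projective_resolution A P d \<and>
      mod_iso A M ((P 1)\<lparr>carrier := d 0 ` carrier (P 0)\<rparr>))"

definition left_weakly_gorenstein :: "('a, 'r) ring_scheme \<Rightarrow> bool"
  where "left_weakly_gorenstein A \<longleftrightarrow>
    (\<forall>M \<in> semi_gorenstein_projective A. gorenstein_projective A M)"


section \<open>Additive categories\<close>

text \<open>
  \<open>Hom C X Y\<close> is the abelian group of morphisms, again written multiplicatively, so that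
  \<open>\<one>\<^bsub>Hom C X Y\<^esub>\<close> is the zero morphism. \<open>Cmp C X Y Z g f\<close> is the composite of
  \<open>f : X \<rightarrow> Y\<close> and \<open>g : Y \<rightarrow> Z\<close>.
\<close>

record ('o, 'm) category =
  Ob :: "'o set"
  Hom :: "'o \<Rightarrow> 'o \<Rightarrow> 'm monoid"
  Id :: "'o \<Rightarrow> 'm"
  Cmp :: "'o \<Rightarrow> 'o \<Rightarrow> 'o \<Rightarrow> 'm \<Rightarrow> 'm \<Rightarrow> 'm"

definition Mor :: "('o, 'm, 's) category_scheme \<Rightarrow> 'o \<Rightarrow> 'o \<Rightarrow> 'm set"
  where "Mor C X Y = carrier (Hom C X Y)"

locale preadditive_category =
  fixes C :: "('o, 'm, 's) category_scheme"
  assumes hom_comm_group: "\<lbrakk>X \<in> Ob C; Y \<in> Ob C\<rbrakk> \<Longrightarrow> comm_group (Hom C X Y)"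
    and Id_closed: "X \<in> Ob C \<Longrightarrow> Id C X \<in> Mor C X X"
    and Cmp_closed:
      "\<lbrakk>X \<in> Ob C; Y \<in> Ob C; Z \<in> Ob C; f \<in> Mor C X Y; g \<in> Mor C Y Z\<rbrakk> \<Longrightarrow> Cmp C X Y Z g f \<in> Mor C X Z"
    and Cmp_Id_right: "\<lbrakk>X \<in> Ob C; Y \<in> Ob C; f \<in> Mor C X Y\<rbrakk> \<Longrightarrow> Cmp C X X Y f (Id C X) = f"
    and Cmp_Id_left: "\<lbrakk>X \<in> Ob C; Y \<in> Ob C; f \<in> Mor C X Y\<rbrakk> \<Longrightarrow> Cmp C X Y Y (Id C Y) f = f"
    and Cmp_assoc:
      "\<lbrakk>W \<in> Ob C; X \<in> Ob C; Y \<in> Ob C; Z \<in> Ob C; f \<in> Mor C W X; g \<in> Mor C X Y; h \<in> Mor C Y Z\<rbrakk> \<Longrightarrow>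
        Cmp C W Y Z h (Cmp C W X Y g f) = Cmp C W X Z (Cmp C X Y Z h g) f"
    and Cmp_add_right:
      "\<lbrakk>X \<in> Ob C; Y \<in> Ob C; Z \<in> Ob C; f \<in> Mor C X Y; f' \<in> Mor C X Y; g \<in> Mor C Y Z\<rbrakk> \<Longrightarrow>
        Cmp C X Y Z g (f \<otimes>\<^bsub>Hom C X Y\<^esub> f') = Cmp C X Y Z g f \<otimes>\<^bsub>Hom C X Z\<^esub> Cmp C X Y Z g f'"
    and Cmp_add_left:
      "\<lbrakk>X \<in> Ob C; Y \<in> Ob C; Z \<in> Ob C; f \<in> Mor C X Y; g \<in> Mor C Y Z; g' \<in> Mor C Y Z\<rbrakk> \<Longrightarrow>
        Cmp C X Y Z (g \<otimes>\<^bsub>Hom C Y Z\<^esub> g') f = Cmp C X Y Z g f \<otimes>\<^bsub>Hom C X Z\<^esub> Cmp C X Y Z g' f"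

definition zero_object :: "('o, 'm, 's) category_scheme \<Rightarrow> 'o \<Rightarrow> bool"
  where "zero_object C Z \<longleftrightarrow>
    Z \<in> Ob C \<and> (\<forall>X\<in>Ob C. (\<exists>!f. f \<in> Mor C X Z) \<and> (\<exists>!f. f \<in> Mor C Z X))"

definition biproduct ::
    "('o, 'm, 's) category_scheme \<Rightarrow> 'o \<Rightarrow> 'o \<Rightarrow> 'o \<Rightarrow> 'm \<Rightarrow> 'm \<Rightarrow> 'm \<Rightarrow> 'm \<Rightarrow> bool"
  where "biproduct C X Y S i j p q \<longleftrightarrow>
    S \<in> Ob C \<and> i \<in> Mor C X S \<and> j \<in> Mor C Y S \<and> p \<in> Mor C S X \<and> q \<in> Mor C S Y \<and>
    Cmp C X S X p i = Id C X \<and> Cmp C Y S Y q j = Id C Y \<and>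
    Cmp C X S Y q i = \<one>\<^bsub>Hom C X Y\<^esub> \<and> Cmp C Y S X p j = \<one>\<^bsub>Hom C Y X\<^esub> \<and>
    Cmp C S X S i p \<otimes>\<^bsub>Hom C S S\<^esub> Cmp C S Y S j q = Id C S"

locale additive_category = preadditive_category +
  assumes zero_object_exists: "\<exists>Z. zero_object C Z"
    and biproduct_exists: "\<lbrakk>X \<in> Ob C; Y \<in> Ob C\<rbrakk> \<Longrightarrow> \<exists>S i j p q. biproduct C X Y S i j p q"

definition isomorphism :: "('o, 'm, 's) category_scheme \<Rightarrow> 'o \<Rightarrow> 'o \<Rightarrow> 'm \<Rightarrow> bool"
  where "isomorphism C X Y f \<longleftrightarrow>
    f \<in> Mor C X Y \<and> (\<exists>g\<in>Mor C Y X. Cmp C X Y X g f = Id C X \<and> Cmp C Y X Y f g = Id C Y)"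

definition is_kernel :: "('o, 'm, 's) category_scheme \<Rightarrow> 'o \<Rightarrow> 'm \<Rightarrow> 'o \<Rightarrow> 'm \<Rightarrow> 'o \<Rightarrow> bool"
  where "is_kernel C L i M p N \<longleftrightarrow>
    i \<in> Mor C L M \<and> p \<in> Mor C M N \<and> Cmp C L M N p i = \<one>\<^bsub>Hom C L N\<^esub> \<and>
    (\<forall>T\<in>Ob C. \<forall>f\<in>Mor C T M. Cmp C T M N p f = \<one>\<^bsub>Hom C T N\<^esub> \<longrightarrow>
      (\<exists>!g. g \<in> Mor C T L \<and> Cmp C T L M i g = f))"

definition is_cokernel :: "('o, 'm, 's) category_scheme \<Rightarrow> 'o \<Rightarrow> 'm \<Rightarrow> 'o \<Rightarrow> 'm \<Rightarrow> 'o \<Rightarrow> bool"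
  where "is_cokernel C L i M p N \<longleftrightarrow>
    i \<in> Mor C L M \<and> p \<in> Mor C M N \<and> Cmp C L M N p i = \<one>\<^bsub>Hom C L N\<^esub> \<and>
    (\<forall>T\<in>Ob C. \<forall>f\<in>Mor C M T. Cmp C L M T f i = \<one>\<^bsub>Hom C L T\<^esub> \<longrightarrow>
      (\<exists>!g. g \<in> Mor C N T \<and> Cmp C M N T g p = f))"

text \<open>In both of the following the square consists of \<open>i : X \<rightarrow> Y\<close>, \<open>f : X \<rightarrow> X'\<close>,
  \<open>f' : Y \<rightarrow> Y'\<close> and \<open>i' : X' \<rightarrow> Y'\<close>.\<close>

definition pushout ::
    "('o, 'm, 's) category_scheme \<Rightarrow> 'o \<Rightarrow> 'o \<Rightarrow> 'o \<Rightarrow> 'o \<Rightarrow> 'm \<Rightarrow> 'm \<Rightarrow> 'm \<Rightarrow> 'm \<Rightarrow> bool"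
  where "pushout C X Y X' Y' i f f' i' \<longleftrightarrow>
    Y' \<in> Ob C \<and> f' \<in> Mor C Y Y' \<and> i' \<in> Mor C X' Y' \<and> Cmp C X Y Y' f' i = Cmp C X X' Y' i' f \<and>
    (\<forall>T\<in>Ob C. \<forall>u\<in>Mor C Y T. \<forall>v\<in>Mor C X' T. Cmp C X Y T u i = Cmp C X X' T v f \<longrightarrow>
      (\<exists>!w. w \<in> Mor C Y' T \<and> Cmp C Y Y' T w f' = u \<and> Cmp C X' Y' T w i' = v))"

definition pullback ::
    "('o, 'm, 's) category_scheme \<Rightarrow> 'o \<Rightarrow> 'o \<Rightarrow> 'o \<Rightarrow> 'o \<Rightarrow> 'm \<Rightarrow> 'm \<Rightarrow> 'm \<Rightarrow> 'm \<Rightarrow> bool"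
  where "pullback C X Y X' Y' i f f' i' \<longleftrightarrow>
    X \<in> Ob C \<and> i \<in> Mor C X Y \<and> f \<in> Mor C X X' \<and> Cmp C X Y Y' f' i = Cmp C X X' Y' i' f \<and>
    (\<forall>T\<in>Ob C. \<forall>u\<in>Mor C T Y. \<forall>v\<in>Mor C T X'. Cmp C T Y Y' f' u = Cmp C T X' Y' i' v \<longrightarrow>
      (\<exists>!w. w \<in> Mor C T X \<and> Cmp C T X Y i w = u \<and> Cmp C T X X' f w = v))"


section \<open>Exact categories and Frobenius categories\<close>

text \<open>A conflation \<open>L \<rightarrow> M \<rightarrow> N\<close> with maps \<open>i\<close> and \<open>p\<close> is the tuple \<open>(L, i, M, p, N)\<close>.\<close>

type_synonym ('o, 'm) conflations = "('o \<times> 'm \<times> 'o \<times> 'm \<times> 'o) set"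

definition inflation :: "('o, 'm) conflations \<Rightarrow> 'o \<Rightarrow> 'o \<Rightarrow> 'm \<Rightarrow> bool"
  where "inflation E L M i \<longleftrightarrow> (\<exists>p N. (L, i, M, p, N) \<in> E)"

definition deflation :: "('o, 'm) conflations \<Rightarrow> 'o \<Rightarrow> 'o \<Rightarrow> 'm \<Rightarrow> bool"
  where "deflation E M N p \<longleftrightarrow> (\<exists>L i. (L, i, M, p, N) \<in> E)"

text \<open>Quillen's axioms in the self-dual form of Keller and Buehler.\<close>

locale exact_category = additive_category C
  for C :: "('o, 'm, 's) category_scheme" +
  fixes E :: "('o, 'm) conflations"
  assumes conflation_kernel_cokernel:
      "(L, i, M, p, N) \<in> E \<Longrightarrow>
        L \<in> Ob C \<and> M \<in> Ob C \<and> N \<in> Ob C \<and> is_kernel C L i M p N \<and> is_cokernel C L i M p N"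
    and conflation_iso:
      "\<lbrakk>(L, i, M, p, N) \<in> E; L' \<in> Ob C; M' \<in> Ob C; N' \<in> Ob C; i' \<in> Mor C L' M'; p' \<in> Mor C M' N';
        isomorphism C L L' a; isomorphism C M M' b; isomorphism C N N' c;
        Cmp C L M M' b i = Cmp C L L' M' i' a; Cmp C M N N' c p = Cmp C M M' N' p' b\<rbrakk> \<Longrightarrow>
        (L', i', M', p', N') \<in> E"
    and Id_inflation: "X \<in> Ob C \<Longrightarrow> inflation E X X (Id C X)"
    and Id_deflation: "X \<in> Ob C \<Longrightarrow> deflation E X X (Id C X)"
    and inflation_Cmp:
      "\<lbrakk>inflation E X Y f; inflation E Y Z g\<rbrakk> \<Longrightarrow> inflation E X Z (Cmp C X Y Z g f)"
    and deflation_Cmp: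
      "\<lbrakk>deflation E X Y f; deflation E Y Z g\<rbrakk> \<Longrightarrow> deflation E X Z (Cmp C X Y Z g f)"
    and inflation_pushout:
      "\<lbrakk>inflation E X Y i; X' \<in> Ob C; f \<in> Mor C X X'\<rbrakk> \<Longrightarrow>
        \<exists>Y' f' i'. pushout C X Y X' Y' i f f' i' \<and> inflation E X' Y' i'"
    and deflation_pullback:
      "\<lbrakk>deflation E X' Y' p'; Y \<in> Ob C; g \<in> Mor C Y Y'\<rbrakk> \<Longrightarrow>
        \<exists>X p g'. pullback C X Y X' Y' p g' g p' \<and> deflation E X Y p"

definition projective_object ::
    "('o, 'm, 's) category_scheme \<Rightarrow> ('o, 'm) conflations \<Rightarrow> 'o \<Rightarrow> bool"
  where "projective_object C E P \<longleftrightarrow>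
    P \<in> Ob C \<and>
    (\<forall>M N p. deflation E M N p \<longrightarrow>
      (\<forall>f\<in>Mor C P N. \<exists>g\<in>Mor C P M. Cmp C P M N p g = f))"

definition injective_object ::
    "('o, 'm, 's) category_scheme \<Rightarrow> ('o, 'm) conflations \<Rightarrow> 'o \<Rightarrow> bool"
  where "injective_object C E I \<longleftrightarrow>
    I \<in> Ob C \<and>
    (\<forall>L M i. inflation E L M i \<longrightarrow>
      (\<forall>f\<in>Mor C L I. \<exists>g\<in>Mor C M I. Cmp C L M I g i = f))"

locale frobenius_category = exact_category +
  assumes enough_projectives:
      "X \<in> Ob C \<Longrightarrow> \<exists>P p. projective_object C E P \<and> deflation E P X p"
    and enough_injectives:
      "X \<in> Ob C \<Longrightarrow> \<exists>I i. injective_object C E I \<and> inflation E X I i"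
    and projective_iff_injective:
      "X \<in> Ob C \<Longrightarrow> projective_object C E X \<longleftrightarrow> injective_object C E X"


section \<open>Full subcategories of the category of finitely generated modules\<close>

definition full_subcategory ::
    "('a, 'r) ring_scheme \<Rightarrow> 'a fgmod set \<Rightarrow> ('a fgmod, 'a fgmap) category"
  where "full_subcategory A \<X> =
    \<lparr>Ob = \<X>, Hom = hom_group A, Id = (\<lambda>M. \<lambda>x\<in>carrier M. x),
     Cmp = (\<lambda>L M N g f. compose (carrier L) g f)\<rparr>"

definition canonical_conflations ::
    "('a, 'r) ring_scheme \<Rightarrow> 'a fgmod set \<Rightarrow> ('a fgmod, 'a fgmap) conflations"
  where "canonical_conflations A \<X> =
    {(L, i, M, p, N). L \<in> \<X> \<and> M \<in> \<X> \<and> N \<in> \<X> \<and> short_exact A L i M p N}"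

end

theory Submission
  imports Defs
begin

text \<open>
  Write \<open>\<X>\<close> for the class of semi-Gorenstein-projective modules. For \<open>N\<close> in \<open>\<X>\<close>, homomorphisms to \<open>A\<close> extend along
  every inclusion with cokernel \<open>N\<close>. Hence the same is true of homomorphisms to a projective module, which is a
  retract of a sum of copies of \<open>A\<close>: projective modules are injective objects of \<open>\<X>\<close>. They are also
  projective objects, they lie in \<open>\<X>\<close>, and every \<open>M\<close> in \<open>\<X>\<close> is a quotient of a projective module with kernel in \<open>\<X>\<close>.
  So there are enough projective objects, and the projective objects are precisely the projective modules,
  since every projective object is a retract of one. What may be missing is a conflation that starts at a
  given \<open>M\<close> and continues with a projective module.

  If \<open>A\<close> is left weakly Gorenstein, then \<open>M\<close> is the image of a differential of a complete resolution. All the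
  images in a complete resolution belong to \<open>\<X>\<close>, because each of them is resolved by the part to its left, so
  that the next term contains \<open>M\<close> with cokernel in \<open>\<X>\<close>. This gives enough injective objects; an injective object
  splits off such a projective module, hence is projective. Conversely, in a Frobenius category every \<open>M\<close> in \<open>\<X>\<close>
  starts a conflation with an injective, hence projective middle term and ends one as well.
  Iterating to both sides and splicing the conflations gives a complete resolution. It stays exact under
  \<open>Hom(-,A)\<close> as all the modules at which it is spliced are in \<open>\<X>\<close>
  (lemmas \<open>gorenstein_projective_embeds\<close> and \<open>gorenstein_projective_if_spliced\<close>).

  Three facts support this argument. First, resolutions by finitely generated modules exist because an artin
  algebra is left noetherian, which comes down to the theorem of Akizuki that a commutative artinian ring
  is noetherian (\<open>artinian_imp_noetherian\<close>). Second, membership in \<open>\<X>\<close>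
  does not depend on the resolution that computes the extension groups. Instead of comparing resolutions, \<open>\<X>\<close> is
  described as the greatest class of modules with vanishing first extension group by \<open>A\<close> and a syzygy in
  the class (\<open>perp\<close>, \<open>semi_gorenstein_projective_iff_perp\<close>). Closure under extensions is then a
  single step of the horseshoe lemma (\<open>perp_extension\<close>), and independence of the presentation follows
  from the pullback of two presentations (\<open>perp_syzygy\<close>). Third, an extension-closed class of finitely
  generated modules with a zero module is an exact category (\<open>exact\<close>).
\<close>

section \<open>Submodules, spans and homomorphisms\<close>

definition submod :: "('a, 'r) ring_scheme \<Rightarrow> ('a, 'm, 's) module_scheme \<Rightarrow> 'm set \<Rightarrow> bool"
  where "submod R M N \<longleftrightarrow> N \<subseteq> carrier M \<and> \<zero>\<^bsub>M\<^esub> \<in> N \<and>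
    (\<forall>x\<in>N. \<forall>y\<in>N. x \<oplus>\<^bsub>M\<^esub> y \<in> N) \<and> (\<forall>a\<in>carrier R. \<forall>x\<in>N. a \<odot>\<^bsub>M\<^esub> x \<in> N)"

text \<open>Linear combinations with varying index sets are awkward to split and to map; an inductive span has an
  induction rule instead, and does not depend on the submodule in which it is formed.\<close>

inductive_set spn :: "('a, 'r) ring_scheme \<Rightarrow> ('a, 'm, 's) module_scheme \<Rightarrow> 'm set \<Rightarrow> 'm set"
  for R :: "('a, 'r) ring_scheme" and M :: "('a, 'm, 's) module_scheme" and S :: "'m set"
  where
    spn_zero: "\<zero>\<^bsub>M\<^esub> \<in> spn R M S"
  | spn_base: "s \<in> S \<Longrightarrow> s \<in> spn R M S"
  | spn_add: "\<lbrakk>x \<in> spn R M S; y \<in> spn R M S\<rbrakk> \<Longrightarrow> x \<oplus>\<^bsub>M\<^esub> y \<in> spn R M S"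
  | spn_smult: "\<lbrakk>a \<in> carrier R; x \<in> spn R M S\<rbrakk> \<Longrightarrow> a \<odot>\<^bsub>M\<^esub> x \<in> spn R M S"

lemma submodD:
  assumes "submod R M N"
  shows "N \<subseteq> carrier M" "x \<in> N \<Longrightarrow> x \<in> carrier M" "\<zero>\<^bsub>M\<^esub> \<in> N"
    "\<lbrakk>x \<in> N; y \<in> N\<rbrakk> \<Longrightarrow> x \<oplus>\<^bsub>M\<^esub> y \<in> N" "\<lbrakk>a \<in> carrier R; x \<in> N\<rbrakk> \<Longrightarrow> a \<odot>\<^bsub>M\<^esub> x \<in> N"
  using assms unfolding submod_def by auto

lemma spn_least: "\<lbrakk>submod R M N; S \<subseteq> N\<rbrakk> \<Longrightarrow> spn R M S \<subseteq> N"
proof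
  fix x assume N: "submod R M N" "S \<subseteq> N" and x: "x \<in> spn R M S"
  from x show "x \<in> N"
    by (induction) (use N in \<open>auto dest: submodD\<close>)
qed

lemma spn_sub [simp]: "spn R (M\<lparr>carrier := N\<rparr>) S = spn R M S"
proof -
  have "x \<in> spn R M S" if "x \<in> spn R (M\<lparr>carrier := N\<rparr>) S" for x
    using that by induction (auto intro: spn.intros)
  moreover have "x \<in> spn R (M\<lparr>carrier := N\<rparr>) S" if "x \<in> spn R M S" for x
    using that
  proof induction
    case spn_zero
    show ?case using spn.spn_zero[of "M\<lparr>carrier := N\<rparr>" R S] by simp
  next
    case (spn_base s)
    then show ?case by (rule spn.spn_base)
  next
    case (spn_add x y)
    show ?case using spn.spn_add[OF spn_add.IH] by simp
  next
    case (spn_smult a x)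
    show ?case using spn.spn_smult[OF spn_smult.hyps(1) spn_smult.IH] by simp
  qed
  ultimately show ?thesis by blast
qed

lemma mod_homD:
  assumes "f \<in> mod_hom R M N"
  shows "x \<in> carrier M \<Longrightarrow> f x \<in> carrier N"
    "\<lbrakk>x \<in> carrier M; y \<in> carrier M\<rbrakk> \<Longrightarrow> f (x \<oplus>\<^bsub>M\<^esub> y) = f x \<oplus>\<^bsub>N\<^esub> f y"
    "\<lbrakk>a \<in> carrier R; x \<in> carrier M\<rbrakk> \<Longrightarrow> f (a \<odot>\<^bsub>M\<^esub> x) = a \<odot>\<^bsub>N\<^esub> f x"
    "f \<in> extensional (carrier M)"
  using assms unfolding mod_hom_def by (auto simp: PiE_def)

lemma mod_homI:
  assumes "\<And>x. x \<in> carrier M \<Longrightarrow> f x \<in> carrier N"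
    "\<And>x y. \<lbrakk>x \<in> carrier M; y \<in> carrier M\<rbrakk> \<Longrightarrow> x \<oplus>\<^bsub>M\<^esub> y \<in> carrier M \<and> f (x \<oplus>\<^bsub>M\<^esub> y) = f x \<oplus>\<^bsub>N\<^esub> f y"
    "\<And>a x. \<lbrakk>a \<in> carrier R; x \<in> carrier M\<rbrakk> \<Longrightarrow> a \<odot>\<^bsub>M\<^esub> x \<in> carrier M \<and> f (a \<odot>\<^bsub>M\<^esub> x) = a \<odot>\<^bsub>N\<^esub> f x"
  shows "(\<lambda>x\<in>carrier M. f x) \<in> mod_hom R M N"
  using assms unfolding mod_hom_def by auto

lemma mod_hom_eqI:
  assumes "f \<in> mod_hom R M N" "g \<in> mod_hom R M N'" "\<And>x. x \<in> carrier M \<Longrightarrow> f x = g x"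
  shows "f = g"
  using assms(1,2)[THEN mod_homD(4)] assms(3) by (rule extensionalityI)

lemma compose_eq_hom_iff:
  "h \<in> mod_hom R L N \<Longrightarrow> compose (carrier L) g f = h \<longleftrightarrow> (\<forall>x\<in>carrier L. g (f x) = h x)"
  using mod_homD(4)[of h R L N] by (auto simp: compose_def fun_eq_iff extensional_def)

lemma compose_eq_compose_iff:
  "compose C g f = compose C g' f' \<longleftrightarrow> (\<forall>x\<in>C. g (f x) = g' (f' x))"
  by (auto simp: compose_def fun_eq_iff)

lemma compose_mod_hom:
  assumes "left_module R L" "f \<in> mod_hom R L M" "g \<in> mod_hom R M N"
  shows "compose (carrier L) g f \<in> mod_hom R L N"
proof -
  interpret left_module R L by fact
  show ?thesis unfolding compose_def
    by (rule mod_homI) (use assms(2,3) in \<open>auto simp: mod_homD\<close>)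
qed

text \<open>Every algebraic law passes along a surjection that respects the operations; quotients and
  transported structures are modules for this one reason.\<close>

lemma left_module_image:
  fixes M :: "('a, 'm, 's) module_scheme" and Q :: "('a, 'q, 't) module_scheme"
  assumes M: "left_module R M" and q: "q ` carrier M = carrier Q"
    and add: "\<And>x y. \<lbrakk>x \<in> carrier M; y \<in> carrier M\<rbrakk> \<Longrightarrow> q (x \<oplus>\<^bsub>M\<^esub> y) = q x \<oplus>\<^bsub>Q\<^esub> q y"
    and smult: "\<And>a x. \<lbrakk>a \<in> carrier R; x \<in> carrier M\<rbrakk> \<Longrightarrow> q (a \<odot>\<^bsub>M\<^esub> x) = a \<odot>\<^bsub>Q\<^esub> q x"
    and zero: "q \<zero>\<^bsub>M\<^esub> = \<zero>\<^bsub>Q\<^esub>"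
  shows "left_module R Q"
proof -
  interpret left_module R M by fact
  have rep: "\<exists>x\<in>carrier M. u = q x" if "u \<in> carrier Q" for u using that q by auto
  have cl: "q x \<in> carrier Q" if "x \<in> carrier M" for x using that q by auto
  have "abelian_group Q"
  proof (rule abelian_groupI)
    fix u v assume "u \<in> carrier Q" "v \<in> carrier Q"
    then obtain x y where xy: "u = q x" "v = q y" "x \<in> carrier M" "y \<in> carrier M" using rep by blast
    show "u \<oplus>\<^bsub>Q\<^esub> v \<in> carrier Q" using xy by (simp flip: add add: cl)
    show "u \<oplus>\<^bsub>Q\<^esub> v = v \<oplus>\<^bsub>Q\<^esub> u" using xy by (simp flip: add add: M.a_comm)
    fix w assume "w \<in> carrier Q"
    then obtain z where "w = q z" "z \<in> carrier M" using rep by blast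
    then show "u \<oplus>\<^bsub>Q\<^esub> v \<oplus>\<^bsub>Q\<^esub> w = u \<oplus>\<^bsub>Q\<^esub> (v \<oplus>\<^bsub>Q\<^esub> w)"
      using xy by (simp flip: add add: M.a_assoc)
  next
    show "\<zero>\<^bsub>Q\<^esub> \<in> carrier Q" using cl[of "\<zero>\<^bsub>M\<^esub>"] zero by simp
  next
    fix u assume "u \<in> carrier Q"
    then obtain x where x: "u = q x" "x \<in> carrier M" using rep by blast
    show "\<zero>\<^bsub>Q\<^esub> \<oplus>\<^bsub>Q\<^esub> u = u" using x by (simp flip: add zero)
    have "q (\<ominus>\<^bsub>M\<^esub> x) \<oplus>\<^bsub>Q\<^esub> u = \<zero>\<^bsub>Q\<^esub>" using x by (simp flip: add zero add: M.l_neg)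
    then show "\<exists>v\<in>carrier Q. v \<oplus>\<^bsub>Q\<^esub> u = \<zero>\<^bsub>Q\<^esub>" using x cl by blast
  qed
  moreover have "left_module_axioms R Q"
  proof
    fix a u assume a: "a \<in> carrier R" and "u \<in> carrier Q"
    then obtain x where x: "u = q x" "x \<in> carrier M" using rep by blast
    show "a \<odot>\<^bsub>Q\<^esub> u \<in> carrier Q" using x a by (simp flip: smult add: cl)
    fix b assume b: "b \<in> carrier R"
    show "(a \<oplus>\<^bsub>R\<^esub> b) \<odot>\<^bsub>Q\<^esub> u = a \<odot>\<^bsub>Q\<^esub> u \<oplus>\<^bsub>Q\<^esub> b \<odot>\<^bsub>Q\<^esub> u"
      using x a b by (simp flip: smult add add: smult_l_distr)
    show "(a \<otimes>\<^bsub>R\<^esub> b) \<odot>\<^bsub>Q\<^esub> u = a \<odot>\<^bsub>Q\<^esub> (b \<odot>\<^bsub>Q\<^esub> u)"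
      using x a b by (simp flip: smult add: smult_assoc)
  next
    fix a u v assume a: "a \<in> carrier R" and "u \<in> carrier Q" "v \<in> carrier Q"
    then obtain x y where x: "u = q x" "x \<in> carrier M" "v = q y" "y \<in> carrier M" using rep by blast
    show "a \<odot>\<^bsub>Q\<^esub> (u \<oplus>\<^bsub>Q\<^esub> v) = a \<odot>\<^bsub>Q\<^esub> u \<oplus>\<^bsub>Q\<^esub> a \<odot>\<^bsub>Q\<^esub> v"
      using x a by (simp flip: smult add add: smult_r_distr)
  next
    fix u assume "u \<in> carrier Q"
    then obtain x where x: "u = q x" "x \<in> carrier M" using rep by blast
    show "\<one>\<^bsub>R\<^esub> \<odot>\<^bsub>Q\<^esub> u = u" using x by (simp flip: smult)
  qed
  ultimately show ?thesis using R.ring_axioms by (intro left_module.intro)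
qed

context left_module
begin

lemma smult_l_null: "x \<in> carrier M \<Longrightarrow> \<zero>\<^bsub>R\<^esub> \<odot>\<^bsub>M\<^esub> x = \<zero>\<^bsub>M\<^esub>"
  using smult_l_distr[of "\<zero>\<^bsub>R\<^esub>" "\<zero>\<^bsub>R\<^esub>" x] by (metis M.add.r_cancel_one' R.l_zero R.zero_closed smult_closed)

lemma smult_r_null: "a \<in> carrier R \<Longrightarrow> a \<odot>\<^bsub>M\<^esub> \<zero>\<^bsub>M\<^esub> = \<zero>\<^bsub>M\<^esub>"
  using smult_r_distr[of a "\<zero>\<^bsub>M\<^esub>" "\<zero>\<^bsub>M\<^esub>"] by (metis M.add.r_cancel_one' M.l_zero M.zero_closed smult_closed)

lemma smult_minus_one: "x \<in> carrier M \<Longrightarrow> (\<ominus>\<^bsub>R\<^esub> \<one>\<^bsub>R\<^esub>) \<odot>\<^bsub>M\<^esub> x = \<ominus>\<^bsub>M\<^esub> x"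
proof -
  assume x: "x \<in> carrier M"
  have "(\<ominus>\<^bsub>R\<^esub> \<one>\<^bsub>R\<^esub>) \<odot>\<^bsub>M\<^esub> x \<oplus>\<^bsub>M\<^esub> x = (\<ominus>\<^bsub>R\<^esub> \<one>\<^bsub>R\<^esub> \<oplus>\<^bsub>R\<^esub> \<one>\<^bsub>R\<^esub>) \<odot>\<^bsub>M\<^esub> x"
    using x by (subst smult_l_distr) auto
  also have "\<dots> = \<zero>\<^bsub>M\<^esub>" using x by (simp add: R.l_neg smult_l_null)
  finally show ?thesis using x M.minus_equality[of _ x] by simp
qed

lemma smult_r_minus: "\<lbrakk>a \<in> carrier R; x \<in> carrier M\<rbrakk> \<Longrightarrow> a \<odot>\<^bsub>M\<^esub> (\<ominus>\<^bsub>M\<^esub> x) = \<ominus>\<^bsub>M\<^esub> (a \<odot>\<^bsub>M\<^esub> x)"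
proof -
  assume x: "a \<in> carrier R" "x \<in> carrier M"
  have "a \<odot>\<^bsub>M\<^esub> (\<ominus>\<^bsub>M\<^esub> x) \<oplus>\<^bsub>M\<^esub> a \<odot>\<^bsub>M\<^esub> x = \<zero>\<^bsub>M\<^esub>"
    using x by (subst smult_r_distr[symmetric]) (auto simp: M.l_neg smult_r_null)
  then show ?thesis using x M.minus_equality[of _ "a \<odot>\<^bsub>M\<^esub> x"] by simp
qed

lemma submod_minus: "\<lbrakk>submod R M N; x \<in> N\<rbrakk> \<Longrightarrow> \<ominus>\<^bsub>M\<^esub> x \<in> N"
  using submodD(5)[of R M N "\<ominus>\<^bsub>R\<^esub> \<one>\<^bsub>R\<^esub>" x] submodD(2)[of R M N x] by (simp add: smult_minus_one)

lemma submod_diff: "\<lbrakk>submod R M N; x \<in> N; y \<in> N\<rbrakk> \<Longrightarrow> x \<ominus>\<^bsub>M\<^esub> y \<in> N"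
  by (simp add: a_minus_def submodD submod_minus)

lemma submod_left_module:
  assumes N: "submod R M N"
  shows "left_module R (M\<lparr>carrier := N\<rparr>)"
proof -
  note [simp] = submodD[OF N]
  have "abelian_group (M\<lparr>carrier := N\<rparr>)"
  proof (rule abelian_groupI)
    fix x assume "x \<in> carrier (M\<lparr>carrier := N\<rparr>)"
    then show "\<exists>y\<in>carrier (M\<lparr>carrier := N\<rparr>). y \<oplus>\<^bsub>M\<lparr>carrier := N\<rparr>\<^esub> x = \<zero>\<^bsub>M\<lparr>carrier := N\<rparr>\<^esub>"
      using submod_minus[OF N, of x] M.l_neg[of x] by (auto intro!: bexI[of _ "\<ominus>\<^bsub>M\<^esub> x"])
  qed (auto simp: M.a_ac)
  moreover have "left_module_axioms R (M\<lparr>carrier := N\<rparr>)"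
    by standard (auto simp: smult_l_distr smult_r_distr smult_assoc)
  ultimately show ?thesis using R.ring_axioms by (intro left_module.intro)
qed

lemma submod_carrier: "submod R M (carrier M)" by (auto simp: submod_def)
lemma submod_zero: "submod R M {\<zero>\<^bsub>M\<^esub>}" by (auto simp: submod_def smult_r_null)

lemma spn_submod: "S \<subseteq> carrier M \<Longrightarrow> submod R M (spn R M S)"
  unfolding submod_def using spn_least[OF submod_carrier] by (auto intro: spn.intros)

lemma diff_add_cancel: "\<lbrakk>x \<in> carrier M; y \<in> carrier M\<rbrakk> \<Longrightarrow> (x \<ominus>\<^bsub>M\<^esub> y) \<oplus>\<^bsub>M\<^esub> y = x"
  by (simp add: a_minus_def M.a_assoc M.l_neg)

lemma diff_eq_zero_iff [simp]:
  "\<lbrakk>x \<in> carrier M; y \<in> carrier M\<rbrakk> \<Longrightarrow> x \<ominus>\<^bsub>M\<^esub> y = \<zero>\<^bsub>M\<^esub> \<longleftrightarrow> x = y"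
  using diff_add_cancel[of x y] by (auto simp: a_minus_def M.r_neg)

lemma diff_self [simp]: "x \<in> carrier M \<Longrightarrow> x \<ominus>\<^bsub>M\<^esub> x = \<zero>\<^bsub>M\<^esub>"
  by simp

lemma add_diff_cancel: "\<lbrakk>x \<in> carrier M; y \<in> carrier M\<rbrakk> \<Longrightarrow> (x \<oplus>\<^bsub>M\<^esub> y) \<ominus>\<^bsub>M\<^esub> y = x"
  by (simp add: a_minus_def M.a_assoc M.r_neg)

lemma add_diff_add:
  assumes "x \<in> carrier M" "y \<in> carrier M" "x' \<in> carrier M" "y' \<in> carrier M"
  shows "(x \<oplus>\<^bsub>M\<^esub> y) \<ominus>\<^bsub>M\<^esub> (x' \<oplus>\<^bsub>M\<^esub> y') = (x \<ominus>\<^bsub>M\<^esub> x') \<oplus>\<^bsub>M\<^esub> (y \<ominus>\<^bsub>M\<^esub> y')"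
  using assms by (simp add: a_minus_def M.minus_add M.a_ac)

lemma add_eq_add_iff:
  assumes "x \<in> carrier M" "y \<in> carrier M" "x' \<in> carrier M" "y' \<in> carrier M"
  shows "x \<oplus>\<^bsub>M\<^esub> y = x' \<oplus>\<^bsub>M\<^esub> y' \<longleftrightarrow> x \<ominus>\<^bsub>M\<^esub> x' = y' \<ominus>\<^bsub>M\<^esub> y"
proof -
  have "x \<oplus>\<^bsub>M\<^esub> y = x' \<oplus>\<^bsub>M\<^esub> y' \<longleftrightarrow> (x \<oplus>\<^bsub>M\<^esub> y) \<ominus>\<^bsub>M\<^esub> (x' \<oplus>\<^bsub>M\<^esub> y') = \<zero>\<^bsub>M\<^esub>"
    using assms by simp
  also have "\<dots> \<longleftrightarrow> (x \<ominus>\<^bsub>M\<^esub> x') \<oplus>\<^bsub>M\<^esub> (y \<ominus>\<^bsub>M\<^esub> y') = \<zero>\<^bsub>M\<^esub>" using assms by (simp add: add_diff_add)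
  also have "y \<ominus>\<^bsub>M\<^esub> y' = \<ominus>\<^bsub>M\<^esub> (y' \<ominus>\<^bsub>M\<^esub> y)" using assms by (simp add: a_minus_def M.minus_add M.a_ac)
  also have "(x \<ominus>\<^bsub>M\<^esub> x') \<oplus>\<^bsub>M\<^esub> \<ominus>\<^bsub>M\<^esub> (y' \<ominus>\<^bsub>M\<^esub> y) = (x \<ominus>\<^bsub>M\<^esub> x') \<ominus>\<^bsub>M\<^esub> (y' \<ominus>\<^bsub>M\<^esub> y)"
    by (simp add: a_minus_def)
  finally show ?thesis using assms by simp
qed

end

lemma left_module_zero_closed: "left_module R M \<Longrightarrow> \<zero>\<^bsub>M\<^esub> \<in> carrier M"
  using submodD(3)[OF left_module.submod_carrier] .

locale module_hom = M: left_module R M + N: left_module R N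
  for R :: "('a, 'r) ring_scheme" and M :: "('a, 'm, 's) module_scheme"
    and N :: "('a, 'n, 't) module_scheme" and f +
  assumes hom: "f \<in> mod_hom R M N"
begin

lemma f_closed [simp]: "x \<in> carrier M \<Longrightarrow> f x \<in> carrier N"
  and f_add: "\<lbrakk>x \<in> carrier M; y \<in> carrier M\<rbrakk> \<Longrightarrow> f (x \<oplus>\<^bsub>M\<^esub> y) = f x \<oplus>\<^bsub>N\<^esub> f y"
  and f_smult: "\<lbrakk>a \<in> carrier R; x \<in> carrier M\<rbrakk> \<Longrightarrow> f (a \<odot>\<^bsub>M\<^esub> x) = a \<odot>\<^bsub>N\<^esub> f x"
  using mod_homD[OF hom] by auto

lemma f_zero [simp]: "f \<zero>\<^bsub>M\<^esub> = \<zero>\<^bsub>N\<^esub>"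
  using f_smult[of "\<zero>\<^bsub>R\<^esub>" "\<zero>\<^bsub>M\<^esub>"] by (simp add: M.smult_l_null N.smult_l_null)

lemma f_minus: "x \<in> carrier M \<Longrightarrow> f (\<ominus>\<^bsub>M\<^esub> x) = \<ominus>\<^bsub>N\<^esub> f x"
  using f_smult[of "\<ominus>\<^bsub>R\<^esub> \<one>\<^bsub>R\<^esub>" x] by (simp add: M.smult_minus_one N.smult_minus_one)

lemma f_diff: "\<lbrakk>x \<in> carrier M; y \<in> carrier M\<rbrakk> \<Longrightarrow> f (x \<ominus>\<^bsub>M\<^esub> y) = f x \<ominus>\<^bsub>N\<^esub> f y"
  by (simp add: a_minus_def f_add f_minus)

lemma submod_kernel: "submod R M (a_kernel M N f)"
  by (auto simp: submod_def a_kernel_def' f_add f_smult N.smult_r_null)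

lemma submod_preimage: "submod R N K \<Longrightarrow> submod R M {x \<in> carrier M. f x \<in> K}"
  by (auto simp: submod_def f_add f_smult)

lemma submod_image:
  assumes "submod R M K"
  shows "submod R N (f ` K)"
  unfolding submod_def
proof safe
  fix x y assume "x \<in> K" "y \<in> K"
  then show "f x \<oplus>\<^bsub>N\<^esub> f y \<in> f ` K" using submodD[OF assms] by (metis f_add image_eqI)
next
  fix a x assume "a \<in> carrier R" "x \<in> K"
  then show "a \<odot>\<^bsub>N\<^esub> f x \<in> f ` K" using submodD[OF assms] by (metis f_smult image_eqI)
qed (use submodD[OF assms] in \<open>auto simp flip: f_zero\<close>)

lemma spn_image:
  assumes "S \<subseteq> carrier M"
  shows "f ` spn R M S = spn R N (f ` S)"
proof
  show "spn R N (f ` S) \<subseteq> f ` spn R M S"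
    by (intro spn_least submod_image M.spn_submod assms image_mono) (auto intro: spn.intros)
  have sub: "submod R N (spn R N (f ` S))" using assms by (intro N.spn_submod) auto
  have "spn R M S \<subseteq> {x \<in> carrier M. f x \<in> spn R N (f ` S)}"
    by (rule spn_least[OF submod_preimage[OF sub]]) (use assms in \<open>auto intro: spn.intros\<close>)
  then show "f ` spn R M S \<subseteq> spn R N (f ` S)" by auto
qed

lemma inj_iff: "inj_on f (carrier M) \<longleftrightarrow> (\<forall>x\<in>carrier M. f x = \<zero>\<^bsub>N\<^esub> \<longrightarrow> x = \<zero>\<^bsub>M\<^esub>)"
proof
  assume "inj_on f (carrier M)"
  then show "\<forall>x\<in>carrier M. f x = \<zero>\<^bsub>N\<^esub> \<longrightarrow> x = \<zero>\<^bsub>M\<^esub>"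
    by (metis M.zero_closed f_zero inj_onD)
next
  assume *: "\<forall>x\<in>carrier M. f x = \<zero>\<^bsub>N\<^esub> \<longrightarrow> x = \<zero>\<^bsub>M\<^esub>"
  show "inj_on f (carrier M)"
  proof (rule inj_onI)
    fix x y assume xy: "x \<in> carrier M" "y \<in> carrier M" "f x = f y"
    then have "f (x \<ominus>\<^bsub>M\<^esub> y) = \<zero>\<^bsub>N\<^esub>" by (simp add: f_diff)
    then have "x \<ominus>\<^bsub>M\<^esub> y = \<zero>\<^bsub>M\<^esub>" using * xy by simp
    then show "x = y" using xy by simp
  qed
qed

end

lemma sub_incl_hom:
  assumes "left_module R M" "submod R M N"
  shows "(\<lambda>x\<in>N. x) \<in> mod_hom R (M\<lparr>carrier := N\<rparr>) M"
  using mod_homI[of "M\<lparr>carrier := N\<rparr>" "\<lambda>x. x" M R] submodD[OF assms(2)] by simp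

lemma restrict_hom:
  assumes "submod R M N" "f \<in> mod_hom R M T"
  shows "restrict f N \<in> mod_hom R (M\<lparr>carrier := N\<rparr>) T"
  using mod_homI[of "M\<lparr>carrier := N\<rparr>" f T R] submodD[OF assms(1)] mod_homD[OF assms(2)] by simp

lemma corestrict_hom:
  assumes "f \<in> mod_hom R M T" "f ` carrier M \<subseteq> N"
  shows "f \<in> mod_hom R M (T\<lparr>carrier := N\<rparr>)"
  using assms unfolding mod_hom_def by (auto simp: PiE_def)

lemma sub_hom_hom:
  assumes "f \<in> mod_hom R M (T\<lparr>carrier := N\<rparr>)" "N \<subseteq> carrier T"
  shows "f \<in> mod_hom R M T"
  using assms unfolding mod_hom_def by (auto simp: PiE_def Pi_iff)

lemma id_hom: "left_module R M \<Longrightarrow> (\<lambda>x\<in>carrier M. x) \<in> mod_hom R M M"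
proof -
  assume "left_module R M"
  then interpret left_module R M .
  show ?thesis by (rule mod_homI) auto
qed

lemma zero_hom:
  assumes "left_module R M" "left_module R N"
  shows "(\<lambda>x\<in>carrier M. \<zero>\<^bsub>N\<^esub>) \<in> mod_hom R M N"
proof -
  interpret M: left_module R M by fact
  interpret N: left_module R N by fact
  show ?thesis by (rule mod_homI) (auto simp: N.smult_r_null)
qed

lemma add_hom:
  assumes "left_module R M" "left_module R N" "f \<in> mod_hom R M N" "g \<in> mod_hom R M N"
  shows "(\<lambda>x\<in>carrier M. f x \<oplus>\<^bsub>N\<^esub> g x) \<in> mod_hom R M N"
proof -
  interpret M: left_module R M by fact
  interpret N: left_module R N by fact
  show ?thesis by (rule mod_homI)
    (use assms(3,4) in \<open>auto simp: mod_homD N.a_ac N.smult_r_distr\<close>)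
qed

lemma minus_hom:
  assumes "left_module R M" "left_module R N" "f \<in> mod_hom R M N"
  shows "(\<lambda>x\<in>carrier M. \<ominus>\<^bsub>N\<^esub> f x) \<in> mod_hom R M N"
proof -
  interpret M: left_module R M by fact
  interpret N: left_module R N by fact
  show ?thesis by (rule mod_homI)
    (use assms(3) in \<open>auto simp: mod_homD N.minus_add N.a_ac N.smult_r_minus\<close>)
qed

text \<open>A map out of a module that is the sum of two images may be prescribed on the two parts,
  provided that the prescriptions agree wherever the images meet. Maps out of quotients (take one
  part to be zero), out of direct sums and out of pushouts all arise in this way.\<close>

lemma glue_hom:
  fixes T :: "('a, 't, 'u) module_scheme"
  assumes "left_module R L" "left_module R P" "left_module R X" "left_module R T"
    and a: "a \<in> mod_hom R L X" and b: "b \<in> mod_hom R P X"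
    and f: "f \<in> mod_hom R L T" and u: "u \<in> mod_hom R P T"
    and surj: "\<And>x. x \<in> carrier X \<Longrightarrow> \<exists>l\<in>carrier L. \<exists>p\<in>carrier P. x = a l \<oplus>\<^bsub>X\<^esub> b p"
    and agree: "\<And>l p. \<lbrakk>l \<in> carrier L; p \<in> carrier P; a l = b p\<rbrakk> \<Longrightarrow> f l = u p"
  shows "\<exists>g\<in>mod_hom R X T. (\<forall>l\<in>carrier L. g (a l) = f l) \<and> (\<forall>p\<in>carrier P. g (b p) = u p)"
proof -
  interpret a: module_hom R L X a by (intro module_hom.intro module_hom_axioms.intro assms)
  interpret b: module_hom R P X b by (intro module_hom.intro module_hom_axioms.intro assms)
  interpret f: module_hom R L T f by (intro module_hom.intro module_hom_axioms.intro assms)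
  interpret u: module_hom R P T u by (intro module_hom.intro module_hom_axioms.intro assms)
  define g where "g x = (SOME t. \<exists>l\<in>carrier L. \<exists>p\<in>carrier P. x = a l \<oplus>\<^bsub>X\<^esub> b p \<and> t = f l \<oplus>\<^bsub>T\<^esub> u p)" for x
  have g: "g (a l \<oplus>\<^bsub>X\<^esub> b p) = f l \<oplus>\<^bsub>T\<^esub> u p" if lp: "l \<in> carrier L" "p \<in> carrier P" for l p
  proof -
    have "\<exists>t. \<exists>l'\<in>carrier L. \<exists>p'\<in>carrier P. a l \<oplus>\<^bsub>X\<^esub> b p = a l' \<oplus>\<^bsub>X\<^esub> b p' \<and> t = f l' \<oplus>\<^bsub>T\<^esub> u p'"
      using lp by blast
    from someI_ex[OF this] obtain l' p' where l'p': "l' \<in> carrier L" "p' \<in> carrier P"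
      "a l \<oplus>\<^bsub>X\<^esub> b p = a l' \<oplus>\<^bsub>X\<^esub> b p'" "g (a l \<oplus>\<^bsub>X\<^esub> b p) = f l' \<oplus>\<^bsub>T\<^esub> u p'"
      unfolding g_def by blast
    from l'p'(3) have "a (l \<ominus>\<^bsub>L\<^esub> l') = b (p' \<ominus>\<^bsub>P\<^esub> p)"
      using lp l'p'(1,2) by (subst (asm) a.N.add_eq_add_iff) (auto simp: a.f_diff b.f_diff)
    then have "f (l \<ominus>\<^bsub>L\<^esub> l') = u (p' \<ominus>\<^bsub>P\<^esub> p)" using agree lp l'p'(1,2) by simp
    then have "f l \<ominus>\<^bsub>T\<^esub> f l' = u p' \<ominus>\<^bsub>T\<^esub> u p"
      using lp l'p'(1,2) by (simp add: f.f_diff u.f_diff)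
    then have "f l \<oplus>\<^bsub>T\<^esub> u p = f l' \<oplus>\<^bsub>T\<^esub> u p'"
      using lp l'p'(1,2) by (subst f.N.add_eq_add_iff) auto
    then show ?thesis using l'p'(4) by simp
  qed
  have hom: "(\<lambda>x\<in>carrier X. g x) \<in> mod_hom R X T"
  proof (rule mod_homI)
    fix x assume "x \<in> carrier X"
    then obtain l p where x: "l \<in> carrier L" "p \<in> carrier P" "x = a l \<oplus>\<^bsub>X\<^esub> b p" using surj by blast
    then show "g x \<in> carrier T" by (simp add: g)
    { fix c assume c: "c \<in> carrier R"
      have "c \<odot>\<^bsub>X\<^esub> x = a (c \<odot>\<^bsub>L\<^esub> l) \<oplus>\<^bsub>X\<^esub> b (c \<odot>\<^bsub>P\<^esub> p)"
        using x c by (simp add: a.f_smult b.f_smult a.N.smult_r_distr)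
      then have "g (c \<odot>\<^bsub>X\<^esub> x) = c \<odot>\<^bsub>T\<^esub> g x"
        using x c by (simp add: g f.f_smult u.f_smult f.N.smult_r_distr)
      then show "c \<odot>\<^bsub>X\<^esub> x \<in> carrier X \<and> g (c \<odot>\<^bsub>X\<^esub> x) = c \<odot>\<^bsub>T\<^esub> g x" using c x by simp }
    fix y assume "y \<in> carrier X"
    then obtain l' p' where y: "l' \<in> carrier L" "p' \<in> carrier P" "y = a l' \<oplus>\<^bsub>X\<^esub> b p'" using surj by blast
    have "x \<oplus>\<^bsub>X\<^esub> y = a (l \<oplus>\<^bsub>L\<^esub> l') \<oplus>\<^bsub>X\<^esub> b (p \<oplus>\<^bsub>P\<^esub> p')"
      using x y by (simp add: a.f_add b.f_add a.N.a_ac)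
    then have "g (x \<oplus>\<^bsub>X\<^esub> y) = g x \<oplus>\<^bsub>T\<^esub> g y"
      using x y by (simp add: g f.f_add u.f_add f.N.a_ac)
    then show "x \<oplus>\<^bsub>X\<^esub> y \<in> carrier X \<and> g (x \<oplus>\<^bsub>X\<^esub> y) = g x \<oplus>\<^bsub>T\<^esub> g y" using x y by simp
  qed
  have "(\<lambda>x\<in>carrier X. g x) (a l) = f l" if "l \<in> carrier L" for l
    using g[of l "\<zero>\<^bsub>P\<^esub>"] that by simp
  moreover have "(\<lambda>x\<in>carrier X. g x) (b p) = u p" if "p \<in> carrier P" for p
    using g[of "\<zero>\<^bsub>L\<^esub>" p] that by simp
  ultimately show ?thesis by (intro bexI[OF _ hom] conjI ballI)
qed

text \<open>Gluing \<open>f\<close> with itself along \<open>q\<close>: agreement is the condition on kernels.\<close>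

lemma hom_factors_through_surj:
  assumes "left_module R M" "left_module R Q" "left_module R T"
    and q: "q \<in> mod_hom R M Q" "q ` carrier M = carrier Q" and f: "f \<in> mod_hom R M T"
    and ker: "\<And>x. \<lbrakk>x \<in> carrier M; q x = \<zero>\<^bsub>Q\<^esub>\<rbrakk> \<Longrightarrow> f x = \<zero>\<^bsub>T\<^esub>"
  shows "\<exists>g\<in>mod_hom R Q T. \<forall>x\<in>carrier M. g (q x) = f x"
proof -
  interpret q: module_hom R M Q q by (intro module_hom.intro module_hom_axioms.intro assms)
  interpret f: module_hom R M T f by (intro module_hom.intro module_hom_axioms.intro assms)
  have "\<exists>g\<in>mod_hom R Q T. (\<forall>x\<in>carrier M. g (q x) = f x) \<and> (\<forall>p\<in>carrier M. g (q p) = f p)"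
  proof (rule glue_hom[where L = M and P = M])
    fix y assume "y \<in> carrier Q"
    then obtain x where "x \<in> carrier M" "y = q x" unfolding q(2)[symmetric] by blast
    then show "\<exists>l\<in>carrier M. \<exists>p\<in>carrier M. y = q l \<oplus>\<^bsub>Q\<^esub> q p"
      by (intro bexI[of _ x] bexI[of _ "\<zero>\<^bsub>M\<^esub>"]) auto
  next
    fix x y assume xy: "x \<in> carrier M" "y \<in> carrier M" "q x = q y"
    then have "f (x \<ominus>\<^bsub>M\<^esub> y) = \<zero>\<^bsub>T\<^esub>" by (intro ker) (simp_all add: q.f_diff)
    then show "f x = f y" using xy by (simp add: f.f_diff)
  qed (fact assms)+
  then show ?thesis by blast
qed

lemma hom_factors_through_inj:
  assumes "left_module R L" "left_module R M" "left_module R T"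
    and i: "i \<in> mod_hom R L M" "inj_on i (carrier L)" and f: "f \<in> mod_hom R T M"
    and im: "f ` carrier T \<subseteq> i ` carrier L"
  shows "\<exists>g\<in>mod_hom R T L. \<forall>x\<in>carrier T. i (g x) = f x"
proof -
  interpret i: module_hom R L M i by (intro module_hom.intro module_hom_axioms.intro assms)
  interpret f: module_hom R T M f by (intro module_hom.intro module_hom_axioms.intro assms)
  define g where "g = (\<lambda>x. inv_into (carrier L) i (f x))"
  have g: "g x \<in> carrier L \<and> i (g x) = f x" if "x \<in> carrier T" for x
  proof -
    have "f x \<in> i ` carrier L" using im that by blast
    then show ?thesis unfolding g_def by (simp add: inv_into_into f_inv_into_f)
  qed
  have inj: "x = y" if "i x = i y" "x \<in> carrier L" "y \<in> carrier L" for x y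
    using i(2) that by (auto dest: inj_onD)
  have hom: "(\<lambda>x\<in>carrier T. g x) \<in> mod_hom R T L"
  proof (rule mod_homI)
    fix x y assume "x \<in> carrier T" "y \<in> carrier T"
    then show "x \<oplus>\<^bsub>T\<^esub> y \<in> carrier T \<and> g (x \<oplus>\<^bsub>T\<^esub> y) = g x \<oplus>\<^bsub>L\<^esub> g y"
      by (intro conjI inj) (simp_all add: g i.f_add f.f_add)
  next
    fix a x assume "a \<in> carrier R" "x \<in> carrier T"
    then show "a \<odot>\<^bsub>T\<^esub> x \<in> carrier T \<and> g (a \<odot>\<^bsub>T\<^esub> x) = a \<odot>\<^bsub>L\<^esub> g x"
      by (intro conjI inj) (simp_all add: g i.f_smult f.f_smult)
  qed (simp add: g)
  have "i ((\<lambda>x\<in>carrier T. g x) x) = f x" if "x \<in> carrier T" for x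
    using g that by simp
  then show ?thesis by (intro bexI[OF _ hom] ballI)
qed

section \<open>Finite generation and the noetherian property\<close>

lemma (in left_module) finsum_in_spn:
  assumes "finite F" "F \<subseteq> S" "S \<subseteq> carrier M" "c \<in> F \<rightarrow> carrier R"
  shows "(\<Oplus>\<^bsub>M\<^esub>s\<in>F. c s \<odot>\<^bsub>M\<^esub> s) \<in> spn R M S"
  using assms
proof (induction F)
  case empty
  then show ?case by (simp add: spn_zero)
next
  case (insert x F)
  then have "(\<Oplus>\<^bsub>M\<^esub>s\<in>insert x F. c s \<odot>\<^bsub>M\<^esub> s) = c x \<odot>\<^bsub>M\<^esub> x \<oplus>\<^bsub>M\<^esub> (\<Oplus>\<^bsub>M\<^esub>s\<in>F. c s \<odot>\<^bsub>M\<^esub> s)"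
    by (intro M.finsum_insert) auto
  moreover have "c x \<odot>\<^bsub>M\<^esub> x \<oplus>\<^bsub>M\<^esub> (\<Oplus>\<^bsub>M\<^esub>s\<in>F. c s \<odot>\<^bsub>M\<^esub> s) \<in> spn R M S"
    using insert by (intro spn_add[OF spn_smult[OF _ spn_base]]) auto
  ultimately show ?case by simp
qed

lemma (in left_module) smult_finsum:
  assumes "finite F" "F \<subseteq> carrier M" "c \<in> F \<rightarrow> carrier R" "a \<in> carrier R"
  shows "a \<odot>\<^bsub>M\<^esub> (\<Oplus>\<^bsub>M\<^esub>s\<in>F. c s \<odot>\<^bsub>M\<^esub> s) = (\<Oplus>\<^bsub>M\<^esub>s\<in>F. (a \<otimes>\<^bsub>R\<^esub> c s) \<odot>\<^bsub>M\<^esub> s)"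
  using assms
proof (induction F)
  case empty
  then show ?case by (simp add: smult_r_null)
next
  case (insert x F)
  have "(\<Oplus>\<^bsub>M\<^esub>s\<in>insert x F. c s \<odot>\<^bsub>M\<^esub> s) = c x \<odot>\<^bsub>M\<^esub> x \<oplus>\<^bsub>M\<^esub> (\<Oplus>\<^bsub>M\<^esub>s\<in>F. c s \<odot>\<^bsub>M\<^esub> s)"
    using insert by (intro M.finsum_insert) auto
  moreover have "(\<Oplus>\<^bsub>M\<^esub>s\<in>insert x F. (a \<otimes>\<^bsub>R\<^esub> c s) \<odot>\<^bsub>M\<^esub> s)
      = (a \<otimes>\<^bsub>R\<^esub> c x) \<odot>\<^bsub>M\<^esub> x \<oplus>\<^bsub>M\<^esub> (\<Oplus>\<^bsub>M\<^esub>s\<in>F. (a \<otimes>\<^bsub>R\<^esub> c s) \<odot>\<^bsub>M\<^esub> s)"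
    using insert by (intro M.finsum_insert) auto
  moreover have "(\<Oplus>\<^bsub>M\<^esub>s\<in>F. c s \<odot>\<^bsub>M\<^esub> s) \<in> carrier M"
    using insert by (intro M.finsum_closed) auto
  ultimately show ?case using insert by (auto simp: smult_r_distr smult_assoc)
qed

text \<open>After this comparison, finite generation is a statement about spans, and no finite sum is needed again
  except for naming elements by their coefficients.\<close>

lemma (in left_module) linear_combinations_eq_spn:
  assumes S: "finite S" "S \<subseteq> carrier M"
  shows "{\<Oplus>\<^bsub>M\<^esub>s\<in>S. c s \<odot>\<^bsub>M\<^esub> s | c. c \<in> S \<rightarrow> carrier R} = spn R M S" (is "?L = _")
proof
  show "?L \<subseteq> spn R M S" using finsum_in_spn[OF S(1) subset_refl S(2)] by blast
  have "submod R M ?L"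
    unfolding submod_def
  proof (intro conjI ballI subsetI)
    fix x assume "x \<in> ?L"
    then obtain c where "c \<in> S \<rightarrow> carrier R" "x = (\<Oplus>\<^bsub>M\<^esub>s\<in>S. c s \<odot>\<^bsub>M\<^esub> s)" by blast
    then show "x \<in> carrier M" using S by (auto intro!: M.finsum_closed)
  next
    have "(\<Oplus>\<^bsub>M\<^esub>s\<in>S. \<zero>\<^bsub>R\<^esub> \<odot>\<^bsub>M\<^esub> s) = (\<Oplus>\<^bsub>M\<^esub>s\<in>S. \<zero>\<^bsub>M\<^esub>)"
      using S by (intro M.finsum_cong') (auto simp: smult_l_null)
    then show "\<zero>\<^bsub>M\<^esub> \<in> ?L" by (auto simp: M.finsum_zero intro!: exI[of _ "\<lambda>_. \<zero>\<^bsub>R\<^esub>"])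
  next
    fix x y assume "x \<in> ?L" "y \<in> ?L"
    then obtain c d where c: "c \<in> S \<rightarrow> carrier R" "x = (\<Oplus>\<^bsub>M\<^esub>s\<in>S. c s \<odot>\<^bsub>M\<^esub> s)"
      and d: "d \<in> S \<rightarrow> carrier R" "y = (\<Oplus>\<^bsub>M\<^esub>s\<in>S. d s \<odot>\<^bsub>M\<^esub> s)" by blast
    have "x \<oplus>\<^bsub>M\<^esub> y = (\<Oplus>\<^bsub>M\<^esub>s\<in>S. c s \<odot>\<^bsub>M\<^esub> s \<oplus>\<^bsub>M\<^esub> d s \<odot>\<^bsub>M\<^esub> s)"
      unfolding c d using c(1) d(1) S by (intro M.finsum_addf[symmetric]) auto
    also have "\<dots> = (\<Oplus>\<^bsub>M\<^esub>s\<in>S. (c s \<oplus>\<^bsub>R\<^esub> d s) \<odot>\<^bsub>M\<^esub> s)"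
      using c(1) d(1) S by (intro M.finsum_cong') (auto simp: smult_l_distr Pi_iff subset_iff)
    finally show "x \<oplus>\<^bsub>M\<^esub> y \<in> ?L"
      using c(1) d(1) by (auto intro!: exI[of _ "\<lambda>s. c s \<oplus>\<^bsub>R\<^esub> d s"])
  next
    fix a x assume a: "a \<in> carrier R" and "x \<in> ?L"
    then obtain c where c: "c \<in> S \<rightarrow> carrier R" "x = (\<Oplus>\<^bsub>M\<^esub>s\<in>S. c s \<odot>\<^bsub>M\<^esub> s)" by blast
    then have "a \<odot>\<^bsub>M\<^esub> x = (\<Oplus>\<^bsub>M\<^esub>s\<in>S. (a \<otimes>\<^bsub>R\<^esub> c s) \<odot>\<^bsub>M\<^esub> s)"
      using smult_finsum S a by simp
    then show "a \<odot>\<^bsub>M\<^esub> x \<in> ?L" using c(1) a by (auto intro!: exI[of _ "\<lambda>s. a \<otimes>\<^bsub>R\<^esub> c s"])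
  qed
  moreover have "S \<subseteq> ?L"
  proof
    fix t assume t: "t \<in> S"
    have "(\<Oplus>\<^bsub>M\<^esub>s\<in>S. (if t = s then \<one>\<^bsub>R\<^esub> else \<zero>\<^bsub>R\<^esub>) \<odot>\<^bsub>M\<^esub> s) = (\<Oplus>\<^bsub>M\<^esub>s\<in>S. if t = s then s else \<zero>\<^bsub>M\<^esub>)"
      using S by (intro M.finsum_cong') (auto simp: smult_l_null)
    also have "\<dots> = t" using S t by (intro M.finsum_singleton) auto
    finally show "t \<in> ?L" by (auto intro!: exI[of _ "\<lambda>s. if t = s then \<one>\<^bsub>R\<^esub> else \<zero>\<^bsub>R\<^esub>"])
  qed
  ultimately show "spn R M S \<subseteq> ?L" by (rule spn_least)
qed

lemma fin_gen_iff:
  assumes "left_module R M"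
  shows "fin_gen R M \<longleftrightarrow> (\<exists>S\<subseteq>carrier M. finite S \<and> spn R M S = carrier M)"
proof -
  have "(S \<subseteq> carrier M \<and> finite S \<and>
        carrier M = {\<Oplus>\<^bsub>M\<^esub>s\<in>S. c s \<odot>\<^bsub>M\<^esub> s | c. c \<in> S \<rightarrow> carrier R}) \<longleftrightarrow>
      (S \<subseteq> carrier M \<and> finite S \<and> spn R M S = carrier M)" for S
  proof (cases "finite S \<and> S \<subseteq> carrier M")
    case True
    then show ?thesis using left_module.linear_combinations_eq_spn[OF assms, of S] by blast
  qed blast
  then show ?thesis unfolding fin_gen_def by presburger
qed

lemma fin_gen_surj_image:
  assumes "left_module R M" "left_module R N" "f \<in> mod_hom R M N" "f ` carrier M = carrier N" "fin_gen R M"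
  shows "fin_gen R N"
proof -
  interpret module_hom R M N f by (intro module_hom.intro module_hom_axioms.intro assms)
  obtain S where "S \<subseteq> carrier M" "finite S" "spn R M S = carrier M"
    using assms(5) fin_gen_iff[OF assms(1)] by auto
  moreover have "f ` S \<subseteq> carrier N" using \<open>S \<subseteq> carrier M\<close> by auto
  ultimately have "f ` S \<subseteq> carrier N \<and> finite (f ` S) \<and> spn R N (f ` S) = carrier N"
    using spn_image[of S] assms(4) by simp
  then show ?thesis unfolding fin_gen_iff[OF assms(2)] by blast
qed

lemma (in left_module) spn_insert:
  assumes "x \<in> carrier M" "S \<subseteq> carrier M" "y \<in> spn R M (insert x S)"
  shows "\<exists>a\<in>carrier R. \<exists>s\<in>spn R M S. y = a \<odot>\<^bsub>M\<^esub> x \<oplus>\<^bsub>M\<^esub> s"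
  using assms(3)
proof induction
  note [simp] = submodD[OF spn_submod[OF assms(2)]]
  case spn_zero
  then show ?case using assms
    by (intro bexI[of _ "\<zero>\<^bsub>R\<^esub>"] bexI[of _ "\<zero>\<^bsub>M\<^esub>"]) (auto simp: smult_l_null)
next
  note [simp] = submodD[OF spn_submod[OF assms(2)]]
  case (spn_base s)
  then consider "s = x" | "s \<in> S" by blast
  then show ?case
  proof cases
    case 1
    then show ?thesis using assms by (intro bexI[of _ "\<one>\<^bsub>R\<^esub>"] bexI[of _ "\<zero>\<^bsub>M\<^esub>"]) auto
  next
    case 2
    then show ?thesis using assms
      by (intro bexI[of _ "\<zero>\<^bsub>R\<^esub>"] bexI[of _ s]) (auto simp: smult_l_null spn.intros)
  qed
next
  note sp = submodD[OF spn_submod[OF assms(2)]]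
  case (spn_add y z)
  then obtain a s b t where *: "a \<in> carrier R" "s \<in> spn R M S" "y = a \<odot>\<^bsub>M\<^esub> x \<oplus>\<^bsub>M\<^esub> s"
    "b \<in> carrier R" "t \<in> spn R M S" "z = b \<odot>\<^bsub>M\<^esub> x \<oplus>\<^bsub>M\<^esub> t" by blast
  then have "y \<oplus>\<^bsub>M\<^esub> z = (a \<oplus>\<^bsub>R\<^esub> b) \<odot>\<^bsub>M\<^esub> x \<oplus>\<^bsub>M\<^esub> (s \<oplus>\<^bsub>M\<^esub> t)"
    using assms sp(2) by (simp add: smult_l_distr M.a_ac)
  then show ?case using * sp(4) by blast
next
  note sp = submodD[OF spn_submod[OF assms(2)]]
  case (spn_smult c y)
  then obtain a s where *: "a \<in> carrier R" "s \<in> spn R M S" "y = a \<odot>\<^bsub>M\<^esub> x \<oplus>\<^bsub>M\<^esub> s" by blast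
  then have "c \<odot>\<^bsub>M\<^esub> y = (c \<otimes>\<^bsub>R\<^esub> a) \<odot>\<^bsub>M\<^esub> x \<oplus>\<^bsub>M\<^esub> (c \<odot>\<^bsub>M\<^esub> s)"
    using assms sp(2) spn_smult(1) by (simp add: smult_r_distr smult_assoc)
  then show ?case using * sp(5) spn_smult(1) by blast
qed

definition noetherian_module :: "('a, 'r) ring_scheme \<Rightarrow> ('a, 'm, 's) module_scheme \<Rightarrow> bool"
  where "noetherian_module R M \<longleftrightarrow>
    (\<forall>N. submod R M N \<longrightarrow> (\<exists>S\<subseteq>N. finite S \<and> spn R M S = N))"

lemma regular_module_simps [simp]:
  "carrier (regular_module R) = carrier R" "add (regular_module R) = add R"
  "zero (regular_module R) = zero R" "smult (regular_module R) = mult R"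
  by (simp_all add: regular_module_def)

lemma regular_module_left_module: "ring R \<Longrightarrow> left_module R (regular_module R)"
proof -
  assume "ring R"
  then interpret ring R .
  have "abelian_group (regular_module R)"
    by (rule abelian_groupI) (auto simp: a_ac intro: l_neg)
  then show ?thesis
    by (intro left_module.intro left_module_axioms.intro ring_axioms) (auto simp: l_distr r_distr m_assoc)
qed

lemma submod_regular_iff_left_ideal:
  "submod R (regular_module R) I \<longleftrightarrow> I \<subseteq> carrier R \<and> \<zero>\<^bsub>R\<^esub> \<in> I \<and> (\<forall>x\<in>I. \<forall>y\<in>I. x \<oplus>\<^bsub>R\<^esub> y \<in> I)
    \<and> (\<forall>a\<in>carrier R. \<forall>x\<in>I. a \<otimes>\<^bsub>R\<^esub> x \<in> I)"
  by (simp add: submod_def)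

text \<open>Induction on the number of generators: for a submodule \<open>N\<close> of the span of \<open>insert x S\<close>, the
  possible coefficients of \<open>x\<close> in elements of \<open>N\<close> form a left ideal. Lifts to \<open>N\<close> of finitely many
  generators of it, together with generators of the part of \<open>N\<close> inside the span of \<open>S\<close>, generate \<open>N\<close>.\<close>

lemma noetherian_module_if_fin_gen:
  fixes M :: "('a, 'm, 's) module_scheme"
  assumes M: "left_module R M" and R: "noetherian_module R (regular_module R)" and fg: "fin_gen R M"
  shows "noetherian_module R M"
proof -
  interpret left_module R M by fact
  have *: "\<exists>T\<subseteq>N. finite T \<and> spn R M T = N"
    if "finite S" "S \<subseteq> carrier M" "submod R M N" "N \<subseteq> spn R M S" for S N
    using that
  proof (induction S arbitrary: N rule: finite_induct)
    case empty
    have "spn R M {} \<subseteq> {\<zero>\<^bsub>M\<^esub>}" by (rule spn_least[OF submod_zero]) simp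
    then have "N = {\<zero>\<^bsub>M\<^esub>}" using empty submodD(3)[of R M N] by blast
    moreover have "spn R M {} = {\<zero>\<^bsub>M\<^esub>}" using \<open>spn R M {} \<subseteq> {\<zero>\<^bsub>M\<^esub>}\<close> spn_zero by blast
    ultimately show ?case by (intro exI[of _ "{}"]) auto
  next
    case (insert x S)
    have x: "x \<in> carrier M" and S: "S \<subseteq> carrier M" using insert by auto
    note N = submodD[OF insert.prems(2)]
    note sp = submodD[OF spn_submod[OF S]]
    define J where "J = {a \<in> carrier R. \<exists>s\<in>spn R M S. a \<odot>\<^bsub>M\<^esub> x \<oplus>\<^bsub>M\<^esub> s \<in> N}"
    have "submod R (regular_module R) J"
      unfolding submod_regular_iff_left_ideal
    proof (intro conjI ballI)
      show "\<zero>\<^bsub>R\<^esub> \<in> J" unfolding J_def using x sp(3) N(3)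
        by (auto simp: smult_l_null intro!: bexI[of _ "\<zero>\<^bsub>M\<^esub>"])
    next
      fix a b assume "a \<in> J" "b \<in> J"
      then obtain s t where st: "a \<in> carrier R" "b \<in> carrier R" "s \<in> spn R M S" "t \<in> spn R M S"
        "a \<odot>\<^bsub>M\<^esub> x \<oplus>\<^bsub>M\<^esub> s \<in> N" "b \<odot>\<^bsub>M\<^esub> x \<oplus>\<^bsub>M\<^esub> t \<in> N" unfolding J_def by blast
      have "(a \<oplus>\<^bsub>R\<^esub> b) \<odot>\<^bsub>M\<^esub> x \<oplus>\<^bsub>M\<^esub> (s \<oplus>\<^bsub>M\<^esub> t) = (a \<odot>\<^bsub>M\<^esub> x \<oplus>\<^bsub>M\<^esub> s) \<oplus>\<^bsub>M\<^esub> (b \<odot>\<^bsub>M\<^esub> x \<oplus>\<^bsub>M\<^esub> t)"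
        using st x sp(2) by (simp add: smult_l_distr M.a_ac)
      then show "a \<oplus>\<^bsub>R\<^esub> b \<in> J" unfolding J_def using st N(4) sp(4) by force
    next
      fix c a assume c: "c \<in> carrier R" "a \<in> J"
      then obtain s where s: "a \<in> carrier R" "s \<in> spn R M S" "a \<odot>\<^bsub>M\<^esub> x \<oplus>\<^bsub>M\<^esub> s \<in> N"
        unfolding J_def by blast
      have "(c \<otimes>\<^bsub>R\<^esub> a) \<odot>\<^bsub>M\<^esub> x \<oplus>\<^bsub>M\<^esub> c \<odot>\<^bsub>M\<^esub> s = c \<odot>\<^bsub>M\<^esub> (a \<odot>\<^bsub>M\<^esub> x \<oplus>\<^bsub>M\<^esub> s)"
        using s c(1) x sp(2) by (simp add: smult_assoc smult_r_distr)
      then show "c \<otimes>\<^bsub>R\<^esub> a \<in> J" unfolding J_def using s c(1) N(5) sp(5) by force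
    qed (auto simp: J_def)
    then obtain T where T: "T \<subseteq> J" "finite T" "spn R (regular_module R) T = J"
      using R unfolding noetherian_module_def by blast
    have "\<forall>a\<in>T. \<exists>s\<in>spn R M S. a \<odot>\<^bsub>M\<^esub> x \<oplus>\<^bsub>M\<^esub> s \<in> N" using T(1) unfolding J_def by auto
    then obtain s where s: "\<And>a. a \<in> T \<Longrightarrow> s a \<in> spn R M S" "\<And>a. a \<in> T \<Longrightarrow> a \<odot>\<^bsub>M\<^esub> x \<oplus>\<^bsub>M\<^esub> s a \<in> N"
      by metis
    have "submod R M (N \<inter> spn R M S)" using N sp by (auto simp: submod_def)
    then obtain U where U: "U \<subseteq> N \<inter> spn R M S" "finite U" "spn R M U = N \<inter> spn R M S"
      using insert.IH[OF S] by (metis inf_le2)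
    define V where "V = (\<lambda>a. a \<odot>\<^bsub>M\<^esub> x \<oplus>\<^bsub>M\<^esub> s a) ` T \<union> U"
    have VN: "V \<subseteq> N" using s U unfolding V_def by auto
    have Vc: "V \<subseteq> carrier M" using VN N(1) by auto
    note spV = submodD[OF spn_submod[OF Vc]]
    have VsubN: "spn R M V \<subseteq> N" by (rule spn_least[OF insert.prems(2) VN])
    have coeff: "\<exists>t\<in>spn R M S. a \<odot>\<^bsub>M\<^esub> x \<oplus>\<^bsub>M\<^esub> t \<in> spn R M V"
      if "a \<in> spn R (regular_module R) T" for a
      using that
    proof induction
      case spn_zero
      then show ?case using x sp(3) spV(3) by (auto simp: smult_l_null intro!: bexI[of _ "\<zero>\<^bsub>M\<^esub>"])
    next
      case (spn_base a)
      then show ?case using s by (intro bexI[of _ "s a"]) (auto simp: V_def intro: spn.spn_base)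
    next
      case (spn_add a b)
      then obtain t u where tu: "t \<in> spn R M S" "u \<in> spn R M S"
        "a \<odot>\<^bsub>M\<^esub> x \<oplus>\<^bsub>M\<^esub> t \<in> spn R M V" "b \<odot>\<^bsub>M\<^esub> x \<oplus>\<^bsub>M\<^esub> u \<in> spn R M V" by blast
      have ab: "a \<in> carrier R" "b \<in> carrier R" using spn_add.hyps T(3) unfolding J_def by auto
      have "(a \<oplus>\<^bsub>R\<^esub> b) \<odot>\<^bsub>M\<^esub> x \<oplus>\<^bsub>M\<^esub> (t \<oplus>\<^bsub>M\<^esub> u) = (a \<odot>\<^bsub>M\<^esub> x \<oplus>\<^bsub>M\<^esub> t) \<oplus>\<^bsub>M\<^esub> (b \<odot>\<^bsub>M\<^esub> x \<oplus>\<^bsub>M\<^esub> u)"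
        using tu ab x sp(2) by (simp add: smult_l_distr M.a_ac)
      then show ?case using tu spV(4) sp(4) by force
    next
      case (spn_smult c a)
      then obtain t where t: "t \<in> spn R M S" "a \<odot>\<^bsub>M\<^esub> x \<oplus>\<^bsub>M\<^esub> t \<in> spn R M V" by blast
      have ca: "a \<in> carrier R" "c \<in> carrier R" using spn_smult.hyps T(3) unfolding J_def by auto
      have "(c \<otimes>\<^bsub>R\<^esub> a) \<odot>\<^bsub>M\<^esub> x \<oplus>\<^bsub>M\<^esub> c \<odot>\<^bsub>M\<^esub> t = c \<odot>\<^bsub>M\<^esub> (a \<odot>\<^bsub>M\<^esub> x \<oplus>\<^bsub>M\<^esub> t)"
        using t ca x sp(2) by (simp add: smult_assoc smult_r_distr)
      then show ?case using t ca spV(5) sp(5) by force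
    qed
    have "N \<subseteq> spn R M V"
    proof
      fix y assume y: "y \<in> N"
      then obtain a t where at: "a \<in> carrier R" "t \<in> spn R M S" "y = a \<odot>\<^bsub>M\<^esub> x \<oplus>\<^bsub>M\<^esub> t"
        using spn_insert[OF x S] insert.prems(3) by blast
      then have "a \<in> J" using y unfolding J_def by blast
      then obtain u where u: "u \<in> spn R M S" "a \<odot>\<^bsub>M\<^esub> x \<oplus>\<^bsub>M\<^esub> u \<in> spn R M V"
        using coeff T(3) by blast
      define v where "v = a \<odot>\<^bsub>M\<^esub> x \<oplus>\<^bsub>M\<^esub> u"
      have v: "v \<in> spn R M V" "v \<in> N" using u VsubN unfolding v_def by auto
      have "y \<ominus>\<^bsub>M\<^esub> v = t \<ominus>\<^bsub>M\<^esub> u"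
        unfolding v_def at(3) using at x u(1) sp(2) by (subst add_diff_add) auto
      then have "y \<ominus>\<^bsub>M\<^esub> v \<in> N \<inter> spn R M S"
        using submod_diff[OF insert.prems(2) y v(2)] submod_diff[OF spn_submod[OF S] at(2) u(1)] by auto
      moreover have "spn R M U \<subseteq> spn R M V"
        by (rule spn_least[OF spn_submod[OF Vc]]) (auto simp: V_def intro: spn.spn_base)
      ultimately have "y \<ominus>\<^bsub>M\<^esub> v \<in> spn R M V" using U(3) by auto
      then have "(y \<ominus>\<^bsub>M\<^esub> v) \<oplus>\<^bsub>M\<^esub> v \<in> spn R M V" using v(1) spV(4) by blast
      then show "y \<in> spn R M V" using y v(2) N(2) by (simp add: diff_add_cancel)
    qed
    then show ?case using VN VsubN T(2) U(2) by (intro exI[of _ V]) (auto simp: V_def)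
  qed
  obtain S where S: "S \<subseteq> carrier M" "finite S" "spn R M S = carrier M"
    using fg fin_gen_iff[OF M] by auto
  show ?thesis
    unfolding noetherian_module_def
  proof (intro allI impI)
    fix N assume N: "submod R M N"
    then show "\<exists>T\<subseteq>N. finite T \<and> spn R M T = N"
      using submodD(1)[OF N] by (intro *[OF S(2,1)]) (simp_all add: S(3))
  qed
qed

lemma noetherian_submodule_fin_gen:
  assumes "left_module R M" "noetherian_module R M" "submod R M N"
  shows "fin_gen R (M\<lparr>carrier := N\<rparr>)"
proof -
  obtain S where "S \<subseteq> N" "finite S" "spn R M S = N"
    using assms(2,3) unfolding noetherian_module_def by blast
  then show ?thesis
    unfolding fin_gen_iff[OF left_module.submod_left_module[OF assms(1,3)]] by (intro exI[of _ S]) simp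
qed

section \<open>Artin algebras are noetherian\<close>

lemma a_minus_regular_module [simp]: "a_minus (regular_module R) = a_minus R"
  by (intro ext) (simp add: a_minus_def a_inv_def m_inv_def)

lemma (in cring) submod_regular_iff_ideal:
  "submod R (regular_module R) I \<longleftrightarrow> ideal I R"
proof
  assume I: "submod R (regular_module R) I"
  interpret M: left_module R "regular_module R" by (rule regular_module_left_module) (rule ring_axioms)
  have minus: "\<ominus> x \<in> I" if "x \<in> I" for x
  proof -
    have "(\<ominus> \<one>) \<otimes> x \<in> I" using submodD(5)[OF I, of "\<ominus> \<one>" x] that by simp
    then show ?thesis using submodD(2)[OF I that] by (simp add: l_minus)
  qed
  note * = I[unfolded submod_regular_iff_left_ideal]
  show "ideal I R"
  proof (rule idealI[OF ring_axioms])
    show "subgroup I (add_monoid R)"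
      by (rule add.subgroupI) (use * minus in \<open>auto simp flip: a_inv_def\<close>)
  next
    fix a x assume "a \<in> I" "x \<in> carrier R"
    then show "x \<otimes> a \<in> I" "a \<otimes> x \<in> I" using * by (auto simp: m_comm subset_iff)
  qed
next
  assume "ideal I R"
  then interpret ideal I R .
  show "submod R (regular_module R) I"
    unfolding submod_regular_iff_left_ideal using a_subset by (auto intro: I_l_closed)
qed

text \<open>If some ideal is not finitely generated, take a minimal such ideal \<open>I\<close>. For each scalar \<open>r\<close>,
  \<open>I\<close> is an extension of \<open>r I\<close> by the elements of \<open>I\<close> killed by \<open>r\<close>, so minimality forces \<open>r I = I\<close> or
  \<open>r I = 0\<close>; by the descending chain condition on the powers of \<open>r\<close>, in the first case \<open>r\<close> acts
  invertibly on \<open>I\<close>. Thus \<open>I\<close> is a vector space over a field. A maximal subspace \<open>H\<close> avoiding a given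
  \<open>x \<noteq> 0\<close> is then a complement of the line through \<open>x\<close>. It is finitely generated by minimality of \<open>I\<close>,
  and so \<open>I\<close> is finitely generated after all.\<close>

lemma (in artinian_cring) artinian_imp_noetherian: "noetherian_module R (regular_module R)"
proof (rule ccontr)
  let ?M = "regular_module R"
  interpret M: left_module R ?M by (rule regular_module_left_module) (rule ring_axioms)
  note sm = submod_regular_iff_left_ideal
  define fg where "fg I \<longleftrightarrow> (\<exists>S\<subseteq>I. finite S \<and> spn R ?M S = I)" for I
  assume "\<not> noetherian_module R ?M"
  then obtain I0 where I0: "submod R ?M I0" "\<not> fg I0" unfolding noetherian_module_def fg_def by blast
  have "\<exists>I. submod R ?M I \<and> \<not> fg I \<and> (\<forall>J. submod R ?M J \<and> J \<subset> I \<longrightarrow> fg J)"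
  proof (rule ccontr)
    assume "\<not> ?thesis"
    then have step: "\<exists>J. (submod R ?M J \<and> \<not> fg J) \<and> J \<subset> I" if "submod R ?M I \<and> \<not> fg I" for I
      using that by blast
    have "\<exists>C. \<forall>n. (submod R ?M (C n) \<and> \<not> fg (C n)) \<and> C (Suc n) \<subset> C n"
      by (rule dependent_nat_choice) (use I0 in blast, rule step)
    then obtain C where C: "\<And>n. submod R ?M (C n) \<and> \<not> fg (C n)" "\<And>n::nat. C (Suc n) \<subset> C n"
      by blast
    have "ideal (C n) R" for n using C(1)[of n] submod_regular_iff_ideal[of "C n"] by blast
    moreover have "C (Suc n) \<subseteq> C n" for n using C(2)[of n] by (rule psubset_imp_subset)
    ultimately obtain n where "\<forall>m\<ge>n. C m = C n" by (rule descending_chain_condition[THEN exE])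
    then have "C (Suc n) = C n" by (metis le_SucI le_refl)
    then show False using C(2)[of n] by (metis psubset_eq)
  qed
  then obtain I where I: "submod R ?M I" "\<not> fg I" and min: "\<And>J. \<lbrakk>submod R ?M J; J \<subset> I\<rbrakk> \<Longrightarrow> fg J"
    by blast
  note Ic = I(1)[unfolded sm]
  have Isub: "\<And>x. x \<in> I \<Longrightarrow> x \<in> carrier R" using Ic by blast
  have dich: "(\<lambda>x. r \<otimes> x) ` I = I \<or> (\<forall>x\<in>I. r \<otimes> x = \<zero>)" if r: "r \<in> carrier R" for r
  proof (rule ccontr)
    assume neg: "\<not> ?thesis"
    interpret mult: module_hom R ?M ?M "\<lambda>x\<in>carrier R. r \<otimes> x"
      by unfold_locales (use r in \<open>auto simp: mod_hom_def r_distr m_lcomm\<close>)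
    have im: "(\<lambda>x. r \<otimes> x) ` J = (\<lambda>x\<in>carrier R. r \<otimes> x) ` J" if "J \<subseteq> carrier R" for J
      using that by (intro image_cong) auto
    have "submod R ?M ((\<lambda>x. r \<otimes> x) ` I)" using mult.submod_image[OF I(1)] im[of I] Ic by simp
    moreover have "(\<lambda>x. r \<otimes> x) ` I \<subset> I" using neg Ic r by blast
    ultimately obtain T' where T': "T' \<subseteq> (\<lambda>x. r \<otimes> x) ` I" "finite T'" "spn R ?M T' = (\<lambda>x. r \<otimes> x) ` I"
      using min unfolding fg_def by meson
    obtain T where T: "T \<subseteq> I" "finite T" "T' = (\<lambda>x. r \<otimes> x) ` T"
      using finite_subset_image[OF T'(2,1)] by blast
    have Tc: "T \<subseteq> carrier R" using T(1) Isub by blast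
    define K where "K = {x \<in> I. r \<otimes> x = \<zero>}"
    have "submod R ?M K" unfolding sm K_def using Ic r by (auto simp: r_distr m_lcomm Isub)
    moreover have "K \<subset> I" using neg unfolding K_def by blast
    ultimately obtain U where U: "U \<subseteq> K" "finite U" "spn R ?M U = K"
      using min unfolding fg_def by meson
    have TU: "T \<union> U \<subseteq> I" using T(1) U(1) unfolding K_def by blast
    then have spn: "submod R ?M (spn R ?M (T \<union> U))" using Isub by (intro M.spn_submod) auto
    \<comment> \<open>\<open>T\<close> lifts generators of \<open>r I\<close>, and \<open>U\<close> generates the part of \<open>I\<close> killed by \<open>r\<close>.\<close>
    have "x \<in> spn R ?M (T \<union> U)" if x: "x \<in> I" for x
    proof -
      have "(\<lambda>x\<in>carrier R. r \<otimes> x) ` spn R ?M T = (\<lambda>x. r \<otimes> x) ` I"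
        using mult.spn_image[of T] Tc T'(3) T(3) im[OF Tc] by simp
      moreover have "r \<otimes> x \<in> (\<lambda>x. r \<otimes> x) ` I" using x by blast
      moreover have "spn R ?M T \<subseteq> I" by (rule spn_least[OF I(1) T(1)])
      ultimately obtain y where y: "y \<in> spn R ?M T" "y \<in> I" "r \<otimes> x = r \<otimes> y"
        using Isub by (smt (verit) image_iff restrict_apply subset_iff)
      have "x \<ominus> y \<in> K"
        using M.submod_diff[OF I(1) x y(2)] y(3) x y(2) r
        by (auto simp: K_def a_minus_def r_distr r_minus Isub r_neg)
      then have "x \<ominus> y \<in> spn R ?M (T \<union> U)"
        using U(3) spn_least[OF spn, of U] by (auto intro: spn_base)
      moreover have "y \<in> spn R ?M (T \<union> U)"
        using y(1) spn_least[OF spn, of T] by (auto intro: spn_base)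
      ultimately have "(x \<ominus> y) \<oplus> y \<in> spn R ?M (T \<union> U)" using submodD(4)[OF spn] by simp
      then show ?thesis using x y(2) by (simp add: Isub a_minus_def a_assoc l_neg)
    qed
    then have "spn R ?M (T \<union> U) = I" using spn_least[OF I(1) TU] by blast
    then show False using I(2) TU T(2) U(2) unfolding fg_def by (metis finite_UnI)
  qed
  have "spn R ?M {} \<subseteq> {\<zero>}" by (rule spn_least) (auto simp: sm)
  then have "spn R ?M {} = {\<zero>}" using spn_zero[of ?M R "{}"] by auto
  then have "fg {\<zero>}" unfolding fg_def by (intro exI[of _ "{}"]) auto
  then have "I \<noteq> {\<zero>}" using I(2) by auto
  then obtain x where x: "x \<in> I" "x \<noteq> \<zero>" using Ic by blast
  let ?\<H> = "{H. submod R ?M H \<and> H \<subseteq> I \<and> x \<notin> H}"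
  have "\<exists>H\<in>?\<H>. \<forall>X\<in>?\<H>. H \<subseteq> X \<longrightarrow> X = H"
  proof (rule subset_Zorn_nonempty)
    show "?\<H> \<noteq> {}" using x Ic by (auto intro!: exI[of _ "{\<zero>}"] simp: sm)
  next
    fix \<C> assume \<C>: "\<C> \<noteq> {}" "subset.chain ?\<H> \<C>"
    have mem: "\<And>H. H \<in> \<C> \<Longrightarrow> submod R ?M H \<and> H \<subseteq> I \<and> x \<notin> H"
      and tot: "\<And>H H'. \<lbrakk>H \<in> \<C>; H' \<in> \<C>\<rbrakk> \<Longrightarrow> H \<subseteq> H' \<or> H' \<subseteq> H"
      using \<C>(2) unfolding subset.chain_def by blast+
    have "submod R ?M (\<Union>\<C>)"
      unfolding sm
    proof (intro conjI ballI)
      show "\<Union>\<C> \<subseteq> carrier R" "\<zero> \<in> \<Union>\<C>" using mem \<C>(1) unfolding sm by blast+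
    next
      fix y z assume "y \<in> \<Union>\<C>" "z \<in> \<Union>\<C>"
      then obtain H where "H \<in> \<C>" "y \<in> H" "z \<in> H" using tot by blast
      then show "y \<oplus> z \<in> \<Union>\<C>" using mem unfolding sm by blast
    next
      fix a y assume "a \<in> carrier R" "y \<in> \<Union>\<C>"
      then show "a \<otimes> y \<in> \<Union>\<C>" using mem unfolding sm by blast
    qed
    then show "\<Union>\<C> \<in> ?\<H>" using mem by blast
  qed
  then obtain H where Hmem: "H \<in> ?\<H>" and Hmax: "\<forall>X\<in>?\<H>. H \<subseteq> X \<longrightarrow> X = H" by (rule bexE)
  have H: "submod R ?M H" "H \<subseteq> I" "x \<notin> H" using Hmem by simp_all
  have max: "X = H" if "submod R ?M X" "X \<subseteq> I" "x \<notin> X" "H \<subseteq> X" for X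
    using Hmax that by simp
  have "H \<subset> I" using H x by blast
  then obtain U where U: "U \<subseteq> H" "finite U" "spn R ?M U = H" using min H(1) unfolding fg_def by meson
  have xU: "insert x U \<subseteq> I" using U(1) H(2) x(1) by blast
  then have spn: "submod R ?M (spn R ?M (insert x U))" using Isub by (intro M.spn_submod) auto
  have HV: "H \<subseteq> spn R ?M (insert x U)" using U(3) spn_least[OF spn, of U] by (auto intro: spn_base)
  \<comment> \<open>\<open>I\<close> is the sum of \<open>H\<close> and the line through \<open>x\<close>: for \<open>y\<close> outside \<open>H\<close>, maximality puts \<open>x = a y + h\<close> into the
    span of \<open>H\<close> and \<open>y\<close>, and \<open>a\<close> can be inverted.\<close>
  have "y \<in> spn R ?M (insert x U)" if y: "y \<in> I" for y
  proof (cases "y \<in> H")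
    case True
    then show ?thesis using HV by blast
  next
    case False
    have yc: "y \<in> carrier R" and xc: "x \<in> carrier R" using y x Isub by auto
    have insyU: "insert y U \<subseteq> carrier R" using U(1) H(2) y Isub by blast
    have X: "submod R ?M (spn R ?M (insert y U))"
      using insyU by (intro M.spn_submod) simp
    have "H \<subseteq> spn R ?M (insert y U)" using U(3) spn_least[OF X, of U] by (auto intro: spn_base)
    moreover have "spn R ?M (insert y U) \<subseteq> I" by (rule spn_least[OF I(1)]) (use U H y in auto)
    moreover have "y \<in> spn R ?M (insert y U)" by (auto intro: spn_base)
    ultimately have "x \<in> spn R ?M (insert y U)" using max[OF X] False by blast
    then obtain a h where ah: "a \<in> carrier R" "h \<in> H" "x = a \<otimes> y \<oplus> h"
      using M.spn_insert[of y U x] U(3) insyU by auto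
    have hc: "h \<in> carrier R" using ah(2) H(2) Isub by blast
    have "a \<otimes> y \<noteq> \<zero>" using ah H(3) hc by auto
    then have aI: "(\<lambda>z. a \<otimes> z) ` I = I" using dich[OF ah(1)] y by blast
    have pow: "(\<lambda>z. a [^] n \<otimes> z) ` I = I" for n :: nat
    proof (induction n)
      case 0
      show ?case using Isub by force
    next
      case (Suc n)
      have "(\<lambda>z. a [^] Suc n \<otimes> z) ` I = (\<lambda>z. a [^] n \<otimes> (a \<otimes> z)) ` I"
        by (rule image_cong) (use ah(1) Isub in \<open>auto simp: m_assoc\<close>)
      also have "\<dots> = (\<lambda>z. a [^] n \<otimes> z) ` ((\<lambda>z. a \<otimes> z) ` I)" by (simp add: image_image)
      finally show ?case using Suc aI by simp
    qed
    \<comment> \<open>Stability of the chain of the ideals generated by the powers of \<open>a\<close> yields an inverse \<open>b\<close> of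
      the action of \<open>a\<close> on \<open>I\<close>.\<close>
    define C where "C n = (\<lambda>z. a [^] n \<otimes> z) ` carrier R" for n :: nat
    have C_ideal: "ideal (C n) R" for n
      unfolding submod_regular_iff_ideal[symmetric] sm
    proof (intro conjI ballI)
      show "C n \<subseteq> carrier R" unfolding C_def using ah(1) by auto
      show "\<zero> \<in> C n" unfolding C_def by (rule image_eqI[of _ _ \<zero>]) (use ah(1) in auto)
    next
      fix u v assume "u \<in> C n" "v \<in> C n"
      then obtain s t where "s \<in> carrier R" "t \<in> carrier R" "u = a [^] n \<otimes> s" "v = a [^] n \<otimes> t"
        unfolding C_def by blast
      then show "u \<oplus> v \<in> C n" unfolding C_def
        by (intro image_eqI[of _ _ "s \<oplus> t"]) (use ah(1) in \<open>auto simp: r_distr\<close>)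
    next
      fix c u assume "c \<in> carrier R" "u \<in> C n"
      then obtain s where "s \<in> carrier R" "c \<in> carrier R" "u = a [^] n \<otimes> s"
        unfolding C_def by blast
      then show "c \<otimes> u \<in> C n" unfolding C_def
        by (intro image_eqI[of _ _ "c \<otimes> s"]) (use ah(1) in \<open>auto simp: m_lcomm\<close>)
    qed
    have C_dec: "C (Suc n) \<subseteq> C n" for n
    proof
      fix u assume "u \<in> C (Suc n)"
      then obtain s where "s \<in> carrier R" "u = a [^] Suc n \<otimes> s" unfolding C_def by blast
      then show "u \<in> C n" unfolding C_def
        by (intro image_eqI[of _ _ "a \<otimes> s"]) (use ah(1) in \<open>auto simp: m_assoc\<close>)
    qed
    obtain n where "\<forall>m\<ge>n. C m = C n"
      using descending_chain_condition[of C, OF C_ideal C_dec] by (rule exE)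
    then have "C (Suc n) = C n" by (metis le_SucI le_refl)
    moreover have "a [^] n \<in> C n" unfolding C_def by (rule image_eqI[of _ _ \<one>]) (use ah(1) in auto)
    ultimately obtain b where b: "b \<in> carrier R" "a [^] n = a [^] Suc n \<otimes> b" unfolding C_def by blast
    have "(\<one> \<ominus> a \<otimes> b) \<otimes> z = \<zero>" if "z \<in> I" for z
    proof -
      have zero: "a [^] n \<otimes> ((\<one> \<ominus> a \<otimes> b) \<otimes> w) = \<zero>" if "w \<in> I" for w
      proof -
        have wc: "w \<in> carrier R" using that Isub by blast
        have "a [^] n \<otimes> (\<one> \<ominus> a \<otimes> b) = a [^] n \<ominus> a [^] Suc n \<otimes> b"
          using b(1) ah(1) by (simp add: a_minus_def r_distr r_minus m_assoc)
        also have "\<dots> = \<zero>" unfolding b(2)[symmetric] using M.diff_self[of "a [^] n"] ah(1) by simp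
        finally show ?thesis using wc b(1) ah(1) by (simp add: m_assoc[symmetric])
      qed
      show ?thesis
      proof (rule ccontr)
        assume "\<not> ?thesis"
        then have "(\<lambda>z. (\<one> \<ominus> a \<otimes> b) \<otimes> z) ` I = I"
          using dich[of "\<one> \<ominus> a \<otimes> b"] that ah(1) b(1) by auto
        then have "(\<lambda>z. a [^] n \<otimes> z) ` ((\<lambda>z. (\<one> \<ominus> a \<otimes> b) \<otimes> z) ` I) = I" using pow by simp
        then have "I \<subseteq> {\<zero>}" using zero by auto
        then show False using x by blast
      qed
    qed
    then have "(\<one> \<ominus> a \<otimes> b) \<otimes> y = \<zero>" using y by blast
    moreover have "(\<one> \<ominus> a \<otimes> b) \<otimes> y = \<one> \<otimes> y \<ominus> (a \<otimes> b) \<otimes> y"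
      using ah(1) b(1) yc by (simp only: a_minus_def l_distr l_minus a_inv_closed one_closed m_closed)
    moreover have "(a \<otimes> b) \<otimes> y = b \<otimes> (a \<otimes> y)" using ah(1) b(1) yc by (simp add: m_ac)
    ultimately have "y = b \<otimes> (a \<otimes> y)"
      using M.diff_eq_zero_iff[of y "b \<otimes> (a \<otimes> y)"] ah(1) b(1) yc by simp
    moreover have "a \<otimes> y = x \<ominus> h" using ah yc hc M.add_diff_cancel[of "a \<otimes> y" h]
      by simp
    moreover have "x \<ominus> h \<in> spn R ?M (insert x U)"
      using M.submod_diff[OF spn, of x h] HV ah(2) by (auto intro: spn_base)
    ultimately show ?thesis using submodD(5)[OF spn b(1)] by simp
  qed
  then have "spn R ?M (insert x U) = I" using spn_least[OF I(1) xU] by blast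
  then show False using I(2) xU U(2) unfolding fg_def by (metis finite_insert)
qed

text \<open>Left ideals of \<open>A\<close> are in particular \<open>k\<close>-submodules of the finitely generated \<open>k\<close>-module \<open>A\<close>.\<close>

lemma artin_algebra_noetherian:
  assumes "artin_algebra k \<phi> A"
  shows "noetherian_module A (regular_module A)"
proof -
  interpret artin_algebra k \<phi> A by fact
  interpret \<phi>: ring_hom_ring k A \<phi>
    by (rule ring_hom_ringI2[OF k.ring_axioms A.ring_axioms structure_map])
  let ?K = "restrict_scalars \<phi> A"
  have [simp]: "carrier ?K = carrier A" "add ?K = add A" "zero ?K = zero A"
      "smult ?K = (\<lambda>c x. \<phi> c \<otimes>\<^bsub>A\<^esub> x)"
    by (simp_all add: restrict_scalars_def)
  have "abelian_group ?K"
    by (rule abelian_groupI) (auto simp: A.a_ac intro: A.l_neg)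
  then interpret K: left_module k ?K
    by (intro left_module.intro left_module_axioms.intro k.ring_axioms)
      (auto simp: A.l_distr A.r_distr A.m_assoc)
  have noeth: "noetherian_module k ?K"
    by (rule noetherian_module_if_fin_gen[OF K.left_module_axioms k.artinian_imp_noetherian finitely_generated])
  show ?thesis
    unfolding noetherian_module_def
  proof (intro allI impI)
    fix N assume N: "submod A (regular_module A) N"
    then have "submod k ?K N" by (auto simp: submod_def)
    then obtain S where S: "S \<subseteq> N" "finite S" "spn k ?K S = N" using noeth unfolding noetherian_module_def by blast
    interpret M: left_module A "regular_module A" by (rule regular_module_left_module) (rule A.ring_axioms)
    have spnA: "submod A (regular_module A) (spn A (regular_module A) S)"
      using S(1) submodD(1)[OF N] by (intro M.spn_submod) auto
    then have "submod k ?K (spn A (regular_module A) S)" by (auto simp: submod_def)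
    then have "N \<subseteq> spn A (regular_module A) S"
      using spn_least[of k ?K _ S] S(3) by (auto intro: spn_base)
    then show "\<exists>S\<subseteq>N. finite S \<and> spn A (regular_module A) S = N"
      using S spn_least[OF N S(1)] by blast
  qed
qed

section \<open>Quotients and direct sums of finitely generated modules\<close>

context left_module
begin

lemma diff_minus_commute: "\<lbrakk>x \<in> carrier M; y \<in> carrier M\<rbrakk> \<Longrightarrow> \<ominus>\<^bsub>M\<^esub> (x \<ominus>\<^bsub>M\<^esub> y) = y \<ominus>\<^bsub>M\<^esub> x"
  by (simp add: a_minus_def M.minus_add M.a_ac)

lemma diff_add_diff: "\<lbrakk>x \<in> carrier M; y \<in> carrier M; z \<in> carrier M\<rbrakk> \<Longrightarrow>
    (x \<ominus>\<^bsub>M\<^esub> y) \<oplus>\<^bsub>M\<^esub> (y \<ominus>\<^bsub>M\<^esub> z) = x \<ominus>\<^bsub>M\<^esub> z"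
  using add_diff_add[of x y y z] by (simp add: a_minus_def M.a_ac M.minus_add)
    (simp add: M.a_assoc[symmetric] M.r_neg M.l_neg)

lemma diff_zero [simp]: "x \<in> carrier M \<Longrightarrow> x \<ominus>\<^bsub>M\<^esub> \<zero>\<^bsub>M\<^esub> = x"
  using add_diff_cancel[of x "\<zero>\<^bsub>M\<^esub>"] by simp

lemma smult_diff: "\<lbrakk>a \<in> carrier R; x \<in> carrier M; y \<in> carrier M\<rbrakk> \<Longrightarrow>
    a \<odot>\<^bsub>M\<^esub> (x \<ominus>\<^bsub>M\<^esub> y) = a \<odot>\<^bsub>M\<^esub> x \<ominus>\<^bsub>M\<^esub> a \<odot>\<^bsub>M\<^esub> y"
  by (simp add: a_minus_def smult_r_distr smult_r_minus)

end

text \<open>Cosets of \<open>M\<close> have the wrong type in general. A coset is therefore encoded by a representative, and the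
  representative by the values, on an enumeration of the generators, of one chosen system of coefficients.
  Only the injectivity of this code matters, as it makes the module structure carry over.\<close>

lemma fgmod_quotient:
  fixes A :: "('a, 'r) ring_scheme" and M :: "('a, 'm, 's) module_scheme"
  assumes M: "left_module A M" and fg: "fin_gen A M" and N: "submod A M N"
  shows "\<exists>Q\<in>fg_modules A. \<exists>q\<in>mod_hom A M Q. q ` carrier M = carrier Q \<and> a_kernel M Q q = N"
proof -
  interpret left_module A M by fact
  obtain S where S: "finite S" "S \<subseteq> carrier M"
    and gen: "carrier M = {\<Oplus>\<^bsub>M\<^esub>s\<in>S. c s \<odot>\<^bsub>M\<^esub> s | c. c \<in> S \<rightarrow> carrier A}"
    using fg unfolding fin_gen_def by blast
  obtain e :: "nat \<Rightarrow> 'm" and n where e: "S = e ` {i. i < n}"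
    using finite_imp_nat_seg_image_inj_on[OF S(1)] by blast
  define c where "c y = (SOME c. y = (\<Oplus>\<^bsub>M\<^esub>s\<in>S. c s \<odot>\<^bsub>M\<^esub> s) \<and> c \<in> S \<rightarrow> carrier A)" for y
  have c: "y = (\<Oplus>\<^bsub>M\<^esub>s\<in>S. c y s \<odot>\<^bsub>M\<^esub> s) \<and> c y \<in> S \<rightarrow> carrier A" if "y \<in> carrier M" for y
  proof -
    have "\<exists>c. y = (\<Oplus>\<^bsub>M\<^esub>s\<in>S. c s \<odot>\<^bsub>M\<^esub> s) \<and> c \<in> S \<rightarrow> carrier A"
      using that gen by blast
    then show ?thesis unfolding c_def by (rule someI_ex)
  qed
  define r where "r x = (SOME y. y \<in> carrier M \<and> x \<ominus>\<^bsub>M\<^esub> y \<in> N)" for x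
  have r: "r x \<in> carrier M \<and> x \<ominus>\<^bsub>M\<^esub> r x \<in> N" if "x \<in> carrier M" for x
  proof -
    have "\<exists>y. y \<in> carrier M \<and> x \<ominus>\<^bsub>M\<^esub> y \<in> N" using that submodD(3)[OF N] by (intro exI[of _ x]) simp
    then show ?thesis unfolding r_def by (rule someI_ex)
  qed
  have sym: "y \<ominus>\<^bsub>M\<^esub> x \<in> N" if "x \<ominus>\<^bsub>M\<^esub> y \<in> N" "x \<in> carrier M" "y \<in> carrier M" for x y
    using submod_minus[OF N that(1)] that by (simp add: diff_minus_commute)
  have trans: "x \<ominus>\<^bsub>M\<^esub> z \<in> N" if "x \<ominus>\<^bsub>M\<^esub> y \<in> N" "y \<ominus>\<^bsub>M\<^esub> z \<in> N" "x \<in> carrier M" "y \<in> carrier M" "z \<in> carrier M" for x y z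
    using submodD(4)[OF N that(1,2)] that by (simp add: diff_add_diff)
  define q where "q x = {\<lambda>i. c (r x) (e i)}" for x
  have q_iff: "q x = q y \<longleftrightarrow> x \<ominus>\<^bsub>M\<^esub> y \<in> N" if xy: "x \<in> carrier M" "y \<in> carrier M" for x y
  proof
    assume "q x = q y"
    then have "\<And>i. c (r x) (e i) = c (r y) (e i)" unfolding q_def by (metis singleton_inject)
    then have "(\<Oplus>\<^bsub>M\<^esub>s\<in>S. c (r x) s \<odot>\<^bsub>M\<^esub> s) = (\<Oplus>\<^bsub>M\<^esub>s\<in>S. c (r y) s \<odot>\<^bsub>M\<^esub> s)"
      using e c r xy S by (intro M.finsum_cong') (auto simp: Pi_iff subset_iff)
    then have "r x = r y" using c r xy by metis
    then show "x \<ominus>\<^bsub>M\<^esub> y \<in> N" using r[OF xy(1)] r[OF xy(2)] sym trans[of x "r x" y] xy by metis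
  next
    assume "x \<ominus>\<^bsub>M\<^esub> y \<in> N"
    then have "(\<lambda>z. z \<in> carrier M \<and> x \<ominus>\<^bsub>M\<^esub> z \<in> N) = (\<lambda>z. z \<in> carrier M \<and> y \<ominus>\<^bsub>M\<^esub> z \<in> N)"
      using sym trans xy by (intro ext) metis
    then have "r x = r y" unfolding r_def by simp
    then show "q x = q y" unfolding q_def by simp
  qed
  define rep where "rep = inv_into (carrier M) q"
  have rep: "rep (q x) \<in> carrier M" "x \<ominus>\<^bsub>M\<^esub> rep (q x) \<in> N" if "x \<in> carrier M" for x
  proof -
    show 1: "rep (q x) \<in> carrier M" unfolding rep_def using that by (intro inv_into_into) auto
    have "q (rep (q x)) = q x" unfolding rep_def using that by (intro f_inv_into_f) auto
    then show "x \<ominus>\<^bsub>M\<^esub> rep (q x) \<in> N" using q_iff that 1 by metis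
  qed
  define Q :: "'a fgmod" where "Q = \<lparr>carrier = q ` carrier M, mult = \<lambda>u v. u, one = q \<zero>\<^bsub>M\<^esub>, zero = q \<zero>\<^bsub>M\<^esub>,
    add = \<lambda>u v. q (rep u \<oplus>\<^bsub>M\<^esub> rep v), smult = \<lambda>a u. q (a \<odot>\<^bsub>M\<^esub> rep u)\<rparr>"
  have carr: "q ` carrier M = carrier Q" and zero: "q \<zero>\<^bsub>M\<^esub> = \<zero>\<^bsub>Q\<^esub>" unfolding Q_def by simp_all
  have add: "q (x \<oplus>\<^bsub>M\<^esub> y) = q x \<oplus>\<^bsub>Q\<^esub> q y" if xy: "x \<in> carrier M" "y \<in> carrier M" for x y
  proof -
    have "(x \<oplus>\<^bsub>M\<^esub> y) \<ominus>\<^bsub>M\<^esub> (rep (q x) \<oplus>\<^bsub>M\<^esub> rep (q y)) \<in> N"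
      using xy rep submodD(4)[OF N] by (simp add: add_diff_add)
    then show ?thesis using xy rep q_iff unfolding Q_def by simp
  qed
  have smult: "q (a \<odot>\<^bsub>M\<^esub> x) = a \<odot>\<^bsub>Q\<^esub> q x" if a: "a \<in> carrier A" "x \<in> carrier M" for a x
  proof -
    have "a \<odot>\<^bsub>M\<^esub> x \<ominus>\<^bsub>M\<^esub> a \<odot>\<^bsub>M\<^esub> rep (q x) \<in> N"
      using a rep submodD(5)[OF N] by (simp flip: smult_diff)
    then show ?thesis using a rep q_iff unfolding Q_def by simp
  qed
  have Q: "left_module A Q" by (rule left_module_image[OF M carr add smult zero])
  have hom: "restrict q (carrier M) \<in> mod_hom A M Q"
    by (rule mod_homI) (use carr add smult in auto)
  have surj: "restrict q (carrier M) ` carrier M = carrier Q" using carr by auto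
  have "Q \<in> fg_modules A"
    unfolding fg_modules_def using Q fin_gen_surj_image[OF M Q hom surj fg] by simp
  moreover have "a_kernel M Q (restrict q (carrier M)) = N"
  proof -
    have "x \<in> carrier M \<and> q x = q \<zero>\<^bsub>M\<^esub> \<longleftrightarrow> x \<in> N" for x
      using q_iff[of x "\<zero>\<^bsub>M\<^esub>"] submodD(2)[OF N, of x] by (cases "x \<in> carrier M") auto
    then show ?thesis unfolding a_kernel_def' by (auto simp flip: zero)
  qed
  ultimately show ?thesis using hom surj by blast
qed

text \<open>The biproduct equations, evaluated at elements.\<close>

definition direct_sum ::
    "('a, 'r) ring_scheme \<Rightarrow> 'a fgmod \<Rightarrow> 'a fgmod \<Rightarrow> 'a fgmod \<Rightarrow> 'a fgmap \<Rightarrow> 'a fgmap \<Rightarrow> 'a fgmap \<Rightarrow> 'a fgmap \<Rightarrow> bool"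
  where "direct_sum A M N S i j p q \<longleftrightarrow>
    S \<in> fg_modules A \<and> i \<in> mod_hom A M S \<and> j \<in> mod_hom A N S \<and> p \<in> mod_hom A S M \<and> q \<in> mod_hom A S N \<and>
    (\<forall>x\<in>carrier M. p (i x) = x \<and> q (i x) = \<zero>\<^bsub>N\<^esub>) \<and>
    (\<forall>y\<in>carrier N. q (j y) = y \<and> p (j y) = \<zero>\<^bsub>M\<^esub>) \<and>
    (\<forall>s\<in>carrier S. i (p s) \<oplus>\<^bsub>S\<^esub> j (q s) = s)"

lemma direct_sumD:
  assumes "direct_sum A M N S i j p q"
  shows "S \<in> fg_modules A" "i \<in> mod_hom A M S" "j \<in> mod_hom A N S" "p \<in> mod_hom A S M" "q \<in> mod_hom A S N"
    "x \<in> carrier M \<Longrightarrow> p (i x) = x" "x \<in> carrier M \<Longrightarrow> q (i x) = \<zero>\<^bsub>N\<^esub>"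
    "y \<in> carrier N \<Longrightarrow> q (j y) = y" "y \<in> carrier N \<Longrightarrow> p (j y) = \<zero>\<^bsub>M\<^esub>"
    "s \<in> carrier S \<Longrightarrow> i (p s) \<oplus>\<^bsub>S\<^esub> j (q s) = s"
  using assms unfolding direct_sum_def by auto

lemma fg_modulesD: "M \<in> fg_modules A \<Longrightarrow> left_module A M" "M \<in> fg_modules A \<Longrightarrow> fin_gen A M"
  by (auto simp: fg_modules_def)

lemma module_homI: "\<lbrakk>left_module R M; left_module R N; f \<in> mod_hom R M N\<rbrakk> \<Longrightarrow> module_hom R M N f"
  by (intro module_hom.intro module_hom_axioms.intro)

text \<open>The module of pairs lives on another type; its quotient by the zero submodule is a copy on the right one.\<close>

lemma direct_sum_exists:
  assumes M: "M \<in> fg_modules A" and N: "N \<in> fg_modules A"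
  shows "\<exists>S i j p q. direct_sum A M N S i j p q"
proof -
  note M' = fg_modulesD[OF M] and N' = fg_modulesD[OF N]
  interpret M: left_module A M by (rule M')
  interpret N: left_module A N by (rule N')
  define D where "D = \<lparr>carrier = carrier M \<times> carrier N, mult = \<lambda>u v. u, one = (\<zero>\<^bsub>M\<^esub>, \<zero>\<^bsub>N\<^esub>),
    zero = (\<zero>\<^bsub>M\<^esub>, \<zero>\<^bsub>N\<^esub>), add = \<lambda>u v. (fst u \<oplus>\<^bsub>M\<^esub> fst v, snd u \<oplus>\<^bsub>N\<^esub> snd v),
    smult = \<lambda>a u. (a \<odot>\<^bsub>M\<^esub> fst u, a \<odot>\<^bsub>N\<^esub> snd u)\<rparr>"
  have [simp]: "carrier D = carrier M \<times> carrier N" "\<zero>\<^bsub>D\<^esub> = (\<zero>\<^bsub>M\<^esub>, \<zero>\<^bsub>N\<^esub>)"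
    "\<And>u v. u \<oplus>\<^bsub>D\<^esub> v = (fst u \<oplus>\<^bsub>M\<^esub> fst v, snd u \<oplus>\<^bsub>N\<^esub> snd v)"
    "\<And>a u. a \<odot>\<^bsub>D\<^esub> u = (a \<odot>\<^bsub>M\<^esub> fst u, a \<odot>\<^bsub>N\<^esub> snd u)"
    unfolding D_def by simp_all
  have "abelian_group D"
  proof (rule abelian_groupI)
    fix u assume "u \<in> carrier D"
    then show "\<exists>v\<in>carrier D. v \<oplus>\<^bsub>D\<^esub> u = \<zero>\<^bsub>D\<^esub>"
      by (intro bexI[of _ "(\<ominus>\<^bsub>M\<^esub> fst u, \<ominus>\<^bsub>N\<^esub> snd u)"]) (auto simp: M.M.l_neg N.M.l_neg)
  qed (auto simp: M.M.a_ac N.M.a_ac)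
  then have D: "left_module A D"
    by (intro left_module.intro left_module_axioms.intro M.R.ring_axioms)
      (auto simp: M.smult_l_distr N.smult_l_distr M.smult_r_distr N.smult_r_distr M.smult_assoc N.smult_assoc)
  interpret D: left_module A D by (rule D)
  have i: "(\<lambda>x\<in>carrier M. (x, \<zero>\<^bsub>N\<^esub>)) \<in> mod_hom A M D" and j: "(\<lambda>y\<in>carrier N. (\<zero>\<^bsub>M\<^esub>, y)) \<in> mod_hom A N D"
    by (rule mod_homI; auto simp: M.smult_r_null N.smult_r_null)+
  have p: "(\<lambda>u\<in>carrier D. fst u) \<in> mod_hom A D M" and q: "(\<lambda>u\<in>carrier D. snd u) \<in> mod_hom A D N"
    by (rule mod_homI; auto)+
  interpret i: module_hom A M D "\<lambda>x\<in>carrier M. (x, \<zero>\<^bsub>N\<^esub>)" by (rule module_homI[OF M'(1) D i])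
  interpret j: module_hom A N D "\<lambda>y\<in>carrier N. (\<zero>\<^bsub>M\<^esub>, y)" by (rule module_homI[OF N'(1) D j])
  obtain S T where S: "S \<subseteq> carrier M" "finite S" "spn A M S = carrier M"
    and T: "T \<subseteq> carrier N" "finite T" "spn A N T = carrier N"
    using M'(2) N'(2) fin_gen_iff[OF M'(1)] fin_gen_iff[OF N'(1)] by auto
  define U where "U = (\<lambda>x\<in>carrier M. (x, \<zero>\<^bsub>N\<^esub>)) ` S \<union> (\<lambda>y\<in>carrier N. (\<zero>\<^bsub>M\<^esub>, y)) ` T"
  have Uc: "U \<subseteq> carrier D" using S(1) T(1) unfolding U_def by auto
  note spU = D.spn_submod[OF Uc]
  have "u \<in> spn A D U" if u: "u \<in> carrier D" for u
  proof -
    have "spn A D ((\<lambda>x\<in>carrier M. (x, \<zero>\<^bsub>N\<^esub>)) ` S) \<subseteq> spn A D U"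
      "spn A D ((\<lambda>y\<in>carrier N. (\<zero>\<^bsub>M\<^esub>, y)) ` T) \<subseteq> spn A D U"
      by (rule spn_least[OF spU]; auto simp: U_def intro: spn_base)+
    then have "(\<lambda>x\<in>carrier M. (x, \<zero>\<^bsub>N\<^esub>)) ` carrier M \<subseteq> spn A D U"
      "(\<lambda>y\<in>carrier N. (\<zero>\<^bsub>M\<^esub>, y)) ` carrier N \<subseteq> spn A D U"
      using i.spn_image[OF S(1)] j.spn_image[OF T(1)] S(3) T(3) by auto
    then have "(fst u, \<zero>\<^bsub>N\<^esub>) \<in> spn A D U" "(\<zero>\<^bsub>M\<^esub>, snd u) \<in> spn A D U" using u by auto
    from submodD(4)[OF spU this] show ?thesis using u by auto
  qed
  then have "spn A D U = carrier D" using submodD(1)[OF spU] by blast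
  then have "fin_gen A D" unfolding fin_gen_iff[OF D] using Uc S(2) T(2)
    by (intro exI[of _ U]) (auto simp: U_def)
  from fgmod_quotient[OF D this D.submod_zero] obtain X \<pi> where X: "X \<in> fg_modules A"
    and \<pi>: "\<pi> \<in> mod_hom A D X" "\<pi> ` carrier D = carrier X" "a_kernel D X \<pi> = {\<zero>\<^bsub>D\<^esub>}" by blast
  note X' = fg_modulesD[OF X]
  interpret \<pi>: module_hom A D X \<pi> by (rule module_homI[OF D X'(1) \<pi>(1)])
  have inj: "\<And>u. u \<in> carrier D \<Longrightarrow> \<pi> u = \<zero>\<^bsub>X\<^esub> \<Longrightarrow> u = \<zero>\<^bsub>D\<^esub>"
    using \<pi>(3) unfolding a_kernel_def' by blast
  obtain p' where p': "p' \<in> mod_hom A X M" "\<And>u. u \<in> carrier D \<Longrightarrow> p' (\<pi> u) = fst u"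
    using hom_factors_through_surj[OF D X'(1) M'(1) \<pi>(1,2) p] inj by force
  obtain q' where q': "q' \<in> mod_hom A X N" "\<And>u. u \<in> carrier D \<Longrightarrow> q' (\<pi> u) = snd u"
    using hom_factors_through_surj[OF D X'(1) N'(1) \<pi>(1,2) q] inj by force
  define i' where "i' = compose (carrier M) \<pi> (\<lambda>x\<in>carrier M. (x, \<zero>\<^bsub>N\<^esub>))"
  define j' where "j' = compose (carrier N) \<pi> (\<lambda>y\<in>carrier N. (\<zero>\<^bsub>M\<^esub>, y))"
  have i': "i' \<in> mod_hom A M X" "\<And>x. x \<in> carrier M \<Longrightarrow> i' x = \<pi> (x, \<zero>\<^bsub>N\<^esub>)"
    unfolding i'_def using compose_mod_hom[OF M'(1) i \<pi>(1)] by (auto simp: compose_def)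
  have j': "j' \<in> mod_hom A N X" "\<And>y. y \<in> carrier N \<Longrightarrow> j' y = \<pi> (\<zero>\<^bsub>M\<^esub>, y)"
    unfolding j'_def using compose_mod_hom[OF N'(1) j \<pi>(1)] by (auto simp: compose_def)
  have "i' (p' s) \<oplus>\<^bsub>X\<^esub> j' (q' s) = s" if "s \<in> carrier X" for s
  proof -
    have "s \<in> \<pi> ` carrier D" using that \<pi>(2) by simp
    then obtain x y where u: "x \<in> carrier M" "y \<in> carrier N" "s = \<pi> (x, y)" by auto
    have "\<pi> (x, \<zero>\<^bsub>N\<^esub>) \<oplus>\<^bsub>X\<^esub> \<pi> (\<zero>\<^bsub>M\<^esub>, y) = \<pi> ((x, \<zero>\<^bsub>N\<^esub>) \<oplus>\<^bsub>D\<^esub> (\<zero>\<^bsub>M\<^esub>, y))"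
      using u by (intro \<pi>.f_add[symmetric]) simp_all
    then show ?thesis using u by (simp add: p'(2) q'(2) i'(2) j'(2))
  qed
  moreover have "p' (i' x) = x" "q' (i' x) = \<zero>\<^bsub>N\<^esub>" if "x \<in> carrier M" for x
    using that by (simp_all add: p'(2) q'(2) i'(2))
  moreover have "q' (j' y) = y" "p' (j' y) = \<zero>\<^bsub>M\<^esub>" if "y \<in> carrier N" for y
    using that by (simp_all add: p'(2) q'(2) j'(2))
  ultimately have "direct_sum A M N X i' j' p' q'"
    unfolding direct_sum_def using X i'(1) j'(1) p'(1) q'(1) by simp
  then show ?thesis by blast
qed

lemma direct_sum_out:
  assumes S: "direct_sum A M N S i j p q" and M: "left_module A M" "left_module A N" "left_module A T"
    and f: "f \<in> mod_hom A M T" and g: "g \<in> mod_hom A N T"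
  shows "\<exists>h\<in>mod_hom A S T. (\<forall>s\<in>carrier S. h s = f (p s) \<oplus>\<^bsub>T\<^esub> g (q s)) \<and>
    (\<forall>x\<in>carrier M. h (i x) = f x) \<and> (\<forall>y\<in>carrier N. h (j y) = g y)"
proof -
  note SD = direct_sumD[OF S]
  note SM = fg_modulesD(1)[OF SD(1)]
  interpret f: module_hom A M T f by (rule module_homI[OF M(1,3) f])
  interpret g: module_hom A N T g by (rule module_homI[OF M(2,3) g])
  interpret S: left_module A S by (rule SM)
  have "(\<lambda>s\<in>carrier S. compose (carrier S) f p s \<oplus>\<^bsub>T\<^esub> compose (carrier S) g q s) \<in> mod_hom A S T"
    by (intro add_hom compose_mod_hom[where M = M] compose_mod_hom[where M = N] SM SD M f g)
  then have h: "(\<lambda>s\<in>carrier S. f (p s) \<oplus>\<^bsub>T\<^esub> g (q s)) \<in> mod_hom A S T"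
    by (rule back_subst[of "\<lambda>h. h \<in> mod_hom A S T"]) (intro restrict_ext, simp add: compose_def)
  show ?thesis
    using SD(6-9) mod_homD(1)[OF SD(2)] mod_homD(1)[OF SD(3)] by (intro bexI[OF _ h]) auto
qed

lemma direct_sum_in:
  assumes S: "direct_sum A M N S i j p q" and M: "left_module A M" "left_module A N" "left_module A T"
    and f: "f \<in> mod_hom A T M" and g: "g \<in> mod_hom A T N"
  shows "\<exists>h\<in>mod_hom A T S. (\<forall>t\<in>carrier T. h t = i (f t) \<oplus>\<^bsub>S\<^esub> j (g t) \<and> p (h t) = f t \<and> q (h t) = g t)"
proof -
  note SD = direct_sumD[OF S]
  note SM = fg_modulesD(1)[OF SD(1)]
  interpret i: module_hom A M S i by (rule module_homI[OF M(1) SM SD(2)])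
  interpret j: module_hom A N S j by (rule module_homI[OF M(2) SM SD(3)])
  interpret p: module_hom A S M p by (rule module_homI[OF SM M(1) SD(4)])
  interpret q: module_hom A S N q by (rule module_homI[OF SM M(2) SD(5)])
  have "(\<lambda>t\<in>carrier T. compose (carrier T) i f t \<oplus>\<^bsub>S\<^esub> compose (carrier T) j g t) \<in> mod_hom A T S"
    by (intro add_hom compose_mod_hom[where M = M] compose_mod_hom[where M = N] SM SD M f g)
  then have h: "(\<lambda>t\<in>carrier T. i (f t) \<oplus>\<^bsub>S\<^esub> j (g t)) \<in> mod_hom A T S"
    by (rule back_subst[of "\<lambda>h. h \<in> mod_hom A T S"]) (intro restrict_ext, simp add: compose_def)
  show ?thesis
  proof (intro bexI[OF _ h] ballI)
    fix t assume t: "t \<in> carrier T"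
    then have "f t \<in> carrier M" "g t \<in> carrier N" using mod_homD(1)[OF f] mod_homD(1)[OF g] by simp_all
    then show "(\<lambda>t\<in>carrier T. i (f t) \<oplus>\<^bsub>S\<^esub> j (g t)) t = i (f t) \<oplus>\<^bsub>S\<^esub> j (g t)
        \<and> p ((\<lambda>t\<in>carrier T. i (f t) \<oplus>\<^bsub>S\<^esub> j (g t)) t) = f t
        \<and> q ((\<lambda>t\<in>carrier T. i (f t) \<oplus>\<^bsub>S\<^esub> j (g t)) t) = g t"
      using t by (simp add: p.f_add q.f_add SD(6-9))
  qed
qed

section \<open>Projective modules and extension of homomorphisms\<close>

lemma homD:
  assumes "f \<in> mod_hom R M N" "left_module R M" "left_module R N"
  shows "x \<in> carrier M \<Longrightarrow> f x \<in> carrier N"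
    "\<lbrakk>x \<in> carrier M; y \<in> carrier M\<rbrakk> \<Longrightarrow> f (x \<oplus>\<^bsub>M\<^esub> y) = f x \<oplus>\<^bsub>N\<^esub> f y"
    "\<lbrakk>a \<in> carrier R; x \<in> carrier M\<rbrakk> \<Longrightarrow> f (a \<odot>\<^bsub>M\<^esub> x) = a \<odot>\<^bsub>N\<^esub> f x"
    "f \<zero>\<^bsub>M\<^esub> = \<zero>\<^bsub>N\<^esub>"
    "x \<in> carrier M \<Longrightarrow> f (\<ominus>\<^bsub>M\<^esub> x) = \<ominus>\<^bsub>N\<^esub> f x"
    "\<lbrakk>x \<in> carrier M; y \<in> carrier M\<rbrakk> \<Longrightarrow> f (x \<ominus>\<^bsub>M\<^esub> y) = f x \<ominus>\<^bsub>N\<^esub> f y"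
proof -
  interpret module_hom R M N f by (rule module_homI[OF assms(2,3,1)])
  show "x \<in> carrier M \<Longrightarrow> f x \<in> carrier N"
    "\<lbrakk>x \<in> carrier M; y \<in> carrier M\<rbrakk> \<Longrightarrow> f (x \<oplus>\<^bsub>M\<^esub> y) = f x \<oplus>\<^bsub>N\<^esub> f y"
    "\<lbrakk>a \<in> carrier R; x \<in> carrier M\<rbrakk> \<Longrightarrow> f (a \<odot>\<^bsub>M\<^esub> x) = a \<odot>\<^bsub>N\<^esub> f x"
    "f \<zero>\<^bsub>M\<^esub> = \<zero>\<^bsub>N\<^esub>"
    "x \<in> carrier M \<Longrightarrow> f (\<ominus>\<^bsub>M\<^esub> x) = \<ominus>\<^bsub>N\<^esub> f x"
    "\<lbrakk>x \<in> carrier M; y \<in> carrier M\<rbrakk> \<Longrightarrow> f (x \<ominus>\<^bsub>M\<^esub> y) = f x \<ominus>\<^bsub>N\<^esub> f y"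
    by (simp_all add: f_add f_smult f_minus f_diff)
qed

lemma hom_comp:
  assumes "f \<in> mod_hom R L M" "g \<in> mod_hom R M N" "left_module R L"
  shows "\<exists>h\<in>mod_hom R L N. \<forall>x\<in>carrier L. h x = g (f x)"
  by (rule bexI[OF _ compose_mod_hom[OF assms(3,1,2)]]) (simp add: compose_def)

lemma projective_module_fg: "projective_module A P \<Longrightarrow> P \<in> fg_modules A"
  by (simp add: projective_module_def)

lemma projective_lift:
  assumes "projective_module A P" "M \<in> fg_modules A" "N \<in> fg_modules A"
    "g \<in> mod_hom A M N" "g ` carrier M = carrier N" "f \<in> mod_hom A P N"
  shows "\<exists>h\<in>mod_hom A P M. \<forall>x\<in>carrier P. g (h x) = f x"
  using assms unfolding projective_module_def compose_eq_hom_iff[OF assms(6), symmetric] by blast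

lemma projective_moduleI:
  assumes "P \<in> fg_modules A"
    "\<And>M N g f. \<lbrakk>M \<in> fg_modules A; N \<in> fg_modules A; g \<in> mod_hom A M N; f \<in> mod_hom A P N;
      g ` carrier M = carrier N\<rbrakk> \<Longrightarrow> \<exists>h\<in>mod_hom A P M. \<forall>x\<in>carrier P. g (h x) = f x"
  shows "projective_module A P"
  unfolding projective_module_def
proof (intro conjI ballI impI)
  fix M N g f assume "M \<in> fg_modules A" "N \<in> fg_modules A" "g \<in> mod_hom A M N" and f: "f \<in> mod_hom A P N"
    and "g ` carrier M = carrier N"
  from assms(2)[OF this] obtain h where "h \<in> mod_hom A P M" "\<forall>x\<in>carrier P. g (h x) = f x" by (rule bexE)
  then show "\<exists>h\<in>mod_hom A P M. compose (carrier P) g h = f"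
    using compose_eq_hom_iff[OF f] by blast
qed (fact assms(1))

lemma projective_retract:
  assumes Q: "Q \<in> fg_modules A" and P: "projective_module A P"
    and i: "i \<in> mod_hom A Q P" and r: "r \<in> mod_hom A P Q" and ri: "\<And>x. x \<in> carrier Q \<Longrightarrow> r (i x) = x"
  shows "projective_module A Q"
proof (rule projective_moduleI[OF Q])
  fix M N g f assume M: "M \<in> fg_modules A" and N: "N \<in> fg_modules A" and g: "g \<in> mod_hom A M N"
    and f: "f \<in> mod_hom A Q N" and surj: "g ` carrier M = carrier N"
  note Pf = projective_module_fg[OF P]
  obtain f' where f': "f' \<in> mod_hom A P N" "\<forall>x\<in>carrier P. f' x = f (r x)"
    using hom_comp[OF r f fg_modulesD(1)[OF Pf]] by blast
  obtain h where h: "h \<in> mod_hom A P M" "\<forall>x\<in>carrier P. g (h x) = f' x"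
    using projective_lift[OF P M N g surj f'(1)] by blast
  obtain h' where h': "h' \<in> mod_hom A Q M" "\<forall>x\<in>carrier Q. h' x = h (i x)"
    using hom_comp[OF i h(1) fg_modulesD(1)[OF Q]] by blast
  show "\<exists>h\<in>mod_hom A Q M. \<forall>x\<in>carrier Q. g (h x) = f x"
    using h h' f' mod_homD(1)[OF i] ri by (intro bexI[OF _ h'(1)]) simp
qed

lemma projective_direct_sum:
  assumes S: "direct_sum A P Q S i j p q" and P: "projective_module A P" and Q: "projective_module A Q"
  shows "projective_module A S"
proof (rule projective_moduleI)
  note D = direct_sumD[OF S]
  show Sf: "S \<in> fg_modules A" by (rule D(1))
  fix M N g f assume M: "M \<in> fg_modules A" and N: "N \<in> fg_modules A" and g: "g \<in> mod_hom A M N"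
    and f: "f \<in> mod_hom A S N" and surj: "g ` carrier M = carrier N"
  note Pf = projective_module_fg[OF P] and Qf = projective_module_fg[OF Q]
  note lm = fg_modulesD(1)[OF Pf] fg_modulesD(1)[OF Qf] fg_modulesD(1)[OF M] fg_modulesD(1)[OF N] fg_modulesD(1)[OF Sf]
  obtain f1 where f1: "f1 \<in> mod_hom A P N" "\<forall>x\<in>carrier P. f1 x = f (i x)"
    using hom_comp[OF D(2) f lm(1)] by blast
  obtain f2 where f2: "f2 \<in> mod_hom A Q N" "\<forall>x\<in>carrier Q. f2 x = f (j x)"
    using hom_comp[OF D(3) f lm(2)] by blast
  obtain h1 where h1: "h1 \<in> mod_hom A P M" "\<forall>x\<in>carrier P. g (h1 x) = f1 x"
    using projective_lift[OF P M N g surj f1(1)] by blast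
  obtain h2 where h2: "h2 \<in> mod_hom A Q M" "\<forall>x\<in>carrier Q. g (h2 x) = f2 x"
    using projective_lift[OF Q M N g surj f2(1)] by blast
  obtain h where h: "h \<in> mod_hom A S M" "\<forall>s\<in>carrier S. h s = h1 (p s) \<oplus>\<^bsub>M\<^esub> h2 (q s)"
    using direct_sum_out[OF S lm(1,2,3) h1(1) h2(1)] by blast
  show "\<exists>h\<in>mod_hom A S M. \<forall>x\<in>carrier S. g (h x) = f x"
  proof (intro bexI[OF _ h(1)] ballI)
    fix s assume s: "s \<in> carrier S"
    then have pq: "p s \<in> carrier P" "q s \<in> carrier Q" using mod_homD(1)[OF D(4)] mod_homD(1)[OF D(5)] by simp_all
    then have "g (h s) = f (i (p s)) \<oplus>\<^bsub>N\<^esub> f (j (q s))"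
      using s h(2) h1(2) h2(2) f1(2) f2(2) mod_homD(1)[OF h1(1)] mod_homD(1)[OF h2(1)]
      by (simp add: mod_homD(2)[OF g])
    also have "\<dots> = f (i (p s) \<oplus>\<^bsub>S\<^esub> j (q s))"
      using pq mod_homD(1)[OF D(2)] mod_homD(1)[OF D(3)] by (simp add: mod_homD(2)[OF f])
    also have "\<dots> = f s" using D(10)[OF s] by simp
    finally show "g (h s) = f s" .
  qed
qed

lemma projective_zero:
  assumes Z: "Z \<in> fg_modules A" and zero: "carrier Z = {\<zero>\<^bsub>Z\<^esub>}"
  shows "projective_module A Z"
proof (rule projective_moduleI[OF Z])
  fix M N g f assume M: "M \<in> fg_modules A" and N: "N \<in> fg_modules A" and g: "g \<in> mod_hom A M N"
    and f: "f \<in> mod_hom A Z N"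
  note lm = fg_modulesD(1)[OF Z] fg_modulesD(1)[OF M] fg_modulesD(1)[OF N]
  show "\<exists>h\<in>mod_hom A Z M. \<forall>x\<in>carrier Z. g (h x) = f x"
    by (rule bexI[OF _ zero_hom[OF lm(1,2)]]) (use zero homD(4)[OF g lm(2,3)] homD(4)[OF f lm(1,3)] in auto)
qed

definition hom_extends ::
    "('a, 'r) ring_scheme \<Rightarrow> ('a, 'l, 's) module_scheme \<Rightarrow> ('l \<Rightarrow> 'm) \<Rightarrow> ('a, 'm, 't) module_scheme \<Rightarrow>
      ('a, 'n, 'u) module_scheme \<Rightarrow> bool"
  where "hom_extends A L i M T \<longleftrightarrow> (\<forall>f\<in>mod_hom A L T. \<exists>g\<in>mod_hom A M T. \<forall>x\<in>carrier L. g (i x) = f x)"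

lemma hom_extendsD:
  "\<lbrakk>hom_extends A L i M T; f \<in> mod_hom A L T\<rbrakk> \<Longrightarrow> \<exists>g\<in>mod_hom A M T. \<forall>x\<in>carrier L. g (i x) = f x"
  by (simp add: hom_extends_def)

text \<open>A chase with the comparison map between two presentations of \<open>N\<close>: whether homomorphisms to \<open>T\<close>
  extend along the kernel of a projective presentation of \<open>N\<close> decides it along every kernel with
  cokernel \<open>N\<close>. This is the vanishing of the first extension group of \<open>N\<close> by \<open>T\<close>.\<close>

lemma hom_extends_from_presentation:
  assumes fg: "K \<in> fg_modules A" "P \<in> fg_modules A" "N \<in> fg_modules A" "L \<in> fg_modules A" "M \<in> fg_modules A"
    and T: "left_module A T" and P: "projective_module A P"
    and s1: "short_exact A K i P p N" and s2: "short_exact A L j M q N"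
    and ext: "hom_extends A K i P T"
  shows "hom_extends A L j M T"
  unfolding hom_extends_def
proof
  fix f assume f: "f \<in> mod_hom A L T"
  note lm = fg[THEN fg_modulesD(1)]
  interpret M: left_module A M by (rule lm)
  from s1 have i: "i \<in> mod_hom A K P" and p: "p \<in> mod_hom A P N" and surj1: "p ` carrier P = carrier N"
    and ker1: "i ` carrier K = a_kernel P N p" unfolding short_exact_def by auto
  from s2 have j: "j \<in> mod_hom A L M" "inj_on j (carrier L)" and q: "q \<in> mod_hom A M N"
    and surj2: "q ` carrier M = carrier N"
    and ker2: "j ` carrier L = a_kernel M N q" unfolding short_exact_def by auto
  note i' = homD[OF i lm(1,2)] and p' = homD[OF p lm(2,3)] and j' = homD[OF j(1) lm(4,5)]
    and q' = homD[OF q lm(5,3)]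
  obtain h where h: "h \<in> mod_hom A P M" "\<forall>x\<in>carrier P. q (h x) = p x"
    using projective_lift[OF P fg(5,3) q surj2 p] by blast
  note h' = homD[OF h(1) lm(2,5)]
  obtain hi where hi: "hi \<in> mod_hom A K M" "\<forall>x\<in>carrier K. hi x = h (i x)"
    using hom_comp[OF i h(1) lm(1)] by blast
  have pi: "p (i x) = \<zero>\<^bsub>N\<^esub>" if "x \<in> carrier K" for x
    using ker1 that unfolding a_kernel_def' by blast
  have "hi ` carrier K \<subseteq> j ` carrier L"
    unfolding ker2 a_kernel_def' using hi(2) h(2) pi i' h' by auto
  then obtain t where t: "t \<in> mod_hom A K L" "\<forall>x\<in>carrier K. j (t x) = hi x"
    using hom_factors_through_inj[OF lm(4,5,1) j hi(1)] by blast
  obtain ft where ft: "ft \<in> mod_hom A K T" "\<forall>x\<in>carrier K. ft x = f (t x)"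
    using hom_comp[OF t(1) f lm(1)] by blast
  obtain u where u: "u \<in> mod_hom A P T" "\<forall>x\<in>carrier K. u (i x) = ft x"
    using hom_extendsD[OF ext ft(1)] by blast
  have "\<exists>g\<in>mod_hom A M T. (\<forall>l\<in>carrier L. g (j l) = f l) \<and> (\<forall>y\<in>carrier P. g (h y) = u y)"
  proof (rule glue_hom[OF lm(4,2,5) T j(1) h(1) f u(1)])
    fix x assume x: "x \<in> carrier M"
    then have "q x \<in> p ` carrier P" using q' surj1 by simp
    then obtain y where y: "y \<in> carrier P" "q x = p y" by blast
    then have "q (x \<ominus>\<^bsub>M\<^esub> h y) = \<zero>\<^bsub>N\<^esub>"
      using x h(2) q'(1)[OF x] left_module.diff_self[OF lm(3)] by (simp add: q'(6) h'(1))
    then have "x \<ominus>\<^bsub>M\<^esub> h y \<in> j ` carrier L" unfolding ker2 a_kernel_def' using x y h' by simp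
    then obtain l where l: "l \<in> carrier L" "x \<ominus>\<^bsub>M\<^esub> h y = j l" by blast
    then have "x = j l \<oplus>\<^bsub>M\<^esub> h y" using M.diff_add_cancel[OF x h'(1)[OF y(1)]] by simp
    then show "\<exists>l\<in>carrier L. \<exists>y\<in>carrier P. x = j l \<oplus>\<^bsub>M\<^esub> h y" using l(1) y(1) by blast
  next
    fix l y assume ly: "l \<in> carrier L" "y \<in> carrier P" "j l = h y"
    have "j l \<in> a_kernel M N q" using ker2 ly(1) by blast
    then have "p y = \<zero>\<^bsub>N\<^esub>" using ly h(2) unfolding a_kernel_def' by simp
    then have "y \<in> i ` carrier K" unfolding ker1 a_kernel_def' using ly(2) by simp
    then obtain k where k: "k \<in> carrier K" "y = i k" by blast
    then have "j l = j (t k)" using ly(3) t(2) hi(2) by simp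
    then have "l = t k" using j(2) ly(1) mod_homD(1)[OF t(1) k(1)] by (auto dest: inj_onD)
    then show "f l = u y" using k u(2) ft(2) by simp
  qed
  then show "\<exists>g\<in>mod_hom A M T. \<forall>x\<in>carrier L. g (j x) = f x" by blast
qed

lemma zero_module_exists:
  assumes "M \<in> fg_modules A"
  shows "\<exists>Z\<in>fg_modules A. carrier Z = {\<zero>\<^bsub>Z\<^esub>}"
proof -
  note M = fg_modulesD[OF assms]
  interpret M: left_module A M by (rule M)
  obtain Z q where Z: "Z \<in> fg_modules A" and q: "q \<in> mod_hom A M Z" "q ` carrier M = carrier Z"
    "a_kernel M Z q = carrier M"
    using fgmod_quotient[OF M M.submod_carrier] by blast
  have "carrier Z = {\<zero>\<^bsub>Z\<^esub>}"
    unfolding q(2)[symmetric] using q(3) M.M.zero_closed unfolding a_kernel_def' by force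
  then show ?thesis using Z by blast
qed

text \<open>\<open>A\<close> is not of the type of the finitely generated modules under consideration; it enters through a copy.\<close>

lemma regular_module_copy:
  assumes A: "ring A"
  shows "\<exists>F\<in>fg_modules A. \<exists>q\<in>mod_hom A (regular_module A) F. \<exists>r\<in>mod_hom A F (regular_module A).
    (\<forall>a\<in>carrier A. r (q a) = a) \<and> (\<forall>x\<in>carrier F. q (r x) = x)"
proof -
  let ?M = "regular_module A"
  interpret ring A by fact
  note M = regular_module_left_module[OF A]
  interpret M: left_module A ?M by (rule M)
  have "x \<in> spn A ?M {\<one>\<^bsub>A\<^esub>}" if "x \<in> carrier A" for x
    using spn_smult[OF that spn_base[of "\<one>\<^bsub>A\<^esub>" "{\<one>\<^bsub>A\<^esub>}" A ?M]] that by simp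
  moreover have "spn A ?M {\<one>\<^bsub>A\<^esub>} \<subseteq> carrier ?M" by (rule spn_least[OF M.submod_carrier]) simp
  ultimately have "spn A ?M {\<one>\<^bsub>A\<^esub>} = carrier ?M" by auto
  then have "fin_gen A ?M" unfolding fin_gen_iff[OF M] by (intro exI[of _ "{\<one>\<^bsub>A\<^esub>}"]) simp
  from fgmod_quotient[OF M this M.submod_zero] obtain F q where F: "F \<in> fg_modules A"
    and q: "q \<in> mod_hom A ?M F" "q ` carrier ?M = carrier F" "a_kernel ?M F q = {\<zero>\<^bsub>A\<^esub>}" by auto
  have ker: "x = \<zero>\<^bsub>A\<^esub>" if "x \<in> carrier A" "q x = \<zero>\<^bsub>F\<^esub>" for x
    using q(3) that unfolding a_kernel_def' by auto
  have "\<exists>r\<in>mod_hom A F ?M. \<forall>x\<in>carrier ?M. r (q x) = (\<lambda>x\<in>carrier ?M. x) x"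
    by (rule hom_factors_through_surj[OF M fg_modulesD(1)[OF F] M q(1,2) id_hom[OF M]]) (simp add: ker)
  then obtain r where r: "r \<in> mod_hom A F ?M" "\<forall>a\<in>carrier A. r (q a) = a" by auto
  have "q (r x) = x" if "x \<in> carrier F" for x
  proof -
    have "x \<in> q ` carrier ?M" using that q(2) by simp
    then show ?thesis using r(2) by auto
  qed
  then show ?thesis using F q(1) r by blast
qed

lemma regular_copy_projective:
  assumes A: "ring A" and F: "F \<in> fg_modules A" and q: "q \<in> mod_hom A (regular_module A) F"
    and r: "r \<in> mod_hom A F (regular_module A)" and qr: "\<forall>x\<in>carrier F. q (r x) = x"
  shows "projective_module A F"
proof (rule projective_moduleI[OF F])
  fix M N g f assume M: "M \<in> fg_modules A" and N: "N \<in> fg_modules A" and g: "g \<in> mod_hom A M N"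
    and f: "f \<in> mod_hom A F N" and surj: "g ` carrier M = carrier N"
  note lm = fg_modulesD(1)[OF F] fg_modulesD(1)[OF M] fg_modulesD(1)[OF N]
  interpret A: ring A by fact
  interpret M: left_module A M by (rule lm)
  interpret F: left_module A F by (rule lm)
  have q1: "q \<one>\<^bsub>A\<^esub> \<in> carrier F" using mod_homD(1)[OF q] by simp
  have "f (q \<one>\<^bsub>A\<^esub>) \<in> g ` carrier M" using surj mod_homD(1)[OF f q1] by simp
  then obtain m where m: "m \<in> carrier M" "g m = f (q \<one>\<^bsub>A\<^esub>)" by force
  have rc: "r x \<in> carrier A" if "x \<in> carrier F" for x using mod_homD(1)[OF r that] by simp
  have h: "(\<lambda>x\<in>carrier F. r x \<odot>\<^bsub>M\<^esub> m) \<in> mod_hom A F M"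
    using m(1) by (intro mod_homI)
      (simp_all add: rc mod_homD(2,3)[OF r] M.smult_l_distr M.smult_assoc)
  show "\<exists>h\<in>mod_hom A F M. \<forall>x\<in>carrier F. g (h x) = f x"
  proof (intro bexI[OF _ h] ballI)
    fix x assume x: "x \<in> carrier F"
    have "g (r x \<odot>\<^bsub>M\<^esub> m) = f (r x \<odot>\<^bsub>F\<^esub> q \<one>\<^bsub>A\<^esub>)"
      using m rc[OF x] q1 by (simp add: mod_homD(3)[OF g] mod_homD(3)[OF f])
    also have "r x \<odot>\<^bsub>F\<^esub> q \<one>\<^bsub>A\<^esub> = q (r x)"
      using mod_homD(3)[OF q, of "r x" "\<one>\<^bsub>A\<^esub>"] rc[OF x] by simp
    finally show "g ((\<lambda>x\<in>carrier F. r x \<odot>\<^bsub>M\<^esub> m) x) = f x" using x qr by simp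
  qed
qed

text \<open>The modules to which the solvability of extension problems passes from \<open>A\<close>. Retracts and direct sums of such
  modules are of the same kind, which brings in all projective modules.\<close>

definition inherits_extension :: "('a, 'r) ring_scheme \<Rightarrow> ('a, 'n, 'u) module_scheme \<Rightarrow> bool"
  where "inherits_extension A P \<longleftrightarrow> (\<forall>L\<in>fg_modules A. \<forall>M\<in>fg_modules A. \<forall>i\<in>mod_hom A L M.
    hom_extends A L i M (regular_module A) \<longrightarrow> hom_extends A L i M P)"

lemma inherits_extension_retract:
  assumes P: "inherits_extension A P" and lm: "left_module A P" "left_module A Q"
    and i: "i \<in> mod_hom A Q P" and r: "r \<in> mod_hom A P Q" and ri: "\<And>x. x \<in> carrier Q \<Longrightarrow> r (i x) = x"
  shows "inherits_extension A Q"
  unfolding inherits_extension_def hom_extends_def[of A _ _ _ Q]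
proof (intro ballI impI)
  fix L M j f assume L: "L \<in> fg_modules A" and M: "M \<in> fg_modules A" and j: "j \<in> mod_hom A L M"
    and ext: "hom_extends A L j M (regular_module A)" and f: "f \<in> mod_hom A L Q"
  obtain f' where f': "f' \<in> mod_hom A L P" "\<forall>x\<in>carrier L. f' x = i (f x)"
    using hom_comp[OF f i fg_modulesD(1)[OF L]] by blast
  have "hom_extends A L j M P" using P L M j ext unfolding inherits_extension_def by blast
  from hom_extendsD[OF this f'(1)] obtain g where
    g: "g \<in> mod_hom A M P" "\<forall>x\<in>carrier L. g (j x) = f' x" by blast
  obtain g' where g': "g' \<in> mod_hom A M Q" "\<forall>x\<in>carrier M. g' x = r (g x)"
    using hom_comp[OF g(1) r fg_modulesD(1)[OF M]] by blast
  show "\<exists>g\<in>mod_hom A M Q. \<forall>x\<in>carrier L. g (j x) = f x"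
    using g'(2) g(2) f'(2) mod_homD(1)[OF j] mod_homD(1)[OF f] ri by (intro bexI[OF _ g'(1)]) simp
qed

lemma inherits_extension_direct_sum:
  assumes S: "direct_sum A P Q S a b p q" and P: "inherits_extension A P" and Q: "inherits_extension A Q"
    and lm: "left_module A P" "left_module A Q"
  shows "inherits_extension A S"
  unfolding inherits_extension_def hom_extends_def[of A _ _ _ S]
proof (intro ballI impI)
  note D = direct_sumD[OF S]
  fix L M j f assume L: "L \<in> fg_modules A" and M: "M \<in> fg_modules A" and j: "j \<in> mod_hom A L M"
    and ext: "hom_extends A L j M (regular_module A)" and f: "f \<in> mod_hom A L S"
  obtain f1 where f1: "f1 \<in> mod_hom A L P" "\<forall>x\<in>carrier L. f1 x = p (f x)"
    using hom_comp[OF f D(4) fg_modulesD(1)[OF L]] by blast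
  obtain f2 where f2: "f2 \<in> mod_hom A L Q" "\<forall>x\<in>carrier L. f2 x = q (f x)"
    using hom_comp[OF f D(5) fg_modulesD(1)[OF L]] by blast
  have "hom_extends A L j M P" "hom_extends A L j M Q"
    using P Q L M j ext unfolding inherits_extension_def by blast+
  from hom_extendsD[OF this(1) f1(1)] hom_extendsD[OF this(2) f2(1)] obtain g1 g2 where
    g: "g1 \<in> mod_hom A M P" "\<forall>x\<in>carrier L. g1 (j x) = f1 x"
    "g2 \<in> mod_hom A M Q" "\<forall>x\<in>carrier L. g2 (j x) = f2 x" by blast
  obtain h where h: "h \<in> mod_hom A M S" "\<forall>t\<in>carrier M. h t = a (g1 t) \<oplus>\<^bsub>S\<^esub> b (g2 t)"
    using direct_sum_in[OF S lm fg_modulesD(1)[OF M] g(1,3)] by blast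
  show "\<exists>g\<in>mod_hom A M S. \<forall>x\<in>carrier L. g (j x) = f x"
    using h(2) g(2,4) f1(2) f2(2) mod_homD(1)[OF j] mod_homD(1)[OF f] D(10)
    by (intro bexI[OF _ h(1)]) simp
qed

lemma inherits_extension_zero:
  assumes Z: "Z \<in> fg_modules A" and zero: "carrier Z = {\<zero>\<^bsub>Z\<^esub>}"
  shows "inherits_extension A Z"
  unfolding inherits_extension_def hom_extends_def[of A _ _ _ Z]
proof (intro ballI impI)
  fix L M j f assume L: "L \<in> fg_modules A" and M: "M \<in> fg_modules A" and j: "j \<in> mod_hom A L M"
    and f: "f \<in> mod_hom A L Z"
  show "\<exists>g\<in>mod_hom A M Z. \<forall>x\<in>carrier L. g (j x) = f x"
    using mod_homD(1)[OF j] mod_homD(1)[OF f] zero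
    by (intro bexI[OF _ zero_hom[OF fg_modulesD(1)[OF M] fg_modulesD(1)[OF Z]]]) auto
qed

lemma inherits_extension_regular_copy:
  assumes A: "ring A" and F: "F \<in> fg_modules A" and q: "q \<in> mod_hom A (regular_module A) F"
    and r: "r \<in> mod_hom A F (regular_module A)" and qr: "\<forall>x\<in>carrier F. q (r x) = x"
  shows "inherits_extension A F"
proof -
  have "inherits_extension A (regular_module A)" by (simp add: inherits_extension_def)
  then show ?thesis
    by (rule inherits_extension_retract[OF _ regular_module_left_module[OF A] fg_modulesD(1)[OF F] r q])
      (simp add: qr)
qed

text \<open>Adding one copy of \<open>A\<close> for each generator; in this way free modules of finite rank need not be
  constructed explicitly.\<close>

lemma projective_surjection_exists:
  assumes A: "ring A" and M: "M \<in> fg_modules A"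
  shows "\<exists>P p. projective_module A P \<and> inherits_extension A P \<and> p \<in> mod_hom A P M \<and> p ` carrier P = carrier M"
proof -
  note M' = fg_modulesD[OF M]
  interpret M: left_module A M by (rule M')
  obtain F q r where F: "F \<in> fg_modules A" and q: "q \<in> mod_hom A (regular_module A) F"
    and r: "r \<in> mod_hom A F (regular_module A)" and rq: "\<forall>a\<in>carrier A. r (q a) = a"
    and qr: "\<forall>x\<in>carrier F. q (r x) = x"
    using regular_module_copy[OF A] by blast
  have rc: "r x \<in> carrier A" if "x \<in> carrier F" for x using mod_homD(1)[OF r that] by simp
  have q1: "q \<one>\<^bsub>A\<^esub> \<in> carrier F" using mod_homD(1)[OF q, of "\<one>\<^bsub>A\<^esub>"] by simp
  note Fproj = regular_copy_projective[OF A F q r qr] and Fext = inherits_extension_regular_copy[OF A F q r qr]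
  have *: "\<exists>P p. projective_module A P \<and> inherits_extension A P \<and> p \<in> mod_hom A P M
      \<and> spn A M S \<subseteq> p ` carrier P" if "finite S" "S \<subseteq> carrier M" for S
    using that
  proof induction
    case empty
    obtain Z where Z: "Z \<in> fg_modules A" "carrier Z = {\<zero>\<^bsub>Z\<^esub>}" using zero_module_exists[OF M] by blast
    have "spn A M {} \<subseteq> {\<zero>\<^bsub>M\<^esub>}" by (rule spn_least[OF M.submod_zero]) simp
    then have "spn A M {} \<subseteq> (\<lambda>x\<in>carrier Z. \<zero>\<^bsub>M\<^esub>) ` carrier Z" using Z(2) by auto
    then show ?case
      using projective_zero[OF Z] inherits_extension_zero[OF Z] zero_hom[OF fg_modulesD(1)[OF Z(1)] M'(1)]
      by blast
  next
    case (insert x S)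
    then obtain P p where P: "projective_module A P" "inherits_extension A P" and p: "p \<in> mod_hom A P M"
      "spn A M S \<subseteq> p ` carrier P" by blast
    note Pf = projective_module_fg[OF P(1)]
    note lm = fg_modulesD(1)[OF Pf] fg_modulesD(1)[OF F]
    obtain X i j p1 p2 where X: "direct_sum A P F X i j p1 p2" using direct_sum_exists[OF Pf F] by blast
    note D = direct_sumD[OF X]
    note Xlm = fg_modulesD(1)[OF D(1)]
    interpret X: left_module A X by (rule Xlm)
    have x: "x \<in> carrier M" using insert.prems by simp
    have "(\<lambda>y\<in>carrier F. r y \<odot>\<^bsub>M\<^esub> x) \<in> mod_hom A F M"
      using x left_module.axioms(1)[OF lm(2)]
      by (intro mod_homI) (simp_all add: rc mod_homD(2,3)[OF r] M.smult_l_distr M.smult_assoc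
          abelian_groupE(1)[OF left_module.axioms(2)[OF lm(2)]] left_module.smult_closed[OF lm(2)])
    from direct_sum_out[OF X lm M'(1) p(1) this] obtain h where h: "h \<in> mod_hom A X M"
      "\<forall>y\<in>carrier P. h (i y) = p y" "\<forall>y\<in>carrier F. h (j y) = (\<lambda>y\<in>carrier F. r y \<odot>\<^bsub>M\<^esub> x) y" by blast
    interpret h: module_hom A X M h by (rule module_homI[OF Xlm M'(1) h(1)])
    have "spn A M (insert x S) \<subseteq> h ` carrier X"
    proof (rule spn_least[OF h.submod_image[OF X.submod_carrier]])
      have "h (j (q \<one>\<^bsub>A\<^esub>)) = x" using h(3) q1 rq x by simp
      then have "x \<in> h ` carrier X" using mod_homD(1)[OF D(3) q1] by blast
      moreover have "S \<subseteq> h ` carrier X"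
      proof
        fix s assume "s \<in> S"
        then have "s \<in> spn A M S" by (rule spn_base)
        then obtain y where "y \<in> carrier P" "s = p y" using p(2) by blast
        then have y: "y \<in> carrier P" "s = h (i y)" using h(2) by simp_all
        then show "s \<in> h ` carrier X" using mod_homD(1)[OF D(2) y(1)] by blast
      qed
      ultimately show "insert x S \<subseteq> h ` carrier X" by blast
    qed
    then show ?case
      using projective_direct_sum[OF X P(1) Fproj] inherits_extension_direct_sum[OF X P(2) Fext lm] h(1) by blast
  qed
  obtain S where S: "S \<subseteq> carrier M" "finite S" "spn A M S = carrier M"
    using M'(2) fin_gen_iff[OF M'(1)] by auto
  then obtain P p where P: "projective_module A P" "inherits_extension A P" "p \<in> mod_hom A P M"
    "carrier M \<subseteq> p ` carrier P" using *[OF S(2,1)] by auto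
  then have "p ` carrier P = carrier M" using mod_homD(1)[OF P(3)] by blast
  then show ?thesis using P by blast
qed

text \<open>A projective module is a retract of one that is built from copies of \<open>A\<close>.\<close>

lemma projective_inherits_extension:
  assumes A: "ring A" and P: "projective_module A P"
  shows "inherits_extension A P"
proof -
  note Pf = projective_module_fg[OF P]
  obtain Q p where Q: "projective_module A Q" "inherits_extension A Q" and p: "p \<in> mod_hom A Q P"
    "p ` carrier Q = carrier P" using projective_surjection_exists[OF A Pf] by blast
  note Qf = projective_module_fg[OF Q(1)]
  obtain s where "s \<in> mod_hom A P Q" "\<forall>x\<in>carrier P. p (s x) = (\<lambda>x\<in>carrier P. x) x"
    using projective_lift[OF P Qf Pf p id_hom[OF fg_modulesD(1)[OF Pf]]] by blast
  then show ?thesis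
    using inherits_extension_retract[OF Q(2) fg_modulesD(1)[OF Qf] fg_modulesD(1)[OF Pf] _ p(1)] by auto
qed

section \<open>Semi-Gorenstein-projective modules without a choice of resolution\<close>

lemma short_exactD:
  assumes "short_exact A L i M p N"
  shows "i \<in> mod_hom A L M" "p \<in> mod_hom A M N" "inj_on i (carrier L)"
    "i ` carrier L = a_kernel M N p" "p ` carrier M = carrier N"
    "x \<in> carrier L \<Longrightarrow> p (i x) = \<zero>\<^bsub>N\<^esub>"
    "\<lbrakk>y \<in> carrier M; p y = \<zero>\<^bsub>N\<^esub>\<rbrakk> \<Longrightarrow> \<exists>x\<in>carrier L. y = i x"
    "z \<in> carrier N \<Longrightarrow> \<exists>y\<in>carrier M. z = p y"
proof -
  show *: "i \<in> mod_hom A L M" "p \<in> mod_hom A M N" "inj_on i (carrier L)"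
    "i ` carrier L = a_kernel M N p" "p ` carrier M = carrier N"
    using assms unfolding short_exact_def by simp_all
  show "x \<in> carrier L \<Longrightarrow> p (i x) = \<zero>\<^bsub>N\<^esub>" using *(4) unfolding a_kernel_def' by blast
  show "\<lbrakk>y \<in> carrier M; p y = \<zero>\<^bsub>N\<^esub>\<rbrakk> \<Longrightarrow> \<exists>x\<in>carrier L. y = i x"
    using *(4) unfolding a_kernel_def' by blast
  show "z \<in> carrier N \<Longrightarrow> \<exists>y\<in>carrier M. z = p y" using *(5) by blast
qed

lemma short_exactI:
  assumes "i \<in> mod_hom A L M" "p \<in> mod_hom A M N" "left_module A L" "left_module A M"
    and "\<And>x. \<lbrakk>x \<in> carrier L; i x = \<zero>\<^bsub>M\<^esub>\<rbrakk> \<Longrightarrow> x = \<zero>\<^bsub>L\<^esub>"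
    and "\<And>x. x \<in> carrier L \<Longrightarrow> p (i x) = \<zero>\<^bsub>N\<^esub>"
    and "\<And>y. \<lbrakk>y \<in> carrier M; p y = \<zero>\<^bsub>N\<^esub>\<rbrakk> \<Longrightarrow> \<exists>x\<in>carrier L. y = i x"
    and "\<And>z. z \<in> carrier N \<Longrightarrow> \<exists>y\<in>carrier M. z = p y"
  shows "short_exact A L i M p N"
proof -
  interpret i: module_hom A L M i by (rule module_homI[OF assms(3,4,1)])
  have "inj_on i (carrier L)" using i.inj_iff assms(5) by blast
  moreover have "i ` carrier L = a_kernel M N p"
    unfolding a_kernel_def' using mod_homD(1)[OF assms(1)] assms(6,7) by blast
  moreover have "p ` carrier M = carrier N" using mod_homD(1)[OF assms(2)] assms(8) by blast
  ultimately show ?thesis unfolding short_exact_def using assms(1,2) by simp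
qed

lemma kernel_short_exact:
  assumes "left_module A M" "left_module A N" "p \<in> mod_hom A M N" "p ` carrier M = carrier N"
  shows "short_exact A (M\<lparr>carrier := a_kernel M N p\<rparr>) (\<lambda>x\<in>a_kernel M N p. x) M p N"
proof -
  interpret module_hom A M N p by (rule module_homI[OF assms(1-3)])
  show ?thesis
    unfolding short_exact_def
    using sub_incl_hom[OF assms(1) submod_kernel] assms(3,4) by (auto simp: inj_on_def image_iff)
qed

text \<open>For modules that are cut out as the preimage \<open>N\<close> of a kernel along a surjection \<open>f\<close>: the restriction of \<open>f\<close>
  presents that kernel, with the same kernel as \<open>f\<close> itself.\<close>

lemma kernel_of_composite_short_exact:
  assumes lm: "left_module A L" "left_module A X" "left_module A Y" "left_module A P" "left_module A Z"
    and s: "short_exact A L k X f Y" and t: "short_exact A P l Y g Z"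
  defines "N \<equiv> {x \<in> carrier X. g (f x) = \<zero>\<^bsub>Z\<^esub>}"
  shows "submod A X N" "\<exists>f'. short_exact A L k (X\<lparr>carrier := N\<rparr>) f' P"
proof -
  note s' = short_exactD[OF s] and t' = short_exactD[OF t]
  interpret f: module_hom A X Y f by (rule module_homI[OF lm(2,3) s'(2)])
  interpret g: module_hom A Y Z g by (rule module_homI[OF lm(3,5) t'(2)])
  have Niff: "x \<in> N \<longleftrightarrow> x \<in> carrier X \<and> g (f x) = \<zero>\<^bsub>Z\<^esub>" for x by (simp add: N_def)
  have "N = {x \<in> carrier X. f x \<in> a_kernel Y Z g}" by (auto simp: N_def a_kernel_def')
  then show N: "submod A X N" using f.submod_preimage[OF g.submod_kernel] by simp
  let ?K = "X\<lparr>carrier := N\<rparr>"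
  note Klm = left_module.submod_left_module[OF lm(2) N]
  have kN: "k \<in> mod_hom A L ?K"
    by (rule corestrict_hom[OF s'(1)]) (use mod_homD(1)[OF s'(1)] s'(6) in \<open>auto simp: Niff\<close>)
  have fN: "restrict f N \<in> mod_hom A ?K Y" by (rule restrict_hom[OF N s'(2)])
  have "restrict f N ` carrier ?K \<subseteq> l ` carrier P"
    unfolding t'(4) a_kernel_def' by (auto simp: Niff)
  then obtain f' where f': "f' \<in> mod_hom A ?K P" "\<forall>x\<in>carrier ?K. l (f' x) = restrict f N x"
    using hom_factors_through_inj[OF lm(4,3) Klm t'(1,3) fN] by blast
  have lf': "l (f' x) = f x" if "x \<in> N" for x using f'(2) that by simp
  have f'c: "f' x \<in> carrier P" if "x \<in> N" for x using mod_homD(1)[OF f'(1)] that by simp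
  have l_inj: "x = y" if "x \<in> carrier P" "y \<in> carrier P" "l x = l y" for x y
    using t'(3) that by (auto dest: inj_onD)
  have f'_zero: "f' x = \<zero>\<^bsub>P\<^esub> \<longleftrightarrow> f x = \<zero>\<^bsub>Y\<^esub>" if "x \<in> N" for x
    using lf'[OF that] l_inj[OF f'c[OF that] left_module_zero_closed[OF lm(4)]] homD(4)[OF t'(1) lm(4,3)] by auto
  have kmem: "k x \<in> N" if "x \<in> carrier L" for x using mod_homD(1)[OF kN that] by simp
  have "short_exact A L k ?K f' P"
  proof (rule short_exactI[OF kN f'(1) lm(1) Klm])
    fix x assume x: "x \<in> carrier L" "k x = \<zero>\<^bsub>?K\<^esub>"
    then have "k x = k \<zero>\<^bsub>L\<^esub>" using homD(4)[OF s'(1) lm(1,2)] by simp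
    then show "x = \<zero>\<^bsub>L\<^esub>" using inj_onD[OF s'(3) _ x(1)] left_module_zero_closed[OF lm(1)] by blast
  next
    fix x assume "x \<in> carrier L"
    then show "f' (k x) = \<zero>\<^bsub>P\<^esub>" using f'_zero[OF kmem] s'(6) by simp
  next
    fix x assume "x \<in> carrier ?K" "f' x = \<zero>\<^bsub>P\<^esub>"
    then have "x \<in> carrier X" "f x = \<zero>\<^bsub>Y\<^esub>" using f'_zero[of x] by (simp_all add: Niff)
    then show "\<exists>z\<in>carrier L. x = k z" by (rule s'(7))
  next
    fix y assume y: "y \<in> carrier P"
    obtain x where x: "x \<in> carrier X" "l y = f x" using s'(8)[OF mod_homD(1)[OF t'(1) y]] by blast
    then have xN: "x \<in> N" using t'(6)[OF y] by (simp add: Niff)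
    then have "l y = l (f' x)" using lf' x by simp
    then have "y = f' x" by (rule l_inj[OF y f'c[OF xN]])
    then show "\<exists>x\<in>carrier ?K. y = f' x" using xN by auto
  qed
  then show "\<exists>f'. short_exact A L k ?K f' P" by blast
qed

lemma quotient_short_exact:
  assumes L: "L \<in> fg_modules A" and M: "M \<in> fg_modules A" and i: "i \<in> mod_hom A L M" "inj_on i (carrier L)"
  shows "\<exists>N\<in>fg_modules A. \<exists>p. short_exact A L i M p N"
proof -
  interpret i: module_hom A L M i by (rule module_homI[OF fg_modulesD(1)[OF L] fg_modulesD(1)[OF M] i(1)])
  obtain Q q where Q: "Q \<in> fg_modules A" and q: "q \<in> mod_hom A M Q" "q ` carrier M = carrier Q"
    "a_kernel M Q q = i ` carrier L"
    using fgmod_quotient[OF fg_modulesD[OF M] i.submod_image[OF i.M.submod_carrier]] by blast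
  have "short_exact A L i M q Q" unfolding short_exact_def using i q by simp
  then show ?thesis using Q by blast
qed

lemma short_exact_id_zero:
  assumes "M \<in> fg_modules A" "Z \<in> fg_modules A" "carrier Z = {\<zero>\<^bsub>Z\<^esub>}"
  shows "short_exact A M (\<lambda>x\<in>carrier M. x) M (\<lambda>x\<in>carrier M. \<zero>\<^bsub>Z\<^esub>) Z"
    "short_exact A Z (\<lambda>x\<in>carrier Z. \<zero>\<^bsub>M\<^esub>) M (\<lambda>x\<in>carrier M. x) M"
proof -
  note lm = fg_modulesD(1)[OF assms(1)] fg_modulesD(1)[OF assms(2)]
  interpret M: left_module A M by (rule lm)
  show "short_exact A M (\<lambda>x\<in>carrier M. x) M (\<lambda>x\<in>carrier M. \<zero>\<^bsub>Z\<^esub>) Z"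
    by (rule short_exactI[OF id_hom[OF lm(1)] zero_hom[OF lm] lm(1) lm(1)])
      (use assms(3) M.M.zero_closed in auto)
  show "short_exact A Z (\<lambda>x\<in>carrier Z. \<zero>\<^bsub>M\<^esub>) M (\<lambda>x\<in>carrier M. x) M"
    by (rule short_exactI[OF zero_hom[OF lm(2,1)] id_hom[OF lm(1)] lm(2,1)]) (use assms(3) in auto)
qed

text \<open>Coinduction replaces the infinite resolution: by dimension shift, all extension groups of \<open>M\<close> by \<open>A\<close> vanish
  if the first one does and if the same holds for some syzygy. To put a module into the greatest such class,
  one step of a construction suffices, provided that it reproduces its own hypotheses for the syzygy.\<close>

coinductive perp :: "('a, 'r) ring_scheme \<Rightarrow> 'a fgmod \<Rightarrow> bool"
  for A :: "('a, 'r) ring_scheme"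
  where perpI: "\<lbrakk>M \<in> fg_modules A; projective_module A P; short_exact A K i P p M;
      hom_extends A K i P (regular_module A); perp A K\<rbrakk> \<Longrightarrow> perp A M"

lemma perp_fg: "perp A M \<Longrightarrow> M \<in> fg_modules A"
  by (erule perp.cases) simp

lemma perp_hom_extends:
  assumes A: "ring A" and N: "perp A N" and fg: "L \<in> fg_modules A" "M \<in> fg_modules A"
    and s: "short_exact A L j M q N"
  shows "hom_extends A L j M (regular_module A)"
  using N
proof cases
  case (perpI P K i p)
  show ?thesis
    by (rule hom_extends_from_presentation[OF perp_fg[OF perpI(5)] projective_module_fg[OF perpI(2)] perpI(1) fg
          regular_module_left_module[OF A] perpI(2,3) s perpI(4)])
qed

text \<open>Pullback squares in terms of elements: \<open>X\<close> consists of the pairs on which \<open>g\<close> and \<open>p'\<close> agree.\<close>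

definition elementwise_pullback ::
    "('a, 'r) ring_scheme \<Rightarrow> 'a fgmod \<Rightarrow> 'a fgmap \<Rightarrow> 'a fgmap \<Rightarrow> 'a fgmod \<Rightarrow> 'a fgmap \<Rightarrow> 'a fgmod \<Rightarrow> 'a fgmap \<Rightarrow> 'a fgmod \<Rightarrow> bool"
  where "elementwise_pullback A X p g' Y g X' p' Y' \<longleftrightarrow>
    p \<in> mod_hom A X Y \<and> g' \<in> mod_hom A X X' \<and> (\<forall>x\<in>carrier X. g (p x) = p' (g' x)) \<and>
    (\<forall>y\<in>carrier Y. \<forall>x'\<in>carrier X'. g y = p' x' \<longrightarrow> (\<exists>x\<in>carrier X. p x = y \<and> g' x = x')) \<and>
    (\<forall>x\<in>carrier X. p x = \<zero>\<^bsub>Y\<^esub> \<and> g' x = \<zero>\<^bsub>X'\<^esub> \<longrightarrow> x = \<zero>\<^bsub>X\<^esub>)"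

lemma elementwise_pullback_sym:
  "elementwise_pullback A X p g' Y g X' p' Y' \<Longrightarrow> elementwise_pullback A X g' p X' p' Y g Y'"
  unfolding elementwise_pullback_def by metis

lemma elementwise_pullback_universal:
  assumes pb: "elementwise_pullback A X p g' Y g X' p' Y'"
    and lm: "left_module A X" "left_module A Y" "left_module A X'" "left_module A T"
    and u: "u \<in> mod_hom A T Y" and v: "v \<in> mod_hom A T X'" and uv: "\<And>t. t \<in> carrier T \<Longrightarrow> g (u t) = p' (v t)"
  shows "\<exists>w\<in>mod_hom A T X. \<forall>t\<in>carrier T. p (w t) = u t \<and> g' (w t) = v t"
proof -
  have p: "p \<in> mod_hom A X Y" and g': "g' \<in> mod_hom A X X'"
    and ex: "\<And>y x'. \<lbrakk>y \<in> carrier Y; x' \<in> carrier X'; g y = p' x'\<rbrakk> \<Longrightarrow> \<exists>x\<in>carrier X. p x = y \<and> g' x = x'"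
    and zero: "\<And>x. \<lbrakk>x \<in> carrier X; p x = \<zero>\<^bsub>Y\<^esub>; g' x = \<zero>\<^bsub>X'\<^esub>\<rbrakk> \<Longrightarrow> x = \<zero>\<^bsub>X\<^esub>"
    using pb unfolding elementwise_pullback_def by blast+
  interpret X: left_module A X by (rule lm)
  interpret Y: left_module A Y by (rule lm)
  interpret X': left_module A X' by (rule lm)
  interpret T: left_module A T by (rule lm)
  note p = homD[OF p lm(1,2)] and g' = homD[OF g' lm(1,3)] and u = homD[OF u lm(4,2)] and v = homD[OF v lm(4,3)]
  have uniq: "x = y" if "x \<in> carrier X" "y \<in> carrier X" "p x = p y" "g' x = g' y" for x y
  proof -
    have "x \<ominus>\<^bsub>X\<^esub> y = \<zero>\<^bsub>X\<^esub>" using that by (intro zero) (simp_all add: p g')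
    then show ?thesis using that by simp
  qed
  define w where "w t = (SOME x. x \<in> carrier X \<and> p x = u t \<and> g' x = v t)" for t
  have w: "w t \<in> carrier X \<and> p (w t) = u t \<and> g' (w t) = v t" if t: "t \<in> carrier T" for t
  proof -
    have "\<exists>x. x \<in> carrier X \<and> p x = u t \<and> g' x = v t" using ex[OF u(1)[OF t] v(1)[OF t] uv[OF t]] by blast
    then show ?thesis unfolding w_def by (rule someI_ex)
  qed
  have hom: "(\<lambda>t\<in>carrier T. w t) \<in> mod_hom A T X"
  proof (rule mod_homI)
    fix s t assume "s \<in> carrier T" "t \<in> carrier T"
    then show "s \<oplus>\<^bsub>T\<^esub> t \<in> carrier T \<and> w (s \<oplus>\<^bsub>T\<^esub> t) = w s \<oplus>\<^bsub>X\<^esub> w t"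
      by - (rule conjI[OF _ uniq]; simp add: w p g' u v)
  next
    fix a t assume "a \<in> carrier A" "t \<in> carrier T"
    then show "a \<odot>\<^bsub>T\<^esub> t \<in> carrier T \<and> w (a \<odot>\<^bsub>T\<^esub> t) = a \<odot>\<^bsub>X\<^esub> w t"
      by - (rule conjI[OF _ uniq]; simp add: w p g' u v)
  qed (simp add: w)
  show ?thesis by (rule bexI[OF _ hom]) (simp add: w)
qed

text \<open>Pulling back a surjection does not change its kernel.\<close>

lemma elementwise_pullback_short_exact:
  assumes pb: "elementwise_pullback A X p g' Y g X' p' Y'" and s: "short_exact A K k X' p' Y'"
    and lm: "left_module A X" "left_module A Y" "left_module A X'" "left_module A Y'" "left_module A K"
    and g: "g \<in> mod_hom A Y Y'"
  shows "\<exists>k'. short_exact A K k' X p Y"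
proof -
  note s = short_exactD[OF s]
  have p: "p \<in> mod_hom A X Y" and g': "g' \<in> mod_hom A X X'"
    and comm: "\<And>x. x \<in> carrier X \<Longrightarrow> g (p x) = p' (g' x)"
    and ex: "\<And>y x'. \<lbrakk>y \<in> carrier Y; x' \<in> carrier X'; g y = p' x'\<rbrakk> \<Longrightarrow> \<exists>x\<in>carrier X. p x = y \<and> g' x = x'"
    and zero: "\<And>x. \<lbrakk>x \<in> carrier X; p x = \<zero>\<^bsub>Y\<^esub>; g' x = \<zero>\<^bsub>X'\<^esub>\<rbrakk> \<Longrightarrow> x = \<zero>\<^bsub>X\<^esub>"
    using pb unfolding elementwise_pullback_def by blast+
  interpret X: left_module A X by (rule lm)
  interpret Y: left_module A Y by (rule lm)
  note pD = homD[OF p lm(1,2)] and gD = homD[OF g' lm(1,3)] and kD = homD[OF s(1) lm(5,3)]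
    and ggD = homD[OF g lm(2,4)]
  have "\<exists>w\<in>mod_hom A K X. \<forall>t\<in>carrier K. p (w t) = (\<lambda>x\<in>carrier K. \<zero>\<^bsub>Y\<^esub>) t \<and> g' (w t) = k t"
    by (rule elementwise_pullback_universal[OF pb lm(1,2,3,5) zero_hom[OF lm(5,2)] s(1)]) (simp add: s(6) ggD)
  then obtain k' where k': "k' \<in> mod_hom A K X" "\<And>t. t \<in> carrier K \<Longrightarrow> p (k' t) = \<zero>\<^bsub>Y\<^esub>"
    "\<And>t. t \<in> carrier K \<Longrightarrow> g' (k' t) = k t" by auto
  have "short_exact A K k' X p Y"
  proof (rule short_exactI[OF k'(1) p lm(5,1)])
    fix t assume t: "t \<in> carrier K" "k' t = \<zero>\<^bsub>X\<^esub>"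
    then have "k t = k \<zero>\<^bsub>K\<^esub>" using k'(3)[OF t(1)] by (simp add: gD kD)
    then show "t = \<zero>\<^bsub>K\<^esub>" using t s(3) left_module.submod_zero[OF lm(5)]
      by (auto dest: inj_onD simp: submod_def)
  next
    fix x assume x: "x \<in> carrier X" "p x = \<zero>\<^bsub>Y\<^esub>"
    then have "p' (g' x) = \<zero>\<^bsub>Y'\<^esub>" using comm[OF x(1)] by (simp add: ggD)
    then obtain t where t: "t \<in> carrier K" "g' x = k t" using s(7)[OF gD(1)[OF x(1)]] by blast
    note kt = mod_homD(1)[OF k'(1) t(1)]
    have "g' (x \<ominus>\<^bsub>X\<^esub> k' t) = \<zero>\<^bsub>X'\<^esub>"
      using x kt t k'(3)[OF t(1)] gD(1)[OF x(1)] left_module.diff_self[OF lm(3)] by (simp add: gD(6))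
    then have "x \<ominus>\<^bsub>X\<^esub> k' t = \<zero>\<^bsub>X\<^esub>" using x kt k'(2)[OF t(1)] by (intro zero) (simp_all add: pD)
    then show "\<exists>t\<in>carrier K. x = k' t" using x kt t by auto
  next
    fix y assume y: "y \<in> carrier Y"
    then obtain x' where "x' \<in> carrier X'" "g y = p' x'" using s(8)[OF ggD(1)[OF y]] by blast
    then show "\<exists>x\<in>carrier X. y = p x" using ex[OF y] by blast
  qed (fact k'(2))
  then show ?thesis by blast
qed

text \<open>Over such a ring, kernels of homomorphisms between finitely generated modules are finitely generated.\<close>

locale left_noetherian_ring = ring A for A :: "('a, 'r) ring_scheme" (structure) +
  assumes noetherian: "noetherian_module A (regular_module A)"
begin

lemma submodule_fg: "\<lbrakk>M \<in> fg_modules A; submod A M N\<rbrakk> \<Longrightarrow> M\<lparr>carrier := N\<rparr> \<in> fg_modules A"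
  using noetherian_submodule_fin_gen[OF _ noetherian_module_if_fin_gen[OF _ noetherian]]
    left_module.submod_left_module unfolding fg_modules_def by blast

lemma kernel_fg:
  assumes "M \<in> fg_modules A" "N \<in> fg_modules A" "p \<in> mod_hom A M N"
  shows "M\<lparr>carrier := a_kernel M N p\<rparr> \<in> fg_modules A"
  by (intro submodule_fg assms module_hom.submod_kernel module_homI fg_modulesD(1))

lemma pullback_exists:
  assumes fg: "Y \<in> fg_modules A" "X' \<in> fg_modules A" "Y' \<in> fg_modules A"
    and g: "g \<in> mod_hom A Y Y'" and p': "p' \<in> mod_hom A X' Y'"
  shows "\<exists>X\<in>fg_modules A. \<exists>p g'. elementwise_pullback A X p g' Y g X' p' Y'"
proof -
  note lm = fg[THEN fg_modulesD(1)]
  obtain S i j q r where S: "direct_sum A Y X' S i j q r" using direct_sum_exists[OF fg(1,2)] by blast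
  note D = direct_sumD[OF S]
  note Slm = fg_modulesD(1)[OF D(1)]
  interpret S: left_module A S by (rule Slm)
  interpret Y': left_module A Y' by (rule lm)
  note gD = homD[OF g lm(1,3)] and p'D = homD[OF p' lm(2,3)] and iD = homD[OF D(2) lm(1) Slm]
    and jD = homD[OF D(3) lm(2) Slm] and qD = homD[OF D(4) Slm lm(1)] and rD = homD[OF D(5) Slm lm(2)]
  define N where "N = {s \<in> carrier S. g (q s) = p' (r s)}"
  have N: "submod A S N"
    unfolding submod_def N_def by (auto simp: gD p'D qD rD)
  have NS: "N \<subseteq> carrier S" by (auto simp: N_def)
  have "elementwise_pullback A (S\<lparr>carrier := N\<rparr>) (restrict q N) (restrict r N) Y g X' p' Y'"
    unfolding elementwise_pullback_def
  proof (intro conjI ballI impI)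
    fix y x' assume yx: "y \<in> carrier Y" "x' \<in> carrier X'" "g y = p' x'"
    interpret Y: left_module A Y by (rule lm)
    interpret X': left_module A X' by (rule lm)
    have *: "q (i y \<oplus>\<^bsub>S\<^esub> j x') = y" "r (i y \<oplus>\<^bsub>S\<^esub> j x') = x'"
      using yx by (simp_all add: qD rD iD jD D)
    then have "i y \<oplus>\<^bsub>S\<^esub> j x' \<in> N" using yx iD(1) jD(1) by (simp add: N_def)
    then show "\<exists>x\<in>carrier (S\<lparr>carrier := N\<rparr>). restrict q N x = y \<and> restrict r N x = x'"
      using * by (intro bexI[of _ "i y \<oplus>\<^bsub>S\<^esub> j x'"]) simp_all
  next
    fix s assume "s \<in> carrier (S\<lparr>carrier := N\<rparr>)" "restrict q N s = \<zero>\<^bsub>Y\<^esub> \<and> restrict r N s = \<zero>\<^bsub>X'\<^esub>"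
    then have "s \<in> carrier S" "q s = \<zero>\<^bsub>Y\<^esub>" "r s = \<zero>\<^bsub>X'\<^esub>" using NS by auto
    then show "s = \<zero>\<^bsub>S\<lparr>carrier := N\<rparr>\<^esub>" using D(10)[of s] by (simp add: iD jD)
  next
    fix s assume "s \<in> carrier (S\<lparr>carrier := N\<rparr>)"
    then show "g (restrict q N s) = p' (restrict r N s)" by (simp add: N_def)
  qed (fact restrict_hom[OF N D(4)] restrict_hom[OF N D(5)])+
  then show ?thesis using submodule_fg[OF D(1) N] by blast
qed

lemma projective_perp:
  assumes "projective_module A P"
  shows "perp A P"
  using assms
proof (coinduction arbitrary: P)
  case (perp P)
  note P = projective_module_fg[OF perp]
  obtain Z where Z: "Z \<in> fg_modules A" "carrier Z = {\<zero>\<^bsub>Z\<^esub>}" using zero_module_exists[OF P] by blast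
  note lm = fg_modulesD(1)[OF P] fg_modulesD(1)[OF Z(1)] regular_module_left_module[OF ring_axioms]
  have "hom_extends A Z (\<lambda>x\<in>carrier Z. \<zero>\<^bsub>P\<^esub>) P (regular_module A)"
    unfolding hom_extends_def
  proof
    fix f assume f: "f \<in> mod_hom A Z (regular_module A)"
    show "\<exists>g\<in>mod_hom A P (regular_module A). \<forall>x\<in>carrier Z. g ((\<lambda>x\<in>carrier Z. \<zero>\<^bsub>P\<^esub>) x) = f x"
      using homD(4)[OF f lm(2,3)] Z(2) left_module.submod_zero[OF lm(1)]
      by (intro bexI[OF _ zero_hom[OF lm(1,3)]]) (auto simp: submod_def)
  qed
  then show ?case
    using P perp short_exact_id_zero(2)[OF P Z] projective_zero[OF Z] by blast
qed

text \<open>One step of the horseshoe construction; the syzygy \<open>K\<close> of \<open>M\<close> is again an extension of the same kind.\<close>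

lemma perp_extension:
  assumes "short_exact A L i M p N" "perp A L" "perp A N" "M \<in> fg_modules A"
  shows "perp A M"
  using assms
proof (coinduction arbitrary: L i M p N)
  case (perp L i M p N)
  note M = perp(4) and L = perp_fg[OF perp(2)] and N = perp_fg[OF perp(3)]
  note s = short_exactD[OF perp(1)]
  let ?A = "regular_module A"
  note reg = regular_module_left_module[OF ring_axioms]
  from perp(2) obtain PL KL a b where PL: "projective_module A PL" and sL: "short_exact A KL a PL b L"
    and eL: "hom_extends A KL a PL ?A" and KL: "perp A KL"
    by (rule perp.cases) blast
  from perp(3) obtain PN KN c d where PN: "projective_module A PN" and sN: "short_exact A KN c PN d N"
    and eN: "hom_extends A KN c PN ?A" and KN: "perp A KN"
    by (rule perp.cases) blast
  note PLf = projective_module_fg[OF PL] and PNf = projective_module_fg[OF PN]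
    and KLf = perp_fg[OF KL] and KNf = perp_fg[OF KN]
  note sL' = short_exactD[OF sL] and sN' = short_exactD[OF sN]
  note lm = L[THEN fg_modulesD(1)] M[THEN fg_modulesD(1)] N[THEN fg_modulesD(1)] PLf[THEN fg_modulesD(1)]
    PNf[THEN fg_modulesD(1)] KLf[THEN fg_modulesD(1)] KNf[THEN fg_modulesD(1)]
  obtain S i1 i2 r1 r2 where S: "direct_sum A PL PN S i1 i2 r1 r2" using direct_sum_exists[OF PLf PNf] by blast
  note D = direct_sumD[OF S]
  note Slm = fg_modulesD(1)[OF D(1)]
  interpret M: left_module A M by (rule lm)
  interpret L: left_module A L by (rule lm)
  interpret N: left_module A N by (rule lm)
  interpret S: left_module A S by (rule Slm)
  interpret PL: left_module A PL by (rule lm)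
  interpret PN: left_module A PN by (rule lm)
  obtain h where h: "h \<in> mod_hom A PN M" "\<forall>x\<in>carrier PN. p (h x) = d x"
    using projective_lift[OF PN M N s(2,5) sN'(2)] by blast
  obtain ib where ib: "ib \<in> mod_hom A PL M" "\<forall>x\<in>carrier PL. ib x = i (b x)"
    using hom_comp[OF sL'(2) s(1) lm(4)] by blast
  obtain e where e: "e \<in> mod_hom A S M" "\<forall>s\<in>carrier S. e s = ib (r1 s) \<oplus>\<^bsub>M\<^esub> h (r2 s)"
    "\<forall>x\<in>carrier PL. e (i1 x) = ib x" "\<forall>y\<in>carrier PN. e (i2 y) = h y"
    using direct_sum_out[OF S lm(4,5,2) ib(1) h(1)] by blast
  note iD = homD[OF s(1) lm(1,2)] and pD = homD[OF s(2) lm(2,3)] and aD = homD[OF sL'(1) lm(6,4)]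
    and bD = homD[OF sL'(2) lm(4,1)] and cD = homD[OF sN'(1) lm(7,5)] and dD = homD[OF sN'(2) lm(5,3)]
    and hD = homD[OF h(1) lm(5,2)] and eD = homD[OF e(1) Slm lm(2)]
    and i1D = homD[OF D(2) lm(4) Slm] and i2D = homD[OF D(3) lm(5) Slm]
    and r1D = homD[OF D(4) Slm lm(4)] and r2D = homD[OF D(5) Slm lm(5)]
  have pe_val: "p (e s) = d (r2 s)" if "s \<in> carrier S" for s
    using that e(2) ib(2) h(2) by (simp add: pD iD bD hD r1D r2D s(6) dD)
  have e_surj: "\<exists>s\<in>carrier S. m = e s" if m: "m \<in> carrier M" for m
  proof -
    obtain y where y: "y \<in> carrier PN" "p m = d y" using sN'(8)[OF pD(1)[OF m]] by blast
    then have "p (m \<ominus>\<^bsub>M\<^esub> h y) = \<zero>\<^bsub>N\<^esub>" using m h(2) by (simp add: pD hD dD)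
    then obtain l where l: "l \<in> carrier L" "m \<ominus>\<^bsub>M\<^esub> h y = i l"
      using s(7)[of "m \<ominus>\<^bsub>M\<^esub> h y"] m hD(1)[OF y(1)] by auto
    obtain x where x: "x \<in> carrier PL" "l = b x" using sL'(8)[OF l(1)] by blast
    have "m = (m \<ominus>\<^bsub>M\<^esub> h y) \<oplus>\<^bsub>M\<^esub> h y" using m hD(1)[OF y(1)] by (simp add: M.diff_add_cancel)
    also have "\<dots> = e (i1 x) \<oplus>\<^bsub>M\<^esub> e (i2 y)" using l x y ib(2) e(3,4) by simp
    also have "\<dots> = e (i1 x \<oplus>\<^bsub>S\<^esub> i2 y)" using x y by (simp add: eD i1D i2D)
    finally show ?thesis using x y i1D(1) i2D(1) by blast
  qed
  have e_im: "e ` carrier S = carrier M" using e_surj eD(1) by blast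
  define K where "K = S\<lparr>carrier := a_kernel S M e\<rparr>"
  have K: "K \<in> fg_modules A" unfolding K_def by (rule kernel_fg[OF D(1) M e(1)])
  note Klm = fg_modulesD(1)[OF K]
  have Kc: "carrier K = {s \<in> carrier S. e s = \<zero>\<^bsub>M\<^esub>}" "\<zero>\<^bsub>K\<^esub> = \<zero>\<^bsub>S\<^esub>" unfolding K_def a_kernel_def' by simp_all
  have sK: "short_exact A K (\<lambda>x\<in>a_kernel S M e. x) S e M"
    unfolding K_def by (rule kernel_short_exact[OF Slm lm(2) e(1) e_im])
  \<comment> \<open>The inclusion of \<open>K\<close> into \<open>S\<close> factors through the preimage \<open>SL\<close> of \<open>L\<close>.\<close>
  obtain pe where pe: "pe \<in> mod_hom A S N" "\<forall>s\<in>carrier S. pe s = p (e s)" using hom_comp[OF e(1) s(2) Slm] by blast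
  have pe_im: "pe ` carrier S = carrier N"
  proof -
    have "pe ` carrier S = p ` (e ` carrier S)" using pe(2) by (simp add: image_image)
    then show ?thesis using e_im s(5) by simp
  qed
  define SL where "SL = S\<lparr>carrier := a_kernel S N pe\<rparr>"
  have SL: "SL \<in> fg_modules A" unfolding SL_def by (rule kernel_fg[OF D(1) N pe(1)])
  have e1: "hom_extends A SL (\<lambda>x\<in>a_kernel S N pe. x) S ?A"
    unfolding SL_def
    by (rule hom_extends_from_presentation[OF KNf PNf N SL[unfolded SL_def] D(1) reg PN sN
          kernel_short_exact[OF Slm lm(3) pe(1) pe_im] eN])
  have SL_def': "SL = S\<lparr>carrier := {s \<in> carrier S. p (e s) = \<zero>\<^bsub>N\<^esub>}\<rparr>"
    unfolding SL_def a_kernel_def' using pe(2) by (simp cong: conj_cong)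
  have SLc: "carrier SL = {s \<in> carrier S. p (e s) = \<zero>\<^bsub>N\<^esub>}" unfolding SL_def' by simp
  obtain e' where "short_exact A K (\<lambda>x\<in>a_kernel S M e. x) SL e' L"
    using kernel_of_composite_short_exact(2)[OF Klm Slm lm(2,1,3) sK perp(1)] unfolding SL_def' by blast
  then have e2: "hom_extends A K (\<lambda>x\<in>a_kernel S M e. x) SL ?A"
    by (rule hom_extends_from_presentation[OF KLf PLf L K SL reg PL sL _ eL])
  have eK: "hom_extends A K (\<lambda>x\<in>a_kernel S M e. x) S ?A"
    unfolding hom_extends_def
  proof
    fix f assume "f \<in> mod_hom A K ?A"
    from hom_extendsD[OF e2 this] obtain g where g: "g \<in> mod_hom A SL ?A"
      "\<forall>x\<in>carrier K. g ((\<lambda>x\<in>a_kernel S M e. x) x) = f x" by blast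
    from hom_extendsD[OF e1 g(1)] obtain g' where g': "g' \<in> mod_hom A S ?A"
      "\<forall>x\<in>carrier SL. g' ((\<lambda>x\<in>a_kernel S N pe. x) x) = g x" by blast
    have "g' x = f x" if "x \<in> carrier K" for x
    proof -
      have "x \<in> a_kernel S M e" using that unfolding K_def by simp
      moreover have "x \<in> carrier SL" using that unfolding Kc SLc by (simp add: pD)
      moreover then have "x \<in> a_kernel S N pe" unfolding SL_def by simp
      ultimately show ?thesis using that g(2) g'(2) by (metis restrict_apply')
    qed
    then show "\<exists>g\<in>mod_hom A S ?A. \<forall>x\<in>carrier K. g ((\<lambda>x\<in>a_kernel S M e. x) x) = f x"
      by (intro bexI[OF _ g'(1)]) (simp add: K_def)
  qed
  \<comment> \<open>The kernel \<open>K\<close> is again an extension, of \<open>KN\<close> by \<open>KL\<close>.\<close>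
  obtain a0 where a0: "a0 \<in> mod_hom A KL S" "\<forall>x\<in>carrier KL. a0 x = i1 (a x)"
    using hom_comp[OF sL'(1) D(2) lm(6)] by blast
  have a': "a0 \<in> mod_hom A KL K"
    unfolding K_def by (rule corestrict_hom[OF a0(1)])
      (use a0(2) e(3) ib(2) in \<open>auto simp: a_kernel_def' i1D aD sL'(6) iD\<close>)
  have r2K: "restrict r2 (carrier K) \<in> mod_hom A K PN"
    using restrict_hom[OF module_hom.submod_kernel[OF module_homI[OF Slm lm(2) e(1)]] D(5)]
    unfolding K_def by simp
  have "restrict r2 (carrier K) ` carrier K \<subseteq> c ` carrier KN"
    unfolding sN'(4) a_kernel_def' by (auto simp: Kc r2D pe_val[symmetric] pD(4))
  then obtain c' where c': "c' \<in> mod_hom A K KN" "\<forall>s\<in>carrier K. c (c' s) = restrict r2 (carrier K) s"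
    using hom_factors_through_inj[OF lm(7,5) Klm sN'(1,3) r2K] by blast
  have i_inj: "x = y" if "x \<in> carrier L" "y \<in> carrier L" "i x = i y" for x y
    using s(3) that by (auto dest: inj_onD)
  have c_inj: "x = y" if "x \<in> carrier KN" "y \<in> carrier KN" "c x = c y" for x y
    using sN'(3) that by (auto dest: inj_onD)
  have a_inj: "x = y" if "x \<in> carrier KL" "y \<in> carrier KL" "a x = a y" for x y
    using sL'(3) that by (auto dest: inj_onD)
  have KNz: "\<zero>\<^bsub>KN\<^esub> \<in> carrier KN" and KLz: "\<zero>\<^bsub>KL\<^esub> \<in> carrier KL"
    using left_module_zero_closed lm(6,7) by auto
  have "short_exact A KL a0 K c' KN"
  proof (rule short_exactI[OF a' c'(1) lm(6) Klm])
    fix x assume x: "x \<in> carrier KL" "a0 x = \<zero>\<^bsub>K\<^esub>"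
    then have "r1 (i1 (a x)) = r1 \<zero>\<^bsub>S\<^esub>" using a0(2) by (simp add: Kc)
    then have "a x = a \<zero>\<^bsub>KL\<^esub>" using x(1) by (simp add: D aD r1D)
    then show "x = \<zero>\<^bsub>KL\<^esub>" using a_inj[OF x(1) KLz] by blast
  next
    fix x assume x: "x \<in> carrier KL"
    have mem: "a0 x \<in> carrier K" by (rule mod_homD(1)[OF a' x])
    then have "c (c' (a0 x)) = c \<zero>\<^bsub>KN\<^esub>" using c'(2) a0(2) x by (simp add: D aD cD)
    then show "c' (a0 x) = \<zero>\<^bsub>KN\<^esub>" using c_inj[OF mod_homD(1)[OF c'(1) mem] KNz] by blast
  next
    fix s assume s': "s \<in> carrier K" "c' s = \<zero>\<^bsub>KN\<^esub>"
    then have sS: "s \<in> carrier S" and es: "e s = \<zero>\<^bsub>M\<^esub>" by (simp_all add: Kc)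
    have r2s: "r2 s = \<zero>\<^bsub>PN\<^esub>" using bspec[OF c'(2) s'(1)] s' by (simp add: cD)
    then have si: "s = i1 (r1 s)" using D(10)[OF sS] sS by (simp add: i1D i2D r1D)
    have "e (i1 (r1 s)) = \<zero>\<^bsub>M\<^esub>" using es by (simp add: si[symmetric])
    then have "i (b (r1 s)) = i \<zero>\<^bsub>L\<^esub>"
      using bspec[OF e(3) r1D(1)[OF sS]] bspec[OF ib(2) r1D(1)[OF sS]] by (simp add: iD)
    then have "b (r1 s) = \<zero>\<^bsub>L\<^esub>"
      using i_inj[OF bD(1)[OF r1D(1)[OF sS]] L.M.zero_closed] by simp
    then obtain x where "x \<in> carrier KL" "r1 s = a x" using sL'(7)[OF r1D(1)[OF sS]] by blast
    then show "\<exists>x\<in>carrier KL. s = a0 x" using si a0(2) by auto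
  next
    fix k assume k: "k \<in> carrier KN"
    note ck = cD(1)[OF k]
    have "p (h (c k)) = \<zero>\<^bsub>N\<^esub>" using h(2) ck sN'(6)[OF k] by simp
    then obtain l where l: "l \<in> carrier L" "h (c k) = i l" using s(7) hD(1)[OF ck] by blast
    obtain x where x: "x \<in> carrier PL" "l = b x" using sL'(8)[OF l(1)] by blast
    define s where "s = i1 (\<ominus>\<^bsub>PL\<^esub> x) \<oplus>\<^bsub>S\<^esub> i2 (c k)"
    have sS: "s \<in> carrier S" unfolding s_def using x ck by (simp add: i1D i2D)
    have "e s = \<ominus>\<^bsub>M\<^esub> i l \<oplus>\<^bsub>M\<^esub> i l" unfolding s_def using x ck l e(3,4) ib(2)
      by (simp add: eD i1D i2D bD iD)
    then have sK: "s \<in> carrier K" using sS iD(1)[OF l(1)] by (simp add: Kc M.M.l_neg)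
    have "r2 s = c k" unfolding s_def using x ck by (simp add: r2D i1D i2D D)
    then have "c (c' s) = c k" using c'(2) sK by simp
    then have "k = c' s" using c_inj[OF k mod_homD(1)[OF c'(1) sK]] by simp
    then show "\<exists>s\<in>carrier K. k = c' s" using sK by blast
  qed
  then have "\<exists>L i M p N. K = M \<and> short_exact A L i M p N \<and> perp A L \<and> perp A N \<and> M \<in> fg_modules A"
    using KL KN K by blast
  then show ?case
    using M projective_direct_sum[OF S PL PN] sK eK by blast
qed

end

context left_noetherian_ring
begin

text \<open>If \<open>Q \<rightarrow> X\<close> presents \<open>X\<close>, then the preimage of the summand \<open>L\<close> is a summand of \<open>Q\<close> and presents \<open>L\<close> with
  the same kernel.\<close>

lemma perp_kernel_onto_projective:
  assumes s: "short_exact A L a X r P" and P: "projective_module A P" and X: "perp A X"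
    and L: "L \<in> fg_modules A"
  shows "perp A L"
  using X
proof cases
  case (perpI Q K i q)
  let ?A = "regular_module A"
  note s' = short_exactD[OF s] and t' = short_exactD[OF perpI(3)]
  note Pf = projective_module_fg[OF P] and Qf = projective_module_fg[OF perpI(2)] and Kf = perp_fg[OF perpI(5)]
  note Xf = perpI(1)
  note lm = L[THEN fg_modulesD(1)] Xf[THEN fg_modulesD(1)] Pf[THEN fg_modulesD(1)] Qf[THEN fg_modulesD(1)]
    Kf[THEN fg_modulesD(1)]
  interpret X: left_module A X by (rule lm)
  interpret Q: left_module A Q by (rule lm)
  interpret P: left_module A P by (rule lm)
  obtain rq where rq: "rq \<in> mod_hom A Q P" "\<forall>y\<in>carrier Q. rq y = r (q y)"
    using hom_comp[OF t'(2) s'(2) lm(4)] by blast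
  note rD = homD[OF s'(2) lm(2,3)] and qD = homD[OF t'(2) lm(4,2)] and iD = homD[OF t'(1) lm(5,4)]
    and aD = homD[OF s'(1) lm(1,2)] and rqD = homD[OF rq(1) lm(4,3)]
  have rq_surj: "rq ` carrier Q = carrier P"
  proof -
    have "rq ` carrier Q = r ` (q ` carrier Q)" using rq(2) by (simp add: image_image)
    then show ?thesis using s'(5) t'(5) by simp
  qed
  obtain \<sigma> where \<sigma>: "\<sigma> \<in> mod_hom A P Q" "\<forall>y\<in>carrier P. rq (\<sigma> y) = (\<lambda>y\<in>carrier P. y) y"
    using projective_lift[OF P Qf Pf rq(1) rq_surj id_hom[OF lm(3)]] by blast
  note \<sigma>D = homD[OF \<sigma>(1) lm(3,4)]
  define N where "N = {y \<in> carrier Q. r (q y) = \<zero>\<^bsub>P\<^esub>}"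
  have N: "submod A Q N" and ses: "\<exists>q'. short_exact A K i (Q\<lparr>carrier := N\<rparr>) q' L"
    unfolding N_def by (rule kernel_of_composite_short_exact[OF lm(5,4,2,1,3) perpI(3) s])+
  have Niff: "y \<in> N \<longleftrightarrow> y \<in> carrier Q \<and> rq y = \<zero>\<^bsub>P\<^esub>" for y unfolding N_def using rq(2) by auto
  let ?Q = "Q\<lparr>carrier := N\<rparr>"
  have Q': "?Q \<in> fg_modules A" by (rule submodule_fg[OF Qf N])
  note Q'lm = fg_modulesD(1)[OF Q']
  have "projective_module A ?Q"
  proof (rule projective_retract[OF Q' perpI(2) sub_incl_hom[OF lm(4) N]])
    have "(\<lambda>y\<in>carrier Q. y \<ominus>\<^bsub>Q\<^esub> \<sigma> (rq y)) \<in> mod_hom A Q Q"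
      by (rule mod_homI) (simp_all add: rqD \<sigma>D Q.add_diff_add Q.smult_diff)
    then show "(\<lambda>y\<in>carrier Q. y \<ominus>\<^bsub>Q\<^esub> \<sigma> (rq y)) \<in> mod_hom A Q ?Q"
      by (rule corestrict_hom) (use \<sigma>(2) in \<open>auto simp: Niff rqD \<sigma>D\<close>)
  next
    fix x assume "x \<in> carrier ?Q"
    then show "(\<lambda>y\<in>carrier Q. y \<ominus>\<^bsub>Q\<^esub> \<sigma> (rq y)) ((\<lambda>x\<in>N. x) x) = x" by (simp add: Niff \<sigma>D)
  qed
  moreover obtain q' where ses: "short_exact A K i ?Q q' L" using ses by blast
  moreover have "hom_extends A K i ?Q ?A"
    unfolding hom_extends_def
  proof
    fix f assume "f \<in> mod_hom A K ?A"
    from hom_extendsD[OF perpI(4) this] obtain g where g: "g \<in> mod_hom A Q ?A" "\<forall>x\<in>carrier K. g (i x) = f x" by blast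
    show "\<exists>g\<in>mod_hom A ?Q ?A. \<forall>x\<in>carrier K. g (i x) = f x"
      by (rule bexI[OF _ restrict_hom[OF N g(1)]]) (use g(2) mod_homD(1)[OF short_exactD(1)[OF ses]] in simp)
  qed
  ultimately show ?thesis using L perpI(5) perp.perpI by blast
qed

text \<open>Independence of the presentation. The pullback of two presentations is an extension of either
  projective module by the kernel over the other one.\<close>

lemma perp_syzygy:
  assumes M: "perp A M" and s: "short_exact A K' i' P' p' M" and P': "projective_module A P'" and K': "K' \<in> fg_modules A"
  shows "perp A K'"
  using M
proof cases
  case (perpI P K i p)
  note s' = short_exactD[OF s] and t' = short_exactD[OF perpI(3)]
  note Pf = projective_module_fg[OF perpI(2)] and P'f = projective_module_fg[OF P'] and Kf = perp_fg[OF perpI(5)]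
  obtain X u v where X: "X \<in> fg_modules A" and pb: "elementwise_pullback A X u v P p P' p' M"
    using pullback_exists[OF Pf P'f perpI(1) t'(2) s'(2)] by blast
  note lm = X[THEN fg_modulesD(1)] Pf[THEN fg_modulesD(1)] P'f[THEN fg_modulesD(1)]
    perpI(1)[THEN fg_modulesD(1)] K'[THEN fg_modulesD(1)] Kf[THEN fg_modulesD(1)]
  obtain k' where k': "short_exact A K' k' X u P"
    using elementwise_pullback_short_exact[OF pb s lm(1,2,3,4,5) t'(2)] by blast
  obtain k where k: "short_exact A K k X v P'"
    using elementwise_pullback_short_exact[OF elementwise_pullback_sym[OF pb] perpI(3) lm(1,3,2,4,6) s'(2)] by blast
  have "perp A X" by (rule perp_extension[OF k perpI(5) projective_perp[OF P'] X])
  then show ?thesis by (rule perp_kernel_onto_projective[OF k' perpI(2) _ K'])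
qed

lemma projective_presentation_exists:
  assumes "M \<in> fg_modules A"
  shows "\<exists>P K i p. projective_module A P \<and> K \<in> fg_modules A \<and> short_exact A K i P p M"
proof -
  obtain P p where P: "projective_module A P" and p: "p \<in> mod_hom A P M" "p ` carrier P = carrier M"
    using projective_surjection_exists[OF ring_axioms assms] by blast
  note Pf = projective_module_fg[OF P]
  show ?thesis
    using P kernel_fg[OF Pf assms p(1)] kernel_short_exact[OF fg_modulesD(1)[OF Pf] fg_modulesD(1)[OF assms] p]
    by blast
qed

lemma perp_presentation:
  assumes "perp A M"
  shows "\<exists>P K i p. projective_module A P \<and> perp A K \<and> short_exact A K i P p M"
proof -
  obtain P K i p where *: "projective_module A P" "K \<in> fg_modules A" "short_exact A K i P p M"
    using projective_presentation_exists[OF perp_fg[OF assms]] by blast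
  then show ?thesis using perp_syzygy[OF assms *(3,1,2)] by blast
qed

lemma projective_resolution_exists:
  assumes M: "M \<in> fg_modules A"
  shows "\<exists>P d e. projective_resolution A M P d e"
proof -
  have "\<forall>N\<in>fg_modules A. \<exists>Pp. projective_module A (fst Pp) \<and> snd Pp \<in> mod_hom A (fst Pp) N \<and>
      snd Pp ` carrier (fst Pp) = carrier N"
    using projective_surjection_exists[OF ring_axioms] by fastforce
  then obtain F where F: "\<And>N. N \<in> fg_modules A \<Longrightarrow> projective_module A (fst (F N))"
    "\<And>N. N \<in> fg_modules A \<Longrightarrow> snd (F N) \<in> mod_hom A (fst (F N)) N"
    "\<And>N. N \<in> fg_modules A \<Longrightarrow> snd (F N) ` carrier (fst (F N)) = carrier N"
    by metis
  define S where "S = rec_nat M (\<lambda>n N. (fst (F N))\<lparr>carrier := a_kernel (fst (F N)) N (snd (F N))\<rparr>)"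
  have S0: "S 0 = M" and SS: "S (Suc n) = (fst (F (S n)))\<lparr>carrier := a_kernel (fst (F (S n))) (S n) (snd (F (S n)))\<rparr>" for n
    unfolding S_def by simp_all
  have S: "S n \<in> fg_modules A" for n
  proof (induction n)
    case (Suc n)
    show ?case unfolding SS by (rule kernel_fg[OF projective_module_fg[OF F(1)[OF Suc]] Suc F(2)[OF Suc]])
  qed (simp add: S0 M)
  have carr: "carrier (S (Suc n)) = a_kernel (fst (F (S n))) (S n) (snd (F (S n)))" for n by (simp add: SS)
  have zero: "\<zero>\<^bsub>S (Suc n)\<^esub> = \<zero>\<^bsub>fst (F (S n))\<^esub>" for n by (simp add: SS)
  have "snd (F (S (Suc n))) \<in> mod_hom A (fst (F (S (Suc n)))) (fst (F (S n)))" for n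
    using sub_hom_hom[OF F(2)[OF S[of "Suc n"], unfolded SS[of n]]] unfolding SS[of n]
    by (auto simp: a_kernel_def')
  moreover have "snd (F (S (Suc (Suc n)))) ` carrier (fst (F (S (Suc (Suc n))))) =
      a_kernel (fst (F (S (Suc n)))) (fst (F (S n))) (snd (F (S (Suc n))))" for n
    unfolding F(3)[OF S[of "Suc (Suc n)"]] carr unfolding a_kernel_def' zero by simp
  moreover have "snd (F (S 1)) ` carrier (fst (F (S 1))) = a_kernel (fst (F (S 0))) M (snd (F (S 0)))"
    using F(3)[OF S[of 1]] carr[of 0] by (simp add: S0)
  moreover have "snd (F (S 0)) \<in> mod_hom A (fst (F (S 0))) M" "snd (F (S 0)) ` carrier (fst (F (S 0))) = carrier M"
    using F(2,3)[OF S[of 0]] by (simp_all add: S0)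
  ultimately have "projective_resolution A M (\<lambda>n. fst (F (S n))) (\<lambda>n. snd (F (S (Suc n)))) (snd (F (S 0)))"
    unfolding projective_resolution_def using F(1)[OF S] by simp
  then show ?thesis by blast
qed

end

section \<open>Extension groups\<close>

lemma hom_group_simps [simp]:
  "carrier (hom_group R M N) = mod_hom R M N"
  "f \<otimes>\<^bsub>hom_group R M N\<^esub> g = (\<lambda>x\<in>carrier M. f x \<oplus>\<^bsub>N\<^esub> g x)"
  "\<one>\<^bsub>hom_group R M N\<^esub> = (\<lambda>x\<in>carrier M. \<zero>\<^bsub>N\<^esub>)"
  by (simp_all add: hom_group_def)

lemma hom_group_comm_group:
  assumes M: "left_module R M" and N: "left_module R N"
  shows "comm_group (hom_group R M N)"
proof (rule comm_groupI)
  interpret M: left_module R M by fact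
  interpret N: left_module R N by fact
  fix f assume f: "f \<in> carrier (hom_group R M N)"
  then have f': "f \<in> mod_hom R M N" by simp
  note fD = homD[OF f' M N]
  show "\<one>\<^bsub>hom_group R M N\<^esub> \<otimes>\<^bsub>hom_group R M N\<^esub> f = f"
    by (rule extensionalityI[OF _ mod_homD(4)[OF f']]) (auto simp: fD)
  show "\<exists>g\<in>carrier (hom_group R M N). g \<otimes>\<^bsub>hom_group R M N\<^esub> f = \<one>\<^bsub>hom_group R M N\<^esub>"
    by (rule bexI[of _ "\<lambda>x\<in>carrier M. \<ominus>\<^bsub>N\<^esub> f x"])
      (use minus_hom[OF M N f'] in \<open>auto simp: fD N.M.l_neg intro!: restrict_ext\<close>)
  fix g assume "g \<in> carrier (hom_group R M N)"
  then have g': "g \<in> mod_hom R M N" by simp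
  note gD = homD[OF g' M N]
  show "f \<otimes>\<^bsub>hom_group R M N\<^esub> g \<in> carrier (hom_group R M N)" using add_hom[OF M N f' g'] by simp
  show "f \<otimes>\<^bsub>hom_group R M N\<^esub> g = g \<otimes>\<^bsub>hom_group R M N\<^esub> f"
    by (auto simp: fD gD N.M.a_comm intro!: restrict_ext)
  fix h assume "h \<in> carrier (hom_group R M N)"
  then have h': "h \<in> mod_hom R M N" by simp
  note hD = homD[OF h' M N]
  show "f \<otimes>\<^bsub>hom_group R M N\<^esub> g \<otimes>\<^bsub>hom_group R M N\<^esub> h = f \<otimes>\<^bsub>hom_group R M N\<^esub> (g \<otimes>\<^bsub>hom_group R M N\<^esub> h)"
    by (auto simp: fD gD hD N.M.a_assoc intro!: restrict_ext)
qed (use zero_hom[OF M N] in simp)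

lemma precomp_group_hom:
  assumes P: "left_module R P" and Q: "left_module R Q" and N: "left_module R N" and d: "d \<in> mod_hom R P Q"
  shows "group_hom (hom_group R Q N) (hom_group R P N) (precomp P d)"
proof -
  interpret G: comm_group "hom_group R Q N" by (rule hom_group_comm_group[OF Q N])
  interpret H: comm_group "hom_group R P N" by (rule hom_group_comm_group[OF P N])
  have "precomp P d \<in> hom (hom_group R Q N) (hom_group R P N)"
    unfolding hom_def precomp_def
    using compose_mod_hom[OF P d] mod_homD(1)[OF d] by (auto simp: compose_def intro!: restrict_ext)
  then show ?thesis by unfold_locales
qed

lemma (in comm_group) trivial_quotient_iff:
  assumes Z: "subgroup Z G" and B: "subgroup B G" "B \<subseteq> Z"
  shows "trivial_group ((G\<lparr>carrier := Z\<rparr>) Mod B) \<longleftrightarrow> Z \<subseteq> B"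
proof -
  interpret Z: comm_group "G\<lparr>carrier := Z\<rparr>"
    by (rule group.group_comm_groupI[OF subgroup_imp_group[OF Z]]) (simp add: m_comm subgroup.mem_carrier[OF Z])
  have sub: "subgroup B (G\<lparr>carrier := Z\<rparr>)" by (rule subgroup_incl[OF B(1) Z B(2)])
  have nor: "B \<lhd> G\<lparr>carrier := Z\<rparr>" by (rule Z.subgroup_imp_normal[OF sub])
  have "trivial_group ((G\<lparr>carrier := Z\<rparr>) Mod B) \<longleftrightarrow> rcosets\<^bsub>G\<lparr>carrier := Z\<rparr>\<^esub> B = {B}"
    unfolding trivial_group_def using normal.factorgroup_is_group[OF nor] by (simp add: FactGroup_def)
  also have "\<dots> \<longleftrightarrow> Z \<subseteq> B"
  proof
    assume *: "rcosets\<^bsub>G\<lparr>carrier := Z\<rparr>\<^esub> B = {B}"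
    show "Z \<subseteq> B"
    proof
      fix z assume z: "z \<in> Z"
      then have "B #>\<^bsub>G\<lparr>carrier := Z\<rparr>\<^esub> z \<in> rcosets\<^bsub>G\<lparr>carrier := Z\<rparr>\<^esub> B" by (auto simp: RCOSETS_def)
      then have "B #>\<^bsub>G\<lparr>carrier := Z\<rparr>\<^esub> z = B" using * by simp
      then show "z \<in> B" using Z.coset_join1[of B z] sub z by simp
    qed
  next
    assume "Z \<subseteq> B"
    then have "B #>\<^bsub>G\<lparr>carrier := Z\<rparr>\<^esub> z = B" if "z \<in> Z" for z
      using Z.coset_join2[of z B] sub that by auto
    then show "rcosets\<^bsub>G\<lparr>carrier := Z\<rparr>\<^esub> B = {B}"
      using subgroup.one_closed[OF Z] by (auto simp: RCOSETS_def)
  qed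
  finally show ?thesis .
qed

lemma mem_kernel_precomp_iff:
  "f \<in> kernel (hom_group R Q N) (hom_group R P N) (precomp P d) \<longleftrightarrow>
    f \<in> mod_hom R Q N \<and> (\<forall>x\<in>carrier P. f (d x) = \<zero>\<^bsub>N\<^esub>)"
  unfolding kernel_def precomp_def by (auto simp: compose_def fun_eq_iff)

lemma mem_image_precomp_iff:
  assumes "f \<in> mod_hom R P N"
  shows "f \<in> precomp P d ` mod_hom R Q N \<longleftrightarrow> (\<exists>g\<in>mod_hom R Q N. \<forall>x\<in>carrier P. g (d x) = f x)"
  unfolding image_iff precomp_def using compose_eq_hom_iff[OF assms] by metis

text \<open>Cocycles are the homomorphisms that vanish on the boundaries, that is, the homomorphisms from the
  image of \<open>c\<close>; coboundaries are those that extend from the image to \<open>R\<close>.\<close>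

lemma cocycles_le_coboundaries_iff:
  assumes lm: "left_module A P" "left_module A Q" "left_module A R" "left_module A T"
    and b: "b \<in> mod_hom A P Q" and c: "c \<in> mod_hom A Q R" and im: "submod A R (c ` carrier Q)"
    and exact: "b ` carrier P = a_kernel Q R c"
  shows "kernel (hom_group A Q T) (hom_group A P T) (precomp P b) \<subseteq> precomp Q c ` mod_hom A R T \<longleftrightarrow>
    hom_extends A (R\<lparr>carrier := c ` carrier Q\<rparr>) (\<lambda>x\<in>c ` carrier Q. x) R T" (is "?L \<longleftrightarrow> ?R")
proof
  let ?I = "R\<lparr>carrier := c ` carrier Q\<rparr>"
  have Ilm: "left_module A ?I" by (rule left_module.submod_left_module[OF lm(3) im])
  have cI: "c \<in> mod_hom A Q ?I" by (rule corestrict_hom[OF c]) simp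
  { assume L: ?L
    show ?R
      unfolding hom_extends_def
    proof
      fix f assume f: "f \<in> mod_hom A ?I T"
      obtain fc where fc: "fc \<in> mod_hom A Q T" "\<forall>x\<in>carrier Q. fc x = f (c x)"
        using hom_comp[OF cI f lm(2)] by blast
      have "fc (b x) = \<zero>\<^bsub>T\<^esub>" if "x \<in> carrier P" for x
      proof -
        have "b x \<in> a_kernel Q R c" using that exact by blast
        then show ?thesis using fc(2) homD(4)[OF f Ilm lm(4)] unfolding a_kernel_def' by simp
      qed
      then have "fc \<in> precomp Q c ` mod_hom A R T"
        using L fc(1) by (auto simp: mem_kernel_precomp_iff subset_iff)
      then obtain g where "g \<in> mod_hom A R T" "\<forall>x\<in>carrier Q. g (c x) = fc x"
        using mem_image_precomp_iff[OF fc(1)] by blast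
      then show "\<exists>g\<in>mod_hom A R T. \<forall>x\<in>carrier ?I. g ((\<lambda>x\<in>c ` carrier Q. x) x) = f x"
        using fc(2) by (intro bexI[of _ g]) auto
    qed }
  { assume R: ?R
    show ?L
    proof
      fix f assume "f \<in> kernel (hom_group A Q T) (hom_group A P T) (precomp P b)"
      then have f: "f \<in> mod_hom A Q T" and fb: "\<forall>x\<in>carrier P. f (b x) = \<zero>\<^bsub>T\<^esub>"
        unfolding mem_kernel_precomp_iff by auto
      have "\<exists>g\<in>mod_hom A ?I T. \<forall>x\<in>carrier Q. g (c x) = f x"
      proof (rule hom_factors_through_surj[OF lm(2) Ilm lm(4) cI _ f])
        fix x assume "x \<in> carrier Q" "c x = \<zero>\<^bsub>?I\<^esub>"
        then have "x \<in> b ` carrier P" unfolding exact a_kernel_def' by simp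
        then show "f x = \<zero>\<^bsub>T\<^esub>" using fb by blast
      qed simp
      then obtain g where g: "g \<in> mod_hom A ?I T" "\<forall>x\<in>carrier Q. g (c x) = f x" by blast
      from hom_extendsD[OF R g(1)] obtain h where
        h: "h \<in> mod_hom A R T" "\<forall>x\<in>carrier ?I. h ((\<lambda>x\<in>c ` carrier Q. x) x) = g x" by blast
      have "\<forall>x\<in>carrier Q. h (c x) = f x" using h(2) g(2) by simp
      then show "f \<in> precomp Q c ` mod_hom A R T" using mem_image_precomp_iff[OF f] h(1) by blast
    qed }
qed

text \<open>The \<open>n\<close>-th syzygy of a projective resolution, realised inside the resolution.\<close>

definition syzygy :: "'a fgmod \<Rightarrow> (nat \<Rightarrow> 'a fgmod) \<Rightarrow> (nat \<Rightarrow> 'a fgmap) \<Rightarrow> nat \<Rightarrow> 'a fgmod"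
  where "syzygy M P d n = (case n of 0 \<Rightarrow> M | Suc m \<Rightarrow> (P m)\<lparr>carrier := d m ` carrier (P (Suc m))\<rparr>)"

context left_noetherian_ring
begin

lemma resolution_syzygy:
  assumes res: "projective_resolution A M P d e" and M: "M \<in> fg_modules A"
  shows "syzygy M P d n \<in> fg_modules A"
    "short_exact A (syzygy M P d (Suc n)) (\<lambda>x\<in>d n ` carrier (P (Suc n)). x) (P n)
      (case n of 0 \<Rightarrow> e | Suc m \<Rightarrow> d m) (syzygy M P d n)"
proof -
  have P: "\<And>n. P n \<in> fg_modules A" and d: "\<And>n. d n \<in> mod_hom A (P (Suc n)) (P n)"
    and e: "e \<in> mod_hom A (P 0) M" "e ` carrier (P 0) = carrier M"
    and ex0: "d 0 ` carrier (P (Suc 0)) = a_kernel (P 0) M e"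
    and ex: "\<And>n. d (Suc n) ` carrier (P (Suc (Suc n))) = a_kernel (P (Suc n)) (P n) (d n)"
    using res unfolding projective_resolution_def by (auto simp: projective_module_fg)
  note lm = P[THEN fg_modulesD(1)]
  have im: "submod A (P n) (d n ` carrier (P (Suc n)))" for n
    by (intro module_hom.submod_image[OF module_homI[OF lm lm d]] left_module.submod_carrier lm)
  show fg: "syzygy M P d n \<in> fg_modules A" for n
    unfolding syzygy_def using M submodule_fg[OF P im] by (cases n) simp_all
  show "short_exact A (syzygy M P d (Suc n)) (\<lambda>x\<in>d n ` carrier (P (Suc n)). x) (P n)
      (case n of 0 \<Rightarrow> e | Suc m \<Rightarrow> d m) (syzygy M P d n)"
  proof (cases n)
    case 0
    then show ?thesis
      using kernel_short_exact[OF lm fg_modulesD(1)[OF M] e] ex0 by (simp add: syzygy_def)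
  next
    case (Suc m)
    let ?I = "(P m)\<lparr>carrier := d m ` carrier (P (Suc m))\<rparr>"
    have "short_exact A ((P n)\<lparr>carrier := a_kernel (P n) ?I (d m)\<rparr>) (\<lambda>x\<in>a_kernel (P n) ?I (d m). x) (P n) (d m) ?I"
      using corestrict_hom[OF d[of m]] Suc
      by (intro kernel_short_exact lm left_module.submod_left_module[OF lm im]) simp_all
    moreover have "a_kernel (P n) ?I (d m) = d n ` carrier (P (Suc n))"
      using ex[of m] Suc unfolding a_kernel_def' by simp
    ultimately show ?thesis using Suc by (simp add: syzygy_def)
  qed
qed

text \<open>The extension groups are computed from an unspecified resolution. If they vanish, then its syzygies form a
  class to which coinduction applies. Conversely, the property passes to the syzygies of every resolution.\<close>

lemma semi_gorenstein_projective_iff_perp: "M \<in> semi_gorenstein_projective A \<longleftrightarrow> perp A M"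
proof (cases "M \<in> fg_modules A")
  case False
  then show ?thesis using perp_fg by (auto simp: semi_gorenstein_projective_def)
next
  case M: True
  let ?A = "regular_module A"
  note reg = regular_module_left_module[OF ring_axioms]
  obtain P d e where some: "(SOME (P, d, e). projective_resolution A M P d e) = (P, d, e)"
    by (metis prod_cases3)
  have "\<exists>x. case x of (P, d, e) \<Rightarrow> projective_resolution A M P d e"
    using projective_resolution_exists[OF M] by auto
  from someI_ex[OF this] have res: "projective_resolution A M P d e" unfolding some by simp
  have proj: "\<And>n. projective_module A (P n)" and d: "\<And>n. d n \<in> mod_hom A (P (Suc n)) (P n)"
    and ex: "\<And>n. d (Suc n) ` carrier (P (Suc (Suc n))) = a_kernel (P (Suc n)) (P n) (d n)"
    using res unfolding projective_resolution_def by auto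
  note P = projective_module_fg[OF proj]
  note lm = P[THEN fg_modulesD(1)]
  have im: "submod A (P n) (d n ` carrier (P (Suc n)))" for n
    by (intro module_hom.submod_image[OF module_homI[OF lm lm d]] left_module.submod_carrier lm)
  let ?S = "syzygy M P d"
  note syz = resolution_syzygy[OF res M]
  define ext where "ext n \<longleftrightarrow> hom_extends A (?S (Suc n)) (\<lambda>x\<in>d n ` carrier (P (Suc n)). x) (P n) ?A" for n
  have Ext: "trivial_group (Ext A (Suc n) M ?A) \<longleftrightarrow> ext n" for n
  proof -
    interpret G: comm_group "hom_group A (P (Suc n)) ?A" by (rule hom_group_comm_group[OF lm reg])
    interpret b: group_hom "hom_group A (P (Suc n)) ?A" "hom_group A (P (Suc (Suc n))) ?A"
      "precomp (P (Suc (Suc n))) (d (Suc n))" by (rule precomp_group_hom[OF lm lm reg d])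
    interpret c: group_hom "hom_group A (P n) ?A" "hom_group A (P (Suc n)) ?A"
      "precomp (P (Suc n)) (d n)" by (rule precomp_group_hom[OF lm lm reg d])
    have "coboundaries A P d ?A (Suc n) \<subseteq> cocycles A P d ?A (Suc n)"
    proof
      fix f assume "f \<in> coboundaries A P d ?A (Suc n)"
      then obtain g where g: "g \<in> mod_hom A (P n) ?A" and f: "f = precomp (P (Suc n)) (d n) g" by auto
      have "f (d (Suc n) x) = \<zero>" if x: "x \<in> carrier (P (Suc (Suc n)))" for x
      proof -
        have "d (Suc n) x \<in> a_kernel (P (Suc n)) (P n) (d n)" using ex x by blast
        then show ?thesis unfolding f precomp_def a_kernel_def' using homD(4)[OF g lm reg]
          by (simp add: compose_def)
      qed
      then show "f \<in> cocycles A P d ?A (Suc n)"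
        unfolding cocycles_def mem_kernel_precomp_iff
        using c.hom_closed[of g] g f by simp
    qed
    then have "trivial_group (Ext A (Suc n) M ?A) \<longleftrightarrow> cocycles A P d ?A (Suc n) \<subseteq> coboundaries A P d ?A (Suc n)"
      unfolding Ext_def some using b.subgroup_kernel c.img_is_subgroup
      by (simp add: cocycles_def G.trivial_quotient_iff)
    also have "\<dots> \<longleftrightarrow> ext n"
      unfolding ext_def cocycles_def coboundaries.simps syzygy_def nat.case
      by (rule cocycles_le_coboundaries_iff[OF lm lm lm reg d d im ex])
    finally show ?thesis .
  qed
  have "(\<forall>i\<ge>1. trivial_group (Ext A i M ?A)) \<longleftrightarrow> (\<forall>n. ext n)"
    using Ext by (metis Suc_le_D One_nat_def le_add1 plus_1_eq_Suc)
  moreover have "(\<forall>n. ext n) \<longleftrightarrow> perp A M"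
  proof
    assume ext: "\<forall>n. ext n"
    have "perp A N" if "\<exists>n. N = ?S n" for N
      using that
    proof (coinduction arbitrary: N)
      case (perp N)
      then obtain n where "N = ?S n" by blast
      then show ?case using syz[of n] proj[of n] ext unfolding ext_def by blast
    qed
    then have "perp A (?S 0)" by blast
    then show "perp A M" by (simp add: syzygy_def)
  next
    assume pM: "perp A M"
    have pS: "perp A (?S n)" for n
    proof (induction n)
      case 0
      show ?case using pM by (simp add: syzygy_def)
    next
      case (Suc n)
      show ?case by (rule perp_syzygy[OF Suc syz(2) proj syz(1)])
    qed
    show "\<forall>n. ext n"
      unfolding ext_def using perp_hom_extends[OF ring_axioms pS syz(1) P syz(2)] by blast
  qed
  ultimately show ?thesis using M by (simp add: semi_gorenstein_projective_def)
qed

end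

section \<open>Extension-closed subcategories are exact\<close>

lemma full_subcategory_simps [simp]:
  "Ob (full_subcategory A \<X>) = \<X>"
  "Mor (full_subcategory A \<X>) M N = mod_hom A M N"
  "Hom (full_subcategory A \<X>) = hom_group A"
  "Id (full_subcategory A \<X>) M = (\<lambda>x\<in>carrier M. x)"
  "Cmp (full_subcategory A \<X>) L M N g f = compose (carrier L) g f"
  by (simp_all add: full_subcategory_def Mor_def)

lemma compose_eq_restrict_iff:
  "compose C g f = (\<lambda>x\<in>C. h x) \<longleftrightarrow> (\<forall>x\<in>C. g (f x) = h x)"
  by (auto simp: compose_def fun_eq_iff)

lemma mem_canonical_conflations_iff [simp]:
  "(L, i, M, p, N) \<in> canonical_conflations A \<X> \<longleftrightarrow> L \<in> \<X> \<and> M \<in> \<X> \<and> N \<in> \<X> \<and> short_exact A L i M p N"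
  by (simp add: canonical_conflations_def)

lemma isomorphism_full_subcategory_iff:
  "isomorphism (full_subcategory A \<X>) X Y f \<longleftrightarrow> f \<in> mod_hom A X Y \<and>
    (\<exists>g\<in>mod_hom A Y X. (\<forall>x\<in>carrier X. g (f x) = x) \<and> (\<forall>y\<in>carrier Y. f (g y) = y))"
  by (simp add: isomorphism_def compose_eq_restrict_iff)

text \<open>Direct sums and isomorphic copies of members are special extensions.\<close>

locale extension_closed_class = left_noetherian_ring A for A :: "('a, 'r) ring_scheme" (structure) +
  fixes \<X> :: "'a fgmod set"
  assumes subset_fg: "\<X> \<subseteq> fg_modules A"
    and zero_mem: "\<exists>Z\<in>\<X>. carrier Z = {\<zero>\<^bsub>Z\<^esub>}"
    and extension_closed: "\<lbrakk>short_exact A L i M p N; L \<in> \<X>; N \<in> \<X>; M \<in> fg_modules A\<rbrakk> \<Longrightarrow> M \<in> \<X>"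
begin

abbreviation "cat \<equiv> full_subcategory A \<X>"
abbreviation "conf \<equiv> canonical_conflations A \<X>"

lemma fg: "M \<in> \<X> \<Longrightarrow> M \<in> fg_modules A" using subset_fg by blast
lemma lm: "M \<in> \<X> \<Longrightarrow> left_module A M" using fg fg_modulesD(1) by blast

lemma preadditive: "preadditive_category cat"
proof (rule preadditive_category.intro, goal_cases)
  case (1 X Y)
  then show ?case by (simp add: hom_group_comm_group lm)
next
  case (2 X)
  then show ?case by (simp add: id_hom lm)
next
  case (3 X Y Z f g)
  then show ?case using compose_mod_hom[of A X f Y g Z] by (simp add: lm)
next
  case (4 X Y f)
  then show ?case by (simp add: compose_eq_hom_iff)
next
  case (5 X Y f)
  then show ?case using mod_homD(1)[of f A X Y] by (simp add: compose_eq_hom_iff)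
next
  case (6 W X Y Z f g h)
  then show ?case using mod_homD(1)[of f A W X] by (simp add: compose_eq_compose_iff) (simp add: compose_def)
next
  case (7 X Y Z f f' g)
  then show ?case using mod_homD(1)[of _ A X Y] mod_homD(2)[of g A Y Z]
    by (simp add: compose_eq_restrict_iff) (simp add: compose_def)
next
  case (8 X Y Z f g g')
  then show ?case using mod_homD(1)[of f A X Y]
    by (simp add: compose_eq_restrict_iff) (simp add: compose_def)
qed

lemma zero_module_zero_object:
  assumes Z: "Z \<in> \<X>" "carrier Z = {\<zero>\<^bsub>Z\<^esub>}"
  shows "zero_object cat Z"
  unfolding zero_object_def full_subcategory_simps
proof (intro conjI ballI)
  fix X assume X: "X \<in> \<X>"
  show "\<exists>!f. f \<in> mod_hom A X Z"
  proof (rule ex1I)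
    show "(\<lambda>x\<in>carrier X. \<zero>\<^bsub>Z\<^esub>) \<in> mod_hom A X Z" by (rule zero_hom[OF lm[OF X] lm[OF Z(1)]])
    fix f assume f: "f \<in> mod_hom A X Z"
    show "f = (\<lambda>x\<in>carrier X. \<zero>\<^bsub>Z\<^esub>)"
      by (rule mod_hom_eqI[OF f zero_hom[OF lm[OF X] lm[OF Z(1)]]]) (use mod_homD(1)[OF f] Z(2) in simp)
  qed
  show "\<exists>!f. f \<in> mod_hom A Z X"
  proof (rule ex1I)
    show "(\<lambda>x\<in>carrier Z. \<zero>\<^bsub>X\<^esub>) \<in> mod_hom A Z X" by (rule zero_hom[OF lm[OF Z(1)] lm[OF X]])
    fix f assume f: "f \<in> mod_hom A Z X"
    show "f = (\<lambda>x\<in>carrier Z. \<zero>\<^bsub>X\<^esub>)"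
      by (rule mod_hom_eqI[OF f zero_hom[OF lm[OF Z(1)] lm[OF X]]])
        (use homD(4)[OF f lm[OF Z(1)] lm[OF X]] Z(2) in simp)
  qed
qed (rule Z(1))

lemma direct_sum_biproduct:
  assumes S: "direct_sum A X Y S i j p q" and X: "X \<in> \<X>" and Y: "Y \<in> \<X>"
  shows "S \<in> \<X>" "biproduct cat X Y S i j p q"
proof -
  note D = direct_sumD[OF S]
  note lms = lm[OF X] lm[OF Y] fg_modulesD(1)[OF D(1)]
  note iD = homD[OF D(2) lms(1,3)] and jD = homD[OF D(3) lms(2,3)]
    and pD = homD[OF D(4) lms(3,1)] and qD = homD[OF D(5) lms(3,2)]
  interpret S: left_module A S by (rule lms)
  have "short_exact A X i S q Y"
  proof (rule short_exactI[OF D(2,5) lms(1,3)])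
    fix x assume "x \<in> carrier X" "i x = \<zero>\<^bsub>S\<^esub>"
    then show "x = \<zero>\<^bsub>X\<^esub>" using D(6) pD(4) by metis
  next
    fix s assume s: "s \<in> carrier S" "q s = \<zero>\<^bsub>Y\<^esub>"
    then have "s = i (p s)" using D(10)[OF s(1)] pD(1) iD(1) by (simp add: jD)
    then show "\<exists>x\<in>carrier X. s = i x" using pD(1)[OF s(1)] by blast
  next
    fix y assume "y \<in> carrier Y"
    then show "\<exists>s\<in>carrier S. y = q s" using D(8) jD(1) by metis
  qed (rule D(7))
  then show mem: "S \<in> \<X>" using X Y D(1) by (rule extension_closed)
  show "biproduct cat X Y S i j p q"
    unfolding biproduct_def using D(2-9) mem
    by (simp add: compose_eq_restrict_iff) (simp add: compose_def D(10) cong: restrict_cong)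
qed

lemma additive: "additive_category cat"
proof -
  interpret preadditive_category cat by (rule preadditive)
  show ?thesis
  proof
    show "\<exists>Z. zero_object cat Z" using zero_mem zero_module_zero_object by blast
  next
    fix X Y assume "X \<in> Ob cat" "Y \<in> Ob cat"
    then have XY: "X \<in> \<X>" "Y \<in> \<X>" by simp_all
    obtain S i j p q where "direct_sum A X Y S i j p q" using direct_sum_exists[OF fg fg] XY by blast
    from direct_sum_biproduct(2)[OF this XY] show "\<exists>S i j p q. biproduct cat X Y S i j p q" by blast
  qed
qed

lemma short_exact_is_kernel:
  assumes X: "L \<in> \<X>" "M \<in> \<X>" "N \<in> \<X>" and s: "short_exact A L i M p N"
  shows "is_kernel cat L i M p N"
proof -
  note s' = short_exactD[OF s]
  have "\<exists>!g. g \<in> mod_hom A T L \<and> compose (carrier T) i g = f"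
    if T: "T \<in> \<X>" and f: "f \<in> mod_hom A T M" and pf: "\<forall>x\<in>carrier T. p (f x) = \<zero>\<^bsub>N\<^esub>" for T f
  proof -
    have "f ` carrier T \<subseteq> i ` carrier L"
      unfolding s'(4) a_kernel_def' using mod_homD(1)[OF f] pf by blast
    then obtain g where g: "g \<in> mod_hom A T L" "\<forall>x\<in>carrier T. i (g x) = f x"
      using hom_factors_through_inj[OF lm[OF X(1)] lm[OF X(2)] lm[OF T] s'(1,3) f] by blast
    show ?thesis
      unfolding compose_eq_hom_iff[OF f]
    proof (intro ex1I[of _ g] conjI)
      fix g' assume g': "g' \<in> mod_hom A T L \<and> (\<forall>x\<in>carrier T. i (g' x) = f x)"
      show "g' = g"
      proof (rule mod_hom_eqI[OF conjunct1[OF g'] g(1)])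
        fix x assume x: "x \<in> carrier T"
        then have "i (g' x) = i (g x)" using g' g(2) by simp
        then show "g' x = g x"
          using inj_onD[OF s'(3) _ mod_homD(1)[OF conjunct1[OF g'] x] mod_homD(1)[OF g(1) x]] by blast
      qed
    qed (use g in auto)
  qed
  then show ?thesis
    unfolding is_kernel_def using s'(1,2,6) by (simp add: compose_eq_restrict_iff)
qed

lemma short_exact_is_cokernel:
  assumes X: "L \<in> \<X>" "M \<in> \<X>" "N \<in> \<X>" and s: "short_exact A L i M p N"
  shows "is_cokernel cat L i M p N"
proof -
  note s' = short_exactD[OF s]
  have "\<exists>!g. g \<in> mod_hom A N T \<and> compose (carrier M) g p = f"
    if T: "T \<in> \<X>" and f: "f \<in> mod_hom A M T" and fi: "\<forall>x\<in>carrier L. f (i x) = \<zero>\<^bsub>T\<^esub>" for T f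
  proof -
    have "f x = \<zero>\<^bsub>T\<^esub>" if "x \<in> carrier M" "p x = \<zero>\<^bsub>N\<^esub>" for x
      using s'(7)[OF that] fi by blast
    then obtain g where g: "g \<in> mod_hom A N T" "\<forall>x\<in>carrier M. g (p x) = f x"
      using hom_factors_through_surj[OF lm[OF X(2)] lm[OF X(3)] lm[OF T] s'(2,5) f] by blast
    show ?thesis
      unfolding compose_eq_hom_iff[OF f]
    proof (intro ex1I[of _ g] conjI)
      fix g' assume g': "g' \<in> mod_hom A N T \<and> (\<forall>x\<in>carrier M. g' (p x) = f x)"
      show "g' = g"
      proof (rule mod_hom_eqI[OF conjunct1[OF g'] g(1)])
        fix z assume "z \<in> carrier N"
        then obtain x where "x \<in> carrier M" "z = p x" using s'(8) by blast
        then show "g' z = g z" using g' g(2) by simp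
      qed
    qed (use g in auto)
  qed
  then show ?thesis
    unfolding is_cokernel_def using s'(1,2,6) by (simp add: compose_eq_restrict_iff)
qed

lemma short_exact_iso:
  assumes X: "L \<in> \<X>" "M \<in> \<X>" "N \<in> \<X>" "L' \<in> \<X>" "M' \<in> \<X>" "N' \<in> \<X>"
    and s: "short_exact A L i M p N" and i': "i' \<in> mod_hom A L' M'" and p': "p' \<in> mod_hom A M' N'"
    and iso: "isomorphism cat L L' a" "isomorphism cat M M' b" "isomorphism cat N N' c"
    and comm: "\<forall>x\<in>carrier L. b (i x) = i' (a x)" "\<forall>x\<in>carrier M. c (p x) = p' (b x)"
  shows "short_exact A L' i' M' p' N'"
proof -
  note s' = short_exactD[OF s]
  note L = lm[OF X(1)] and M = lm[OF X(2)] and N = lm[OF X(3)] and L' = lm[OF X(4)] and M' = lm[OF X(5)]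
    and N' = lm[OF X(6)]
  obtain a' where a: "a \<in> mod_hom A L L'" "a' \<in> mod_hom A L' L" "\<forall>x\<in>carrier L'. a (a' x) = x"
    using iso(1) unfolding isomorphism_full_subcategory_iff by blast
  obtain b' where b: "b \<in> mod_hom A M M'" "b' \<in> mod_hom A M' M" "\<forall>x\<in>carrier M. b' (b x) = x"
    "\<forall>x\<in>carrier M'. b (b' x) = x"
    using iso(2) unfolding isomorphism_full_subcategory_iff by blast
  obtain c' where c: "c \<in> mod_hom A N N'" "c' \<in> mod_hom A N' N" "\<forall>x\<in>carrier N. c' (c x) = x"
    "\<forall>x\<in>carrier N'. c (c' x) = x"
    using iso(3) unfolding isomorphism_full_subcategory_iff by blast
  have i'_eq: "i' x = b (i (a' x))" if "x \<in> carrier L'" for x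
    using comm(1) a(3) that mod_homD(1)[OF a(2) that] by simp
  have p'_eq: "p' y = c (p (b' y))" if "y \<in> carrier M'" for y
    using comm(2) b(4) that mod_homD(1)[OF b(2) that] by simp
  show ?thesis
  proof (rule short_exactI[OF i' p' L' M'])
    fix x assume x: "x \<in> carrier L'" "i' x = \<zero>\<^bsub>M'\<^esub>"
    note a'x = mod_homD(1)[OF a(2) x(1)]
    have "i (a' x) = b' (b (i (a' x)))" using b(3) mod_homD(1)[OF s'(1) a'x] by simp
    also have "\<dots> = i \<zero>\<^bsub>L\<^esub>" using x i'_eq homD(4)[OF b(2) M' M] homD(4)[OF s'(1) L M] by simp
    finally have "a' x = \<zero>\<^bsub>L\<^esub>"
      using inj_onD[OF s'(3) _ a'x] left_module_zero_closed[OF L] by blast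
    then show "x = \<zero>\<^bsub>L'\<^esub>" using a(3) x(1) homD(4)[OF a(1) L L'] by metis
  next
    fix x assume x: "x \<in> carrier L'"
    note a'x = mod_homD(1)[OF a(2) x]
    have "p' (i' x) = c (p (i (a' x)))"
      using i'_eq[OF x] comm(2) mod_homD(1)[OF s'(1) a'x] by simp
    then show "p' (i' x) = \<zero>\<^bsub>N'\<^esub>" using s'(6)[OF a'x] homD(4)[OF c(1) N N'] by simp
  next
    fix y assume y: "y \<in> carrier M'" "p' y = \<zero>\<^bsub>N'\<^esub>"
    note b'y = mod_homD(1)[OF b(2) y(1)]
    have "p (b' y) = c' (c (p (b' y)))" using c(3) mod_homD(1)[OF s'(2) b'y] by simp
    also have "\<dots> = \<zero>\<^bsub>N\<^esub>" using y p'_eq[OF y(1)] homD(4)[OF c(2) N' N] by simp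
    finally obtain x where x: "x \<in> carrier L" "b' y = i x" using s'(7)[OF b'y] by blast
    then have "y = i' (a x)" using b(4) y(1) comm(1) by metis
    then show "\<exists>x\<in>carrier L'. y = i' x" using mod_homD(1)[OF a(1) x(1)] by blast
  next
    fix z assume z: "z \<in> carrier N'"
    obtain x where x: "x \<in> carrier M" "c' z = p x" using s'(8)[OF mod_homD(1)[OF c(2) z]] by blast
    then have "z = p' (b x)" using c(4) z comm(2) by metis
    then show "\<exists>y\<in>carrier M'. z = p' y" using mod_homD(1)[OF b(1) x(1)] by blast
  qed
qed

text \<open>The cokernel of a composite is an extension of the two cokernels.\<close>

lemma inflation_compose:
  assumes f: "inflation conf X Y f" and g: "inflation conf Y Z g"
  shows "inflation conf X Z (compose (carrier X) g f)"
proof -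
  obtain p N where X: "X \<in> \<X>" and Y: "Y \<in> \<X>" and N: "N \<in> \<X>" and s: "short_exact A X f Y p N"
    using f unfolding inflation_def by auto
  obtain q P where Z: "Z \<in> \<X>" and P: "P \<in> \<X>" and t: "short_exact A Y g Z q P"
    using g unfolding inflation_def by auto
  note s' = short_exactD[OF s] and t' = short_exactD[OF t]
  let ?h = "compose (carrier X) g f"
  have h: "?h \<in> mod_hom A X Z" by (rule compose_mod_hom[OF lm[OF X] s'(1) t'(1)])
  have hx: "?h x = g (f x)" if "x \<in> carrier X" for x using that by (simp add: compose_def)
  have inj: "inj_on ?h (carrier X)"
  proof (rule inj_onI)
    fix x y assume xy: "x \<in> carrier X" "y \<in> carrier X" "?h x = ?h y"
    then have "g (f x) = g (f y)" using hx by simp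
    then have "f x = f y"
      using inj_onD[OF t'(3)] mod_homD(1)[OF s'(1) xy(1)] mod_homD(1)[OF s'(1) xy(2)] by blast
    then show "x = y" using inj_onD[OF s'(3)] xy by blast
  qed
  obtain Q r where Q: "Q \<in> fg_modules A" and u: "short_exact A X ?h Z r Q"
    using quotient_short_exact[OF fg[OF X] fg[OF Z] h inj] by blast
  note u' = short_exactD[OF u] and Qlm = fg_modulesD(1)[OF Q]
  obtain rg where rg: "rg \<in> mod_hom A Y Q" "\<forall>y\<in>carrier Y. rg y = r (g y)"
    using hom_comp[OF t'(1) u'(2) lm[OF Y]] by blast
  have "rg y = \<zero>\<^bsub>Q\<^esub>" if y: "y \<in> carrier Y" "p y = \<zero>\<^bsub>N\<^esub>" for y
  proof -
    obtain x where x: "x \<in> carrier X" "y = f x" using s'(7)[OF y] by blast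
    then show ?thesis using rg(2) y(1) u'(6)[OF x(1)] hx by simp
  qed
  then obtain \<alpha> where \<alpha>: "\<alpha> \<in> mod_hom A N Q" "\<forall>y\<in>carrier Y. \<alpha> (p y) = rg y"
    using hom_factors_through_surj[OF lm[OF Y] lm[OF N] Qlm s'(2,5) rg(1)] by blast
  have "q z = \<zero>\<^bsub>P\<^esub>" if z: "z \<in> carrier Z" "r z = \<zero>\<^bsub>Q\<^esub>" for z
  proof -
    obtain x where "x \<in> carrier X" "z = ?h x" using u'(7)[OF z] by blast
    then show ?thesis using hx t'(6) mod_homD(1)[OF s'(1)] by simp
  qed
  then obtain \<beta> where \<beta>: "\<beta> \<in> mod_hom A Q P" "\<forall>z\<in>carrier Z. \<beta> (r z) = q z"
    using hom_factors_through_surj[OF lm[OF Z] Qlm lm[OF P] u'(2,5) t'(2)] by blast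
  have gY: "g y \<in> carrier Z" if "y \<in> carrier Y" for y by (rule mod_homD(1)[OF t'(1) that])
  have \<alpha>p: "\<alpha> (p y) = r (g y)" if "y \<in> carrier Y" for y using \<alpha>(2) rg(2) that by simp
  have "short_exact A N \<alpha> Q \<beta> P"
  proof (rule short_exactI[OF \<alpha>(1) \<beta>(1) lm[OF N] Qlm])
    fix n assume n: "n \<in> carrier N" "\<alpha> n = \<zero>\<^bsub>Q\<^esub>"
    obtain y where y: "y \<in> carrier Y" "n = p y" using s'(8)[OF n(1)] by blast
    then have "r (g y) = \<zero>\<^bsub>Q\<^esub>" using n(2) \<alpha>p by simp
    then obtain x where x: "x \<in> carrier X" "g y = g (f x)" using u'(7)[OF gY[OF y(1)]] hx by auto
    then have "y = f x" using inj_onD[OF t'(3) x(2) y(1) mod_homD(1)[OF s'(1) x(1)]] by blast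
    then show "n = \<zero>\<^bsub>N\<^esub>" using y(2) s'(6)[OF x(1)] by simp
  next
    fix n assume n: "n \<in> carrier N"
    obtain y where y: "y \<in> carrier Y" "n = p y" using s'(8)[OF n] by blast
    then show "\<beta> (\<alpha> n) = \<zero>\<^bsub>P\<^esub>" using \<alpha>p \<beta>(2) gY t'(6) by simp
  next
    fix w assume w: "w \<in> carrier Q" "\<beta> w = \<zero>\<^bsub>P\<^esub>"
    obtain z where z: "z \<in> carrier Z" "w = r z" using u'(8)[OF w(1)] by blast
    then have "q z = \<zero>\<^bsub>P\<^esub>" using w(2) \<beta>(2) by simp
    then obtain y where y: "y \<in> carrier Y" "z = g y" using t'(7)[OF z(1)] by blast
    then show "\<exists>n\<in>carrier N. w = \<alpha> n" using z(2) \<alpha>p mod_homD(1)[OF s'(2) y(1)] by metis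
  next
    fix v assume "v \<in> carrier P"
    then obtain z where "z \<in> carrier Z" "v = q z" using t'(8) by blast
    then show "\<exists>w\<in>carrier Q. v = \<beta> w" using \<beta>(2) mod_homD(1)[OF u'(2)] by metis
  qed
  then have "Q \<in> \<X>" using N P Q by (rule extension_closed)
  then show ?thesis using u X Z unfolding inflation_def by auto
qed

lemma deflation_compose:
  assumes f: "deflation conf X Y f" and g: "deflation conf Y Z g"
  shows "deflation conf X Z (compose (carrier X) g f)"
proof -
  obtain k L where X: "X \<in> \<X>" and Y: "Y \<in> \<X>" and L: "L \<in> \<X>" and s: "short_exact A L k X f Y"
    using f unfolding deflation_def by auto
  obtain l P where Z: "Z \<in> \<X>" and P: "P \<in> \<X>" and t: "short_exact A P l Y g Z"
    using g unfolding deflation_def by auto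
  note s' = short_exactD[OF s] and t' = short_exactD[OF t]
  let ?h = "compose (carrier X) g f"
  have h: "?h \<in> mod_hom A X Z" by (rule compose_mod_hom[OF lm[OF X] s'(2) t'(2)])
  have hx: "?h x = g (f x)" if "x \<in> carrier X" for x using that by (simp add: compose_def)
  have "?h ` carrier X = g ` (f ` carrier X)" using hx by (simp add: image_image)
  then have surj: "?h ` carrier X = carrier Z" using s'(5) t'(5) by simp
  define N where "N = a_kernel X Z ?h"
  have N: "N = {x \<in> carrier X. g (f x) = \<zero>\<^bsub>Z\<^esub>}"
    unfolding N_def a_kernel_def' using hx by (simp cong: conj_cong)
  have K: "X\<lparr>carrier := N\<rparr> \<in> fg_modules A" unfolding N_def by (rule kernel_fg[OF fg[OF X] fg[OF Z] h])
  have u: "short_exact A (X\<lparr>carrier := N\<rparr>) (\<lambda>x\<in>N. x) X ?h Z"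
    unfolding N_def by (rule kernel_short_exact[OF lm[OF X] lm[OF Z] h surj])
  obtain f' where "short_exact A L k (X\<lparr>carrier := N\<rparr>) f' P"
    using kernel_of_composite_short_exact(2)[OF lm[OF L] lm[OF X] lm[OF Y] lm[OF P] lm[OF Z] s t]
    unfolding N by blast
  then have "X\<lparr>carrier := N\<rparr> \<in> \<X>" using L P K by (rule extension_closed)
  then show ?thesis using u X Z unfolding deflation_def by auto
qed

text \<open>The pushout is the cokernel of \<open>X \<rightarrow> Y \<oplus> X'\<close>, and has the same cokernel \<open>N\<close> over \<open>X'\<close> as \<open>Y\<close> over \<open>X\<close>.\<close>

lemma inflation_pushout_exists:
  assumes i: "inflation conf X Y i" and X': "X' \<in> \<X>" and f: "f \<in> mod_hom A X X'"
  shows "\<exists>Y' f' i'. pushout cat X Y X' Y' i f f' i' \<and> inflation conf X' Y' i'"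
proof -
  obtain p N where X: "X \<in> \<X>" and Y: "Y \<in> \<X>" and N: "N \<in> \<X>" and s: "short_exact A X i Y p N"
    using i unfolding inflation_def by auto
  note s' = short_exactD[OF s]
  obtain S j1 j2 q1 q2 where S: "direct_sum A Y X' S j1 j2 q1 q2" using direct_sum_exists[OF fg[OF Y] fg[OF X']] by blast
  note D = direct_sumD[OF S]
  note Slm = fg_modulesD(1)[OF D(1)]
  interpret S: left_module A S by (rule Slm)
  interpret Y: left_module A Y by (rule lm[OF Y])
  interpret X': left_module A X' by (rule lm[OF X'])
  interpret X: left_module A X by (rule lm[OF X])
  interpret N: left_module A N by (rule lm[OF N])
  note iD = homD[OF s'(1) lm[OF X] lm[OF Y]] and pD = homD[OF s'(2) lm[OF Y] lm[OF N]]
    and fD = homD[OF f lm[OF X] lm[OF X']] and j1D = homD[OF D(2) lm[OF Y] Slm] and j2D = homD[OF D(3) lm[OF X'] Slm]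
    and q1D = homD[OF D(4) Slm lm[OF Y]] and q2D = homD[OF D(5) Slm lm[OF X']]
  obtain h where h: "h \<in> mod_hom A X S" and h_eq': "\<forall>x\<in>carrier X. h x = j1 (i x) \<oplus>\<^bsub>S\<^esub> j2 ((\<lambda>x\<in>carrier X. \<ominus>\<^bsub>X'\<^esub> f x) x)
      \<and> q1 (h x) = i x \<and> q2 (h x) = (\<lambda>x\<in>carrier X. \<ominus>\<^bsub>X'\<^esub> f x) x"
    using direct_sum_in[OF S lm[OF Y] lm[OF X'] lm[OF X] s'(1) minus_hom[OF lm[OF X] lm[OF X'] f]] by blast
  have h_eq: "h x = j1 (i x) \<ominus>\<^bsub>S\<^esub> j2 (f x)" "q1 (h x) = i x" if "x \<in> carrier X" for x
    using bspec[OF h_eq' that] that by (simp add: j2D fD a_minus_def, blast)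
  note hD = homD[OF h lm[OF X] Slm]
  have i_zero: "x = \<zero>\<^bsub>X\<^esub>" if "x \<in> carrier X" "i x = \<zero>\<^bsub>Y\<^esub>" for x
    using inj_onD[OF s'(3) _ that(1) X.M.zero_closed] that(2) iD(4) by simp
  interpret h: module_hom A X S h by (rule module_homI[OF lm[OF X] Slm h])
  have "inj_on h (carrier X)" unfolding h.inj_iff
  proof (intro ballI impI)
    fix x assume x: "x \<in> carrier X" "h x = \<zero>\<^bsub>S\<^esub>"
    then have "i x = \<zero>\<^bsub>Y\<^esub>" using h_eq(2)[OF x(1)] by (simp add: q1D)
    then show "x = \<zero>\<^bsub>X\<^esub>" by (rule i_zero[OF x(1)])
  qed
  then obtain Y' r where Y': "Y' \<in> fg_modules A" and t: "short_exact A X h S r Y'"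
    using quotient_short_exact[OF fg[OF X] D(1) h] by blast
  note t' = short_exactD[OF t] and Y'lm = fg_modulesD(1)[OF Y']
  interpret Y': left_module A Y' by (rule Y'lm)
  note rD = homD[OF t'(2) Slm Y'lm]
  obtain f' where f': "f' \<in> mod_hom A Y Y'" "\<forall>y\<in>carrier Y. f' y = r (j1 y)"
    using hom_comp[OF D(2) t'(2) lm[OF Y]] by blast
  obtain i' where i': "i' \<in> mod_hom A X' Y'" "\<forall>x\<in>carrier X'. i' x = r (j2 x)"
    using hom_comp[OF D(3) t'(2) lm[OF X']] by blast
  obtain pq where pq: "pq \<in> mod_hom A S N" "\<forall>u\<in>carrier S. pq u = p (q1 u)"
    using hom_comp[OF D(4) s'(2) Slm] by blast
  have "pq u = \<zero>\<^bsub>N\<^esub>" if u: "u \<in> carrier S" "r u = \<zero>\<^bsub>Y'\<^esub>" for u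
  proof -
    obtain x where "x \<in> carrier X" "u = h x" using t'(7)[OF u] by blast
    then show ?thesis using pq(2) u(1) h_eq(2) s'(6) by simp
  qed
  then obtain p' where p': "p' \<in> mod_hom A Y' N" "\<forall>u\<in>carrier S. p' (r u) = pq u"
    using hom_factors_through_surj[OF Slm Y'lm lm[OF N] t'(2,5) pq(1)] by blast
  have p'r: "p' (r u) = p (q1 u)" if "u \<in> carrier S" for u using p'(2) pq(2) that by simp
  have s2: "short_exact A X' i' Y' p' N"
  proof (rule short_exactI[OF i'(1) p'(1) lm[OF X'] Y'lm])
    fix x' assume x': "x' \<in> carrier X'" "i' x' = \<zero>\<^bsub>Y'\<^esub>"
    then have "r (j2 x') = \<zero>\<^bsub>Y'\<^esub>" using i'(2) by simp
    then obtain x where x: "x \<in> carrier X" "j2 x' = h x" using t'(7)[OF j2D(1)[OF x'(1)]] by blast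
    then have "i x = \<zero>\<^bsub>Y\<^esub>" using h_eq(2)[OF x(1)] D(9)[OF x'(1)] by simp
    then have "j2 x' = \<zero>\<^bsub>S\<^esub>" using i_zero[OF x(1)] x(2) by (simp add: hD)
    then show "x' = \<zero>\<^bsub>X'\<^esub>" using D(8)[OF x'(1)] by (simp add: q2D)
  next
    fix x' assume "x' \<in> carrier X'"
    then show "p' (i' x') = \<zero>\<^bsub>N\<^esub>" using i'(2) by (simp add: p'r j2D D(9) pD)
  next
    fix y assume y: "y \<in> carrier Y'" "p' y = \<zero>\<^bsub>N\<^esub>"
    obtain u where u: "u \<in> carrier S" "y = r u" using t'(8)[OF y(1)] by blast
    then have "p (q1 u) = \<zero>\<^bsub>N\<^esub>" using y(2) p'r by simp
    then obtain x where x: "x \<in> carrier X" "q1 u = i x" using s'(7)[OF q1D(1)[OF u(1)]] by blast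
    define v where "v = u \<ominus>\<^bsub>S\<^esub> h x"
    have v: "v \<in> carrier S" unfolding v_def using u x hD(1) by simp
    have "q1 v = \<zero>\<^bsub>Y\<^esub>" unfolding v_def using u x hD(1) h_eq(2) by (simp add: q1D iD)
    then have "v = j2 (q2 v)" using D(10)[OF v] v by (simp add: j1D j2D q2D)
    moreover have "r v = y" unfolding v_def using u x hD(1) t'(6)[OF x(1)] by (simp add: rD)
    ultimately have "y = i' (q2 v)" using i'(2) q2D(1)[OF v] by simp
    then show "\<exists>x\<in>carrier X'. y = i' x" using q2D(1)[OF v] by blast
  next
    fix n assume "n \<in> carrier N"
    then obtain y where y: "y \<in> carrier Y" "n = p y" using s'(8) by blast
    then have "n = p' (r (j1 y))" by (simp add: p'r j1D D(6))
    then show "\<exists>y\<in>carrier Y'. n = p' y" using rD(1)[OF j1D(1)[OF y(1)]] by blast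
  qed
  then have Y'X: "Y' \<in> \<X>" using X' N Y' by (rule extension_closed)
  have comm: "f' (i x) = i' (f x)" if x: "x \<in> carrier X" for x
  proof -
    have "r (j1 (i x)) \<ominus>\<^bsub>Y'\<^esub> r (j2 (f x)) = \<zero>\<^bsub>Y'\<^esub>"
      using t'(6)[OF x] x by (simp add: h_eq(1) rD j1D j2D iD fD)
    then show ?thesis using x f'(2) i'(2) by (simp add: rD j1D j2D iD fD)
  qed
  have univ: "\<exists>!w. w \<in> mod_hom A Y' T \<and> compose (carrier Y) w f' = u \<and> compose (carrier X') w i' = v"
    if T: "T \<in> \<X>" and u: "u \<in> mod_hom A Y T" and v: "v \<in> mod_hom A X' T"
      and uv: "\<forall>x\<in>carrier X. u (i x) = v (f x)" for T u v
  proof -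
    interpret T: left_module A T by (rule lm[OF T])
    note uD = homD[OF u lm[OF Y] lm[OF T]] and vD = homD[OF v lm[OF X'] lm[OF T]]
    obtain w0 where w0: "w0 \<in> mod_hom A S T" "\<forall>y\<in>carrier Y. w0 (j1 y) = u y" "\<forall>x\<in>carrier X'. w0 (j2 x) = v x"
      using direct_sum_out[OF S lm[OF Y] lm[OF X'] lm[OF T] u v] by blast
    note w0D = homD[OF w0(1) Slm lm[OF T]]
    have "w0 c = \<zero>\<^bsub>T\<^esub>" if c: "c \<in> carrier S" "r c = \<zero>\<^bsub>Y'\<^esub>" for c
    proof -
      obtain x where x: "x \<in> carrier X" "c = h x" using t'(7)[OF c] by blast
      then show ?thesis using uv w0(2,3) by (simp add: h_eq(1) w0D j1D j2D iD fD vD)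
    qed
    then obtain w where w: "w \<in> mod_hom A Y' T" "\<forall>c\<in>carrier S. w (r c) = w0 c"
      using hom_factors_through_surj[OF Slm Y'lm lm[OF T] t'(2,5) w0(1)] by blast
    have wf: "\<forall>y\<in>carrier Y. w (f' y) = u y" "\<forall>x\<in>carrier X'. w (i' x) = v x"
      using w(2) w0(2,3) f'(2) i'(2) by (simp_all add: j1D j2D)
    show ?thesis
      unfolding compose_eq_hom_iff[OF u] compose_eq_hom_iff[OF v]
    proof (intro ex1I[of _ w] conjI)
      fix w' assume w': "w' \<in> mod_hom A Y' T \<and> (\<forall>y\<in>carrier Y. w' (f' y) = u y) \<and> (\<forall>x\<in>carrier X'. w' (i' x) = v x)"
      note wD = homD[OF w(1) Y'lm lm[OF T]] and w'D = homD[OF conjunct1[OF w'] Y'lm lm[OF T]]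
      show "w' = w"
      proof (rule mod_hom_eqI[OF conjunct1[OF w'] w(1)])
        fix y assume "y \<in> carrier Y'"
        then obtain c where c: "c \<in> carrier S" "y = r c" using t'(8) by blast
        have "r (j1 (q1 c) \<oplus>\<^bsub>S\<^esub> j2 (q2 c)) = f' (q1 c) \<oplus>\<^bsub>Y'\<^esub> i' (q2 c)"
          using c(1) f'(2) i'(2) by (simp add: rD j1D j2D q1D q2D)
        then have y: "y = f' (q1 c) \<oplus>\<^bsub>Y'\<^esub> i' (q2 c)" using c D(10) by simp
        show "w' y = w y"
          unfolding y using c(1) wf w' mod_homD(1)[OF f'(1)] mod_homD(1)[OF i'(1)]
          by (simp add: wD w'D q1D q2D)
      qed
    qed (use w(1) wf in auto)
  qed
  have "pushout cat X Y X' Y' i f f' i'"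
    unfolding pushout_def using Y'X f'(1) i'(1) comm univ by (simp add: compose_eq_compose_iff)
  moreover have "inflation conf X' Y' i'" unfolding inflation_def using s2 X' Y'X N by auto
  ultimately show ?thesis by blast
qed

lemma deflation_pullback_exists:
  assumes p': "deflation conf X' Y' p'" and Y: "Y \<in> \<X>" and g: "g \<in> mod_hom A Y Y'"
  shows "\<exists>X p g'. pullback cat X Y X' Y' p g' g p' \<and> deflation conf X Y p"
proof -
  obtain k K where X': "X' \<in> \<X>" and Y': "Y' \<in> \<X>" and K: "K \<in> \<X>" and s: "short_exact A K k X' p' Y'"
    using p' unfolding deflation_def by auto
  note s' = short_exactD[OF s]
  obtain X p g' where X: "X \<in> fg_modules A" and pb: "elementwise_pullback A X p g' Y g X' p' Y'"
    using pullback_exists[OF fg[OF Y] fg[OF X'] fg[OF Y'] g s'(2)] by blast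
  note Xlm = fg_modulesD(1)[OF X]
  obtain k' where k': "short_exact A K k' X p Y"
    using elementwise_pullback_short_exact[OF pb s Xlm lm[OF Y] lm[OF X'] lm[OF Y'] lm[OF K] g] by blast
  then have XX: "X \<in> \<X>" using K Y X by (rule extension_closed)
  have p: "p \<in> mod_hom A X Y" and g': "g' \<in> mod_hom A X X'" and comm: "\<forall>x\<in>carrier X. g (p x) = p' (g' x)"
    and zero: "\<And>x. \<lbrakk>x \<in> carrier X; p x = \<zero>\<^bsub>Y\<^esub>; g' x = \<zero>\<^bsub>X'\<^esub>\<rbrakk> \<Longrightarrow> x = \<zero>\<^bsub>X\<^esub>"
    using pb unfolding elementwise_pullback_def by blast+
  interpret X: left_module A X by (rule Xlm)
  note pD = homD[OF p Xlm lm[OF Y]] and g'D = homD[OF g' Xlm lm[OF X']]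
  have uniq: "x = y" if xy: "x \<in> carrier X" "y \<in> carrier X" "p x = p y" "g' x = g' y" for x y
  proof -
    have "p (x \<ominus>\<^bsub>X\<^esub> y) = \<zero>\<^bsub>Y\<^esub>" "g' (x \<ominus>\<^bsub>X\<^esub> y) = \<zero>\<^bsub>X'\<^esub>"
      using xy pD(1) g'D(1) left_module.diff_self[OF lm[OF Y]] left_module.diff_self[OF lm[OF X']]
      by (simp_all add: pD(6) g'D(6))
    then have "x \<ominus>\<^bsub>X\<^esub> y = \<zero>\<^bsub>X\<^esub>" using xy by (intro zero) simp_all
    then show ?thesis using xy by simp
  qed
  have univ: "\<exists>!w. w \<in> mod_hom A T X \<and> compose (carrier T) p w = u \<and> compose (carrier T) g' w = v"
    if T: "T \<in> \<X>" and u: "u \<in> mod_hom A T Y" and v: "v \<in> mod_hom A T X'"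
      and uv: "\<forall>t\<in>carrier T. g (u t) = p' (v t)" for T u v
  proof -
    obtain w where w: "w \<in> mod_hom A T X" "\<forall>t\<in>carrier T. p (w t) = u t \<and> g' (w t) = v t"
      using elementwise_pullback_universal[OF pb Xlm lm[OF Y] lm[OF X'] lm[OF T] u v] uv by blast
    show ?thesis
      unfolding compose_eq_hom_iff[OF u] compose_eq_hom_iff[OF v]
    proof (intro ex1I[of _ w] conjI)
      fix w' assume w': "w' \<in> mod_hom A T X \<and> (\<forall>t\<in>carrier T. p (w' t) = u t) \<and> (\<forall>t\<in>carrier T. g' (w' t) = v t)"
      show "w' = w"
        by (rule mod_hom_eqI[OF conjunct1[OF w'] w(1)], rule uniq)
          (use w w' mod_homD(1) in \<open>auto intro: mod_homD(1)\<close>)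
    qed (use w in auto)
  qed
  have "pullback cat X Y X' Y' p g' g p'"
    unfolding pullback_def using XX p g' comm univ by (simp add: compose_eq_compose_iff)
  moreover have "deflation conf X Y p" unfolding deflation_def using k' K XX Y by auto
  ultimately show ?thesis by blast
qed

lemma exact: "exact_category cat conf"
proof -
  interpret additive_category cat by (rule additive)
  obtain Z where Z: "Z \<in> \<X>" "carrier Z = {\<zero>\<^bsub>Z\<^esub>}" using zero_mem by blast
  show ?thesis
  proof (unfold_locales, goal_cases)
    case (1 L i M p N)
    then show ?case using short_exact_is_kernel short_exact_is_cokernel by simp
  next
    case (2 L i M p N L' M' N' i' p' a b c)
    then show ?case
      using short_exact_iso[of L M N L' M' N' i p i' p' a b c] by (simp add: compose_eq_compose_iff)
  next
    case (3 X)
    then show ?case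
      using short_exact_id_zero(1)[OF fg fg Z(2), of X] Z(1) unfolding inflation_def by auto
  next
    case (4 X)
    then show ?case
      using short_exact_id_zero(2)[OF fg fg Z(2), of X] Z(1) unfolding deflation_def by auto
  next
    case (5 X Y f Z g)
    then show ?case using inflation_compose by simp
  next
    case (6 X Y f Z g)
    then show ?case using deflation_compose by simp
  next
    case (7 X Y i X' f)
    then show ?case using inflation_pushout_exists by simp
  next
    case (8 X' Y' p' Y g)
    then show ?case using deflation_pullback_exists by simp
  qed
qed

end

section \<open>Complete resolutions and the Frobenius property\<close>

lemma int_indexed_chain:
  assumes "\<And>x. x \<in> X \<Longrightarrow> \<exists>y\<in>X. R x y" "\<And>y. y \<in> X \<Longrightarrow> \<exists>x\<in>X. R x y" "m \<in> X"
  shows "\<exists>W :: int \<Rightarrow> 'w. W 0 = m \<and> (\<forall>i. W i \<in> X \<and> R (W i) (W (i + 1)))"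
proof -
  obtain f where f: "\<And>x. x \<in> X \<Longrightarrow> f x \<in> X \<and> R x (f x)" using assms(1) by metis
  obtain g where g: "\<And>y. y \<in> X \<Longrightarrow> g y \<in> X \<and> R (g y) y" using assms(2) by metis
  have fX: "(f ^^ n) m \<in> X" for n by (induction n) (use assms(3) f in auto)
  have gX: "(g ^^ n) m \<in> X" for n by (induction n) (use assms(3) g in auto)
  define W where "W i = (if i \<ge> 0 then (f ^^ nat i) m else (g ^^ nat (- i)) m)" for i :: int
  have "R (W i) (W (i + 1))" for i
  proof (cases "i \<ge> 0")
    case True
    then have "nat (i + 1) = Suc (nat i)" by simp
    then show ?thesis using True f[OF fX] by (simp add: W_def)
  next
    case False
    then have *: "nat (- i) = Suc (nat (- (i + 1)))" by simp
    have "W (i + 1) = (g ^^ nat (- (i + 1))) m"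
      using False by (cases "i = -1") (simp_all add: W_def)
    then show ?thesis using False g[OF gX] by (simp add: W_def *)
  qed
  moreover have "W i \<in> X" for i using fX gX by (simp add: W_def)
  ultimately show ?thesis by (intro exI[of _ W]) (simp add: W_def)
qed

context left_noetherian_ring
begin

lemma extension_closed_perp: "extension_closed_class A (semi_gorenstein_projective A)"
proof
  show "semi_gorenstein_projective A \<subseteq> fg_modules A" by (auto simp: semi_gorenstein_projective_def)
  obtain F where F: "F \<in> fg_modules A" using regular_module_copy[OF ring_axioms] by blast
  show "\<exists>Z\<in>semi_gorenstein_projective A. carrier Z = {\<zero>\<^bsub>Z\<^esub>}"
  proof -
    obtain Z where Z: "Z \<in> fg_modules A" "carrier Z = {\<zero>\<^bsub>Z\<^esub>}" using zero_module_exists[OF F] by blast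
    then show ?thesis
      using projective_perp[OF projective_zero[OF Z]] semi_gorenstein_projective_iff_perp by blast
  qed
next
  fix L i M p N
  assume "short_exact A L i M p N" "L \<in> semi_gorenstein_projective A" "N \<in> semi_gorenstein_projective A"
    "M \<in> fg_modules A"
  then show "M \<in> semi_gorenstein_projective A"
    unfolding semi_gorenstein_projective_iff_perp by (rule perp_extension)
qed

abbreviation "sgp_cat \<equiv> full_subcategory A (semi_gorenstein_projective A)"
abbreviation "sgp_conf \<equiv> canonical_conflations A (semi_gorenstein_projective A)"

lemma projective_module_imp_projective_object:
  assumes P: "projective_module A P"
  shows "projective_object sgp_cat sgp_conf P"
  unfolding projective_object_def
proof (intro conjI allI impI ballI)
  show "P \<in> Ob sgp_cat" using projective_perp[OF P] by (simp add: semi_gorenstein_projective_iff_perp)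
  fix M N p f assume "deflation sgp_conf M N p" and f: "f \<in> Mor sgp_cat P N"
  then obtain L i where M: "perp A M" and N: "perp A N" and s: "short_exact A L i M p N"
    unfolding deflation_def by (auto simp: semi_gorenstein_projective_iff_perp)
  have f': "f \<in> mod_hom A P N" using f by simp
  note s' = short_exactD[OF s]
  show "\<exists>g\<in>Mor sgp_cat P M. Cmp sgp_cat P M N p g = f"
    using projective_lift[OF P perp_fg[OF M] perp_fg[OF N] s'(2,5) f'] by (simp add: compose_eq_hom_iff[OF f'])
qed

text \<open>A presentation by a projective module is a deflation of the category, hence splits over a
  projective object.\<close>

lemma projective_object_imp_projective_module:
  assumes X: "projective_object sgp_cat sgp_conf X"
  shows "projective_module A X"
proof -
  have XX: "perp A X"
    using X unfolding projective_object_def by (simp add: semi_gorenstein_projective_iff_perp)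
  obtain P K i p where P: "projective_module A P" and K: "perp A K" and s: "short_exact A K i P p X"
    using perp_presentation[OF XX] by blast
  have defl: "deflation sgp_conf P X p"
    unfolding deflation_def using projective_perp[OF P] K XX s by (auto simp: semi_gorenstein_projective_iff_perp)
  have id: "(\<lambda>x\<in>carrier X. x) \<in> Mor sgp_cat X X" using id_hom[OF fg_modulesD(1)[OF perp_fg[OF XX]]] by simp
  from X defl id obtain g where "g \<in> Mor sgp_cat X P" "Cmp sgp_cat X P X p g = (\<lambda>x\<in>carrier X. x)"
    unfolding projective_object_def by blast
  then have g: "g \<in> mod_hom A X P" "\<forall>x\<in>carrier X. p (g x) = x" by (simp_all add: compose_eq_restrict_iff)
  show ?thesis
    by (rule projective_retract[OF perp_fg[OF XX] P g(1) short_exactD(2)[OF s]]) (simp add: g(2))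
qed

text \<open>A module in the category has no extensions by \<open>A\<close>, hence none by a projective module.\<close>

lemma projective_module_imp_injective_object:
  assumes P: "projective_module A P"
  shows "injective_object sgp_cat sgp_conf P"
  unfolding injective_object_def
proof (intro conjI allI impI ballI)
  show "P \<in> Ob sgp_cat" using projective_perp[OF P] by (simp add: semi_gorenstein_projective_iff_perp)
  fix L M i f assume "inflation sgp_conf L M i" and f: "f \<in> Mor sgp_cat L P"
  then obtain N p where L: "perp A L" and M: "perp A M" and N: "perp A N" and s: "short_exact A L i M p N"
    unfolding inflation_def by (auto simp: semi_gorenstein_projective_iff_perp)
  have f': "f \<in> mod_hom A L P" using f by simp
  have "hom_extends A L i M (regular_module A)"
    by (rule perp_hom_extends[OF ring_axioms N perp_fg[OF L] perp_fg[OF M] s])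
  then have "hom_extends A L i M P"
    using projective_inherits_extension[OF ring_axioms P] perp_fg[OF L] perp_fg[OF M] short_exactD(1)[OF s]
    unfolding inherits_extension_def by blast
  from hom_extendsD[OF this f'] show "\<exists>g\<in>Mor sgp_cat M P. Cmp sgp_cat L M P g i = f"
    by (simp add: compose_eq_hom_iff[OF f'])
qed

text \<open>Exactness of \<open>Hom(P,A)\<close> says exactly that homomorphisms to \<open>A\<close> extend from each image to the next term;
  the images to the left of it provide the syzygies.\<close>

lemma complete_resolution_images:
  assumes res: "complete_projective_resolution A P d"
  defines "W \<equiv> \<lambda>i. (P (i + 1))\<lparr>carrier := d i ` carrier (P i)\<rparr>"
  shows "short_exact A (W i) (\<lambda>x\<in>d i ` carrier (P i). x) (P (i + 1)) (d (i + 1)) (W (i + 1))" "perp A (W i)"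
proof -
  let ?A = "regular_module A"
  note reg = regular_module_left_module[OF ring_axioms]
  note res' = res[unfolded complete_projective_resolution_def]
  note proj = spec[OF conjunct1[OF res']] and d = spec[OF conjunct1[OF conjunct2[OF res']]]
    and ex = spec[OF conjunct1[OF conjunct2[OF conjunct2[OF res']]]]
    and hom_ex = spec[OF conjunct2[OF conjunct2[OF conjunct2[OF res']]]]
  note P = projective_module_fg[OF proj]
  note lm = P[THEN fg_modulesD(1)]
  have im: "submod A (P (i + 1)) (d i ` carrier (P i))" for i
    by (intro module_hom.submod_image[OF module_homI[OF lm lm d]] left_module.submod_carrier lm)
  have W: "W i \<in> fg_modules A" for i unfolding W_def by (rule submodule_fg[OF P im])
  have ses: "short_exact A (W i) (\<lambda>x\<in>d i ` carrier (P i). x) (P (i + 1)) (d (i + 1)) (W (i + 1))" for i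
  proof -
    have dW: "d (i + 1) \<in> mod_hom A (P (i + 1)) (W (i + 1))"
      unfolding W_def by (rule corestrict_hom[OF d]) simp
    have "a_kernel (P (i + 1)) (W (i + 1)) (d (i + 1)) = d i ` carrier (P i)"
      unfolding ex[of i] a_kernel_def' by (simp add: W_def add.commute)
    moreover have "d (i + 1) ` carrier (P (i + 1)) = carrier (W (i + 1))" by (simp add: W_def)
    ultimately show ?thesis
      using kernel_short_exact[OF lm fg_modulesD(1)[OF W] dW] unfolding W_def by simp
  qed
  then show "short_exact A (W i) (\<lambda>x\<in>d i ` carrier (P i). x) (P (i + 1)) (d (i + 1)) (W (i + 1))" .
  have ext: "hom_extends A (W i) (\<lambda>x\<in>d i ` carrier (P i). x) (P (i + 1)) ?A" for i
  proof -
    have e: "i - 1 + 1 = i" "i - 1 + 2 = i + 1" by simp_all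
    have "kernel (hom_group A (P i) ?A) (hom_group A (P (i - 1)) ?A) (precomp (P (i - 1)) (d (i - 1)))
        \<subseteq> precomp (P i) (d i) ` mod_hom A (P (i + 1)) ?A"
      using hom_ex[of "i - 1"] unfolding e by (rule equalityD2)
    moreover have "d (i - 1) ` carrier (P (i - 1)) = a_kernel (P i) (P (i + 1)) (d i)"
      using ex[of "i - 1"] unfolding e .
    moreover have "d (i - 1) \<in> mod_hom A (P (i - 1)) (P i)" using d[of "i - 1"] unfolding e .
    ultimately show ?thesis
      unfolding W_def using cocycles_le_coboundaries_iff[OF lm lm lm reg _ d im] by blast
  qed
  have "perp A N" if "\<exists>i. N = W i" for N
    using that
  proof (coinduction arbitrary: N)
    case (perp N)
    then obtain i where N: "N = W (i + 1)" by (metis diff_add_cancel)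
    show ?case using W[of "i + 1"] proj[of "i + 1"] ses[of i] ext[of i] unfolding N by blast
  qed
  then show "perp A (W i)" by blast
qed

lemma gorenstein_projective_embeds:
  assumes M: "gorenstein_projective A M"
  shows "\<exists>i P p N. projective_module A P \<and> perp A N \<and> short_exact A M i P p N"
proof -
  obtain P d where res: "complete_projective_resolution A P d"
    and iso: "mod_iso A M ((P 1)\<lparr>carrier := d 0 ` carrier (P 0)\<rparr>)"
    using M unfolding gorenstein_projective_def by blast
  note proj = spec[OF conjunct1[OF res[unfolded complete_projective_resolution_def]], of 1]
  let ?W = "(P 1)\<lparr>carrier := d 0 ` carrier (P 0)\<rparr>" and ?N = "(P 2)\<lparr>carrier := d 1 ` carrier (P 1)\<rparr>"
  have s: "short_exact A ?W (\<lambda>x\<in>d 0 ` carrier (P 0). x) (P 1) (d 1) ?N" and N: "perp A ?N"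
    using complete_resolution_images[OF res, of 0] complete_resolution_images(2)[OF res, of 1] by simp_all
  note s' = short_exactD[OF s]
  obtain \<phi> where \<phi>: "\<phi> \<in> mod_hom A M ?W" "bij_betw \<phi> (carrier M) (carrier ?W)"
    using iso unfolding mod_iso_def by blast
  have im: "d 0 ` carrier (P 0) = a_kernel (P 1) ?N (d 1)"
    using s'(4) by (simp add: image_restrict_eq)
  then have "\<phi> \<in> mod_hom A M (P 1)" by (intro sub_hom_hom[OF \<phi>(1)]) (auto simp: a_kernel_def')
  moreover have "inj_on \<phi> (carrier M)" "\<phi> ` carrier M = a_kernel (P 1) ?N (d 1)"
    using \<phi>(2) im unfolding bij_betw_def by simp_all
  ultimately have "short_exact A M \<phi> (P 1) (d 1) ?N" unfolding short_exact_def using s'(2,5) by simp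
  then show ?thesis using proj N by blast
qed

text \<open>Splicing short exact sequences. The spliced complex stays exact under \<open>Hom(-,A)\<close> because the
  first extension group by \<open>A\<close> vanishes on all the modules \<open>W i\<close>.\<close>

lemma gorenstein_projective_if_spliced:
  assumes W: "\<And>i::int. perp A (W i)" and P: "\<And>i. projective_module A (P i)"
    and s: "\<And>i. short_exact A (W i) (a i) (P i) (b i) (W (i + 1))"
  shows "gorenstein_projective A (W 0)"
proof -
  let ?A = "regular_module A"
  note reg = regular_module_left_module[OF ring_axioms]
  note Wf = perp_fg[OF W] and Pf = projective_module_fg[OF P]
  note Wlm = Wf[THEN fg_modulesD(1)] and Plm = Pf[THEN fg_modulesD(1)]
  note s' = short_exactD[OF s]
  have bc: "b i x \<in> carrier (W (i + 1))" if "x \<in> carrier (P i)" for i x by (rule mod_homD(1)[OF s'(2) that])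
  have ac: "a i x \<in> carrier (P i)" if "x \<in> carrier (W i)" for i x by (rule mod_homD(1)[OF s'(1) that])
  have a_zero: "a i x = \<zero>\<^bsub>P i\<^esub> \<longleftrightarrow> x = \<zero>\<^bsub>W i\<^esub>" if "x \<in> carrier (W i)" for i x
    using inj_onD[OF s'(3) _ that left_module_zero_closed[OF Wlm]] homD(4)[OF s'(1) Wlm Plm] by metis
  \<comment> \<open>\<open>D i\<close> is the splice \<open>P i \<rightarrow> W (i + 1) \<rightarrow> P (i + 1)\<close>.\<close>
  define D where "D i = compose (carrier (P i)) (a (i + 1)) (b i)" for i
  have D: "D i \<in> mod_hom A (P i) (P (i + 1))" for i
    unfolding D_def by (rule compose_mod_hom[OF Plm s'(2) s'(1)])
  have Dx: "D i x = a (i + 1) (b i x)" if "x \<in> carrier (P i)" for i x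
    unfolding D_def using that by (simp add: compose_def)
  have D_im: "D i ` carrier (P i) = a (i + 1) ` carrier (W (i + 1))" for i
    unfolding s'(5)[of i, symmetric] using Dx by (simp add: image_image)
  have D_ker: "a_kernel (P i) (P (i + 1)) (D i) = a i ` carrier (W i)" for i
    unfolding s'(4) a_kernel_def' by (simp add: Dx a_zero[OF bc] cong: conj_cong)
  have e: "i + 1 + 1 = i + 2" "i + 2 + 1 = i + 3" for i :: int by simp_all
  have ex: "D i ` carrier (P i) = a_kernel (P (i + 1)) (P (i + 2)) (D (i + 1))" for i
    by (rule trans[OF D_im D_ker[of "i + 1", unfolded e, symmetric]])
  have submod_im: "submod A (P (i + 1)) (D i ` carrier (P i))" for i
    by (intro module_hom.submod_image[OF module_homI[OF Plm Plm D]] left_module.submod_carrier Plm)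
  have hom_ex: "precomp (P (i + 1)) (D (i + 1)) ` mod_hom A (P (i + 2)) ?A =
      kernel (hom_group A (P (i + 1)) ?A) (hom_group A (P i) ?A) (precomp (P i) (D i))" (is "?B = ?Z") for i
  proof
    show "?B \<subseteq> ?Z"
    proof
      fix f assume "f \<in> ?B"
      then obtain g where g: "g \<in> mod_hom A (P (i + 2)) ?A" and f: "f = compose (carrier (P (i + 1))) g (D (i + 1))"
        unfolding precomp_def by blast
      have "f \<in> mod_hom A (P (i + 1)) ?A"
        unfolding f by (rule compose_mod_hom[OF Plm D[of "i + 1", unfolded e] g])
      moreover have "f (D i x) = \<zero>" if x: "x \<in> carrier (P i)" for x
      proof -
        have "D i x \<in> a_kernel (P (i + 1)) (P (i + 2)) (D (i + 1))" using ex x by blast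
        then show ?thesis unfolding f a_kernel_def' using homD(4)[OF g Plm reg] by (simp add: compose_def)
      qed
      ultimately show "f \<in> ?Z" unfolding mem_kernel_precomp_iff by simp
    qed
    let ?I = "(P (i + 2))\<lparr>carrier := D (i + 1) ` carrier (P (i + 1))\<rparr>"
    note D1 = D[of "i + 1", unfolded e]
    note im = submod_im[of "i + 1", unfolded e]
    have "hom_extends A ?I (\<lambda>x\<in>D (i + 1) ` carrier (P (i + 1)). x) (P (i + 2)) ?A"
    proof (rule perp_hom_extends[OF ring_axioms W submodule_fg[OF Pf im] Pf])
      have "D (i + 1) ` carrier (P (i + 1)) = a_kernel (P (i + 2)) (W (i + 3)) (b (i + 2))"
        by (rule trans[OF D_im[of "i + 1", unfolded e] s'(4)[of "i + 2", unfolded e]])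
      then show "short_exact A ?I (\<lambda>x\<in>D (i + 1) ` carrier (P (i + 1)). x) (P (i + 2)) (b (i + 2)) (W (i + 3))"
        using kernel_short_exact[OF Plm Wlm s'(2)[of "i + 2", unfolded e] s'(5)[of "i + 2", unfolded e]] by simp
    qed
    then show "?Z \<subseteq> ?B"
      using cocycles_le_coboundaries_iff[OF Plm Plm Plm reg D D1 im ex] by blast
  qed
  \<comment> \<open>Shift the index so that the image of the zeroth differential is \<open>W 0\<close>.\<close>
  have "complete_projective_resolution A (\<lambda>i. P (i - 1)) (\<lambda>i. D (i - 1))"
    unfolding complete_projective_resolution_def
  proof (intro conjI allI)
    fix i :: int
    have e: "i + 1 - 1 = i - 1 + 1" "i + 2 - 1 = i - 1 + 2" by simp_all
    show "projective_module A (P (i - 1))" by (rule P)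
    show "D (i - 1) \<in> mod_hom A (P (i - 1)) (P (i + 1 - 1))" unfolding e by (rule D)
    show "D (i - 1) ` carrier (P (i - 1)) = a_kernel (P (i + 1 - 1)) (P (i + 2 - 1)) (D (i + 1 - 1))"
      unfolding e by (rule ex)
    show "precomp (P (i + 1 - 1)) (D (i + 1 - 1)) ` mod_hom A (P (i + 2 - 1)) ?A =
      kernel (hom_group A (P (i + 1 - 1)) ?A) (hom_group A (P (i - 1)) ?A) (precomp (P (i - 1)) (D (i - 1)))"
      unfolding e by (rule hom_ex)
  qed
  moreover have "mod_iso A (W 0) ((P (1 - 1))\<lparr>carrier := D (0 - 1) ` carrier (P (0 - 1))\<rparr>)"
  proof -
    have im: "D (0 - 1) ` carrier (P (0 - 1)) = a 0 ` carrier (W 0)" using D_im[of "-1"] by simp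
    show ?thesis
      unfolding mod_iso_def im using corestrict_hom[OF s'(1)[of 0]] s'(3)[of 0]
      by (intro bexI[of _ "a 0"]) (simp_all add: bij_betw_def)
  qed
  ultimately show ?thesis unfolding gorenstein_projective_def using Wf[of 0] by blast
qed

theorem left_weakly_gorenstein_iff_frobenius:
  "left_weakly_gorenstein A \<longleftrightarrow> frobenius_category sgp_cat sgp_conf"
proof
  interpret S: extension_closed_class A "semi_gorenstein_projective A" by (rule extension_closed_perp)
  interpret exact_category sgp_cat sgp_conf by (rule S.exact)
  assume lwg: "left_weakly_gorenstein A"
  have emb: "\<exists>i P p N. projective_module A P \<and> perp A N \<and> short_exact A X i P p N" if "perp A X" for X
    by (rule gorenstein_projective_embeds, rule bspec[OF lwg[unfolded left_weakly_gorenstein_def]])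
      (use that semi_gorenstein_projective_iff_perp in blast)
  show "frobenius_category sgp_cat sgp_conf"
  proof
    fix X assume "X \<in> Ob sgp_cat"
    then have X: "perp A X" by (simp add: semi_gorenstein_projective_iff_perp)
    obtain P K i p where P: "projective_module A P" "perp A K" "short_exact A K i P p X"
      using perp_presentation[OF X] by blast
    have "deflation sgp_conf P X p"
      unfolding deflation_def using P X projective_perp[OF P(1)] by (auto simp: semi_gorenstein_projective_iff_perp)
    then show "\<exists>P p. projective_object sgp_cat sgp_conf P \<and> deflation sgp_conf P X p"
      using projective_module_imp_projective_object[OF P(1)] by blast
    obtain j Q q N where Q: "projective_module A Q" "perp A N" "short_exact A X j Q q N"
      using emb[OF X] by blast
    have infl: "inflation sgp_conf X Q j"
      unfolding inflation_def using Q X projective_perp[OF Q(1)] by (auto simp: semi_gorenstein_projective_iff_perp)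
    then show "\<exists>I i. injective_object sgp_cat sgp_conf I \<and> inflation sgp_conf X I i"
      using projective_module_imp_injective_object[OF Q(1)] by blast
    show "projective_object sgp_cat sgp_conf X \<longleftrightarrow> injective_object sgp_cat sgp_conf X"
    proof
      assume "projective_object sgp_cat sgp_conf X"
      then show "injective_object sgp_cat sgp_conf X"
        using projective_object_imp_projective_module projective_module_imp_injective_object by blast
    next
      \<comment> \<open>The embedding of an injective object into a projective module splits.\<close>
      assume inj: "injective_object sgp_cat sgp_conf X"
      have "(\<lambda>x\<in>carrier X. x) \<in> Mor sgp_cat X X" using id_hom[OF fg_modulesD(1)[OF perp_fg[OF X]]] by simp
      with inj infl obtain g where "g \<in> Mor sgp_cat Q X" "Cmp sgp_cat X Q X g j = (\<lambda>x\<in>carrier X. x)"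
        unfolding injective_object_def by blast
      then have g: "g \<in> mod_hom A Q X" "\<forall>x\<in>carrier X. g (j x) = x" by (simp_all add: compose_eq_restrict_iff)
      have "projective_module A X"
        by (rule projective_retract[OF perp_fg[OF X] Q(1) short_exactD(1)[OF Q(3)] g(1)]) (simp add: g(2))
      then show "projective_object sgp_cat sgp_conf X" by (rule projective_module_imp_projective_object)
    qed
  qed
next
  assume "frobenius_category sgp_cat sgp_conf"
  then interpret frobenius_category sgp_cat sgp_conf .
  let ?R = "\<lambda>M N. \<exists>P i p. projective_module A P \<and> short_exact A M i P p N"
  show "left_weakly_gorenstein A"
    unfolding left_weakly_gorenstein_def semi_gorenstein_projective_iff_perp
  proof
    fix M assume "M \<in> semi_gorenstein_projective A"
    then have M: "M \<in> {M. perp A M}" by (simp add: semi_gorenstein_projective_iff_perp)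
    have coszy: "\<exists>N\<in>{M. perp A M}. ?R X N" if "X \<in> {M. perp A M}" for X
    proof -
      have X: "X \<in> Ob sgp_cat" using that by (simp add: semi_gorenstein_projective_iff_perp)
      obtain I i where I: "injective_object sgp_cat sgp_conf I" "inflation sgp_conf X I i"
        using enough_injectives[OF X] by blast
      have "I \<in> Ob sgp_cat" using I(1) unfolding injective_object_def by blast
      then have "projective_module A I"
        using projective_iff_injective I(1) projective_object_imp_projective_module by blast
      moreover obtain p N where "perp A N" "short_exact A X i I p N"
        using I(2) unfolding inflation_def by (auto simp: semi_gorenstein_projective_iff_perp)
      ultimately show ?thesis by blast
    qed
    have syz: "\<exists>L\<in>{M. perp A M}. ?R L X" if "X \<in> {M. perp A M}" for X
      using perp_presentation[of X] that by blast
    obtain W where W: "W 0 = M" "\<And>i::int. perp A (W i)" "\<And>i. ?R (W i) (W (i + 1))"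
      using int_indexed_chain[of "{M. perp A M}" ?R M, OF coszy syz M] by blast
    then obtain P a b where "\<And>i. projective_module A (P i)" "\<And>i. short_exact A (W i) (a i) (P i) (b i) (W (i + 1))"
      by metis
    from gorenstein_projective_if_spliced[of W P a b, OF W(2) this] show "gorenstein_projective A M" using W(1) by simp
  qed
qed

end

theorem corollary2:
  fixes k :: "('k, 'r) ring_scheme" and \<phi> :: "'k \<Rightarrow> 'a" and A :: "('a, 's) ring_scheme"
  assumes "artin_algebra k \<phi> A"
  shows "left_weakly_gorenstein A \<longleftrightarrow>
    frobenius_category
      (full_subcategory A (semi_gorenstein_projective A))
      (canonical_conflations A (semi_gorenstein_projective A))"
proof -
  interpret artin_algebra k \<phi> A by (rule assms)
  interpret left_noetherian_ring A
    by unfold_locales (rule artin_algebra_noetherian[OF assms])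
  show ?thesis by (rule left_weakly_gorenstein_iff_frobenius)
qed

end
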